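(* Let $R$ be a commutative ring, $M$ an $R$-bimodule, $\phi=\langle C_\bullet,a,b\rangle$ a multiplicative elementary extension of $R$ by $M$, and let $R'$ be the square-zero extension of $R$ by $M$ corresponding to $\phi$, with projection $q:R'\to R$. Then $R'$ is commutative, and the canonical multiplicative splitting $C_{01}$ of the induced extension $e_*(\phi)$ in $\mathcal B(R,\mathbb Z)$ extends to a multiplicative splitting of the extension $q_*(\phi)$ in $\mathcal B(R,R')$.
   Context: Complexes are homologically graded, $E[m]_n=E_{n-m}$. An elementary extension of an object $A$ by an object $B$ of an abelian category is a complex $C_\bullet=[C_1\xrightarrow{d}C_0]$ in degrees $1,0$ with an exact sequence $0\to B\xrightarrow{b}C_1\xrightarrow{d}C_0\xrightarrow{a}A\to0$. A splitting of it is an object $C_{01}$ with maps $c_1:C_1\to C_{01}$ injective, $c_0:C_{01}\to C_0$ surjective, $c_0c_1=d$, $\operatorname{Ker}c_0=c_1(b(B))$. $R\text{-proj}$ is the category of finitely generated projective $R$-modules; for a ring $S$, $\mathcal B(R,S)$ is the abelian category of pointed functors ($F(0)=0$, not necessarily additive) $R\text{-proj}\to S\text{-mod}$; $\mathcal B(R)=\mathcal B(R,R)$. $\mathsf I(M)(V)=M\otimes_RV$, $\mathsf I=\mathsf I(R)$. An elementary extension of $R$ by $M$ is an elementary extension of $\mathsf I$ by $\mathsf I(M)$ in $\mathcal B(R)$. $e_*:\mathcal B(R)\to\mathcal B(R,\mathbb Z)$ and $q_*:\mathcal B(R)\to\mathcal B(R,R')$ are composition with the forgetful functor, resp. restriction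 of scalars along $q$. For $S$ commutative, a multiplicative structure on a complex $F_\bullet$ in $\mathcal B(R,S)$ is a map $S\to F_0(R)$ and functorial maps of complexes $F_\bullet(V)\otimes_SF_\bullet(V')\to F_\bullet(V\otimes_RV')$, $V,V'\in R\text{-proj}$, that are associative and unital. An elementary extension $\langle C_\bullet,a,b\rangle$ of $R$ by $M$ is multiplicative if $C_\bullet$ has a multiplicative structure such that $a:C_\bullet\to\mathsf I$ is multiplicative; then $e_*(\phi)$ (and $q_*(\phi)$ if $R'$ is commutative) is multiplicative in the same sense. A multiplicative splitting of such an extension is a splitting $\langle C_{01},c_0,c_1\rangle$ with a multiplicative structure on the complex $C^l_\bullet=[C_1\xrightarrow{c_1}C_{01}]$ (with $C_{01}$ in degree $0$) such that $l:C^l_\bullet\to C_\bullet$, given by $\mathrm{id}$ in degree $1$ and $c_0$ in degree $0$, is multiplicative. The splitting of $e_*(\phi)$ in $\mathcal B(R,\mathbb Z)$ is unique up to isomorphism, and its canonical multiplicative form is as follows. Let $s\in C_0(R)$ be the unit given by the multiplicative structure; for $v\in V$, viewed as a map $R\to V$, put $\tilde s(v)=C_0(v)(s)\in C_0(V)$. There is a unique functorial map $c(-,-):V\times V\to C_1(V)$ with $c(v,0)=c(0,v)=0$ and $d(c(v_1,v_2))=\tilde s(v_1)+\tilde s(v_2)-\tilde s(v_1+v_2)$. Put $C_{01}(V)=C_1(V)\times V$ with addition $(c,v)+(c',v')=(c+c'+c(v,v'),v+v')$, $c_1(c)=(c,0)$, $c_0(c,v)=d(c)+\tilde s(v)$,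 and product $C_{01}(V)\times C_{01}(V')\to C_{01}(V\otimes_RV')$, $(c,v)\cdot(c',v')=(c\cdot d(c')+c\cdot\tilde s(v')+\tilde s(v)\cdot c',\,v\otimes v')$. A square-zero extension of $R$ by $M$ is a ring $R'$ with an exact sequence $0\to M\xrightarrow{i}R'\xrightarrow{q}R\to0$ of abelian groups, $q$ a unital ring map, $i(m)r'=i(mq(r'))$, $r'i(m)=i(q(r')m)$, $i(m)i(m')=0$. The one corresponding to $\phi$ is the ring $R'$ of endomorphisms $r'$ of $C_{01}\in\mathcal B(R,\mathbb Z)$ for which there is a (unique) $r\in R$ with $c_0r'=rc_0$ and $r'c_1=c_1r$; $q(r')=r$ and $i(m)$ is $x\mapsto c_1(b(m\otimes a(c_0(x))))$. "Extends to a multiplicative splitting of $q_*(\phi)$" means that with the natural action of $R'$ on $C_{01}$, the same data form a multiplicative splitting in $\mathcal B(R,R')$. *)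

theory Defs
  imports "HOL-Algebra.Module" "HOL-Algebra.IntRing" "HOL-Algebra.Free_Abelian_Groups"
begin

section \<open>Modules, bimodules and tensor products\<close>

text \<open>
  Module homomorphisms are extensional functions, so that equality of morphisms is equality in HOL.
\<close>

definition mod_hom ::
  "('s, 'x) ring_scheme \<Rightarrow> ('s, 'a, 'y) module_scheme \<Rightarrow> ('s, 'b, 'z) module_scheme \<Rightarrow> ('a \<Rightarrow> 'b) set"
  where "mod_hom S X Y =
    {f \<in> (\<Pi>\<^sub>E x\<in>carrier X. carrier Y).
       (\<forall>x\<in>carrier X. \<forall>y\<in>carrier X. f (x \<oplus>\<^bsub>X\<^esub> y) = f x \<oplus>\<^bsub>Y\<^esub> f y) \<and>
       (\<forall>s\<in>carrier S. \<forall>x\<in>carrier X. f (s \<odot>\<^bsub>X\<^esub> x) = s \<odot>\<^bsub>Y\<^esub> f x)}"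

text \<open>
  The fields \<open>mult\<close> and \<open>one\<close> that a module record inherits from rings play no role.
\<close>

definition regular_module :: "'s ring \<Rightarrow> ('s, 's) module"
  where "regular_module S =
    \<lparr>carrier = carrier S, monoid.mult = monoid.mult S, one = one S,
     ring.zero = ring.zero S, add = add S, smult = monoid.mult S\<rparr>"

definition free_module :: "'r ring \<Rightarrow> nat \<Rightarrow> ('r, nat \<Rightarrow> 'r) module"
  where "free_module R n =
    \<lparr>carrier = (\<Pi>\<^sub>E i\<in>{..<n}. carrier R), monoid.mult = undefined, one = undefined,
     ring.zero = (\<lambda>i\<in>{..<n}. \<zero>\<^bsub>R\<^esub>),
     add = (\<lambda>x y. \<lambda>i\<in>{..<n}. x i \<oplus>\<^bsub>R\<^esub> y i),
     smult = (\<lambda>r x. \<lambda>i\<in>{..<n}. r \<otimes>\<^bsub>R\<^esub> x i)\<rparr>"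

definition zero_module :: "('s, unit) module"
  where "zero_module =
    \<lparr>carrier = UNIV, monoid.mult = (\<lambda>_ _. ()), one = (), ring.zero = (), add = (\<lambda>_ _. ()), smult = (\<lambda>_ _. ())\<rparr>"

text \<open>
  The objects of the category of finitely generated projective \<open>R\<close>-modules, i.e. of the direct
  summands of the modules \<open>R\<^sup>n\<close>, with carrier in the universe type \<^typ>\<open>'v\<close>. The morphisms
  are given by \<^const>\<open>mod_hom\<close>.
\<close>

definition proj_modules :: "'r ring \<Rightarrow> ('r, 'v) module set"
  where "proj_modules R =
    {V. module R V \<and>
        (\<exists>n. \<exists>j\<in>mod_hom R V (free_module R n). \<exists>p\<in>mod_hom R (free_module R n) V.
           \<forall>v\<in>carrier V. p (j v) = v)}"

record ('r, 'm) bimodule = "('r, 'm) module" +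
  rsmult :: "'m \<Rightarrow> 'r \<Rightarrow> 'm"

definition is_bimodule :: "'r ring \<Rightarrow> ('r, 'm) bimodule \<Rightarrow> bool"
  where "is_bimodule R M \<longleftrightarrow>
    module R M \<and>
    (\<forall>m\<in>carrier M. \<forall>r\<in>carrier R. rsmult M m r \<in> carrier M) \<and>
    (\<forall>m\<in>carrier M. \<forall>n\<in>carrier M. \<forall>r\<in>carrier R.
       rsmult M (m \<oplus>\<^bsub>M\<^esub> n) r = rsmult M m r \<oplus>\<^bsub>M\<^esub> rsmult M n r) \<and>
    (\<forall>m\<in>carrier M. \<forall>r\<in>carrier R. \<forall>s\<in>carrier R.
       rsmult M m (r \<oplus>\<^bsub>R\<^esub> s) = rsmult M m r \<oplus>\<^bsub>M\<^esub> rsmult M m s) \<and>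
    (\<forall>m\<in>carrier M. \<forall>r\<in>carrier R. \<forall>s\<in>carrier R.
       rsmult M m (r \<otimes>\<^bsub>R\<^esub> s) = rsmult M (rsmult M m r) s) \<and>
    (\<forall>m\<in>carrier M. rsmult M m \<one>\<^bsub>R\<^esub> = m) \<and>
    (\<forall>m\<in>carrier M. \<forall>r\<in>carrier R. \<forall>s\<in>carrier R.
       rsmult M (r \<odot>\<^bsub>M\<^esub> m) s = r \<odot>\<^bsub>M\<^esub> rsmult M m s)"

definition symmetric_bimodule :: "('r, 'v) module \<Rightarrow> ('r, 'v) bimodule"
  where "symmetric_bimodule V =
    \<lparr>carrier = carrier V, monoid.mult = monoid.mult V, one = one V, ring.zero = ring.zero V, add = add V,
     smult = smult V, rsmult = (\<lambda>v r. r \<odot>\<^bsub>V\<^esub> v)\<rparr>"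

text \<open>
  The tensor product of a bimodule \<open>M\<close> with a left module \<open>V\<close> over \<open>R\<close>: the free abelian group on
  \<open>M \<times> V\<close> modulo the biadditivity and balancing relations, with \<open>R\<close> acting through the left
  action on \<open>M\<close>. Its elements are cosets.
\<close>

definition tensor_relations ::
  "'r ring \<Rightarrow> ('r, 'm) bimodule \<Rightarrow> ('r, 'v) module \<Rightarrow> (('m \<times> 'v) \<Rightarrow>\<^sub>0 int) set"
  where "tensor_relations R M V =
    {frag_of (m \<oplus>\<^bsub>M\<^esub> m', v) - frag_of (m, v) - frag_of (m', v) | m m' v.
       m \<in> carrier M \<and> m' \<in> carrier M \<and> v \<in> carrier V} \<union>
    {frag_of (m, v \<oplus>\<^bsub>V\<^esub> v') - frag_of (m, v) - frag_of (m, v') | m v v'.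
       m \<in> carrier M \<and> v \<in> carrier V \<and> v' \<in> carrier V} \<union>
    {frag_of (rsmult M m r, v) - frag_of (m, r \<odot>\<^bsub>V\<^esub> v) | m r v.
       m \<in> carrier M \<and> r \<in> carrier R \<and> v \<in> carrier V}"

definition tensor_subgroup ::
  "'r ring \<Rightarrow> ('r, 'm) bimodule \<Rightarrow> ('r, 'v) module \<Rightarrow> (('m \<times> 'v) \<Rightarrow>\<^sub>0 int) set"
  where "tensor_subgroup R M V =
    generate (free_Abelian_group (carrier M \<times> carrier V)) (tensor_relations R M V)"

definition tensor_class ::
  "'r ring \<Rightarrow> ('r, 'm) bimodule \<Rightarrow> ('r, 'v) module \<Rightarrow> (('m \<times> 'v) \<Rightarrow>\<^sub>0 int) \<Rightarrow> (('m \<times> 'v) \<Rightarrow>\<^sub>0 int) set"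
  where "tensor_class R M V x =
    tensor_subgroup R M V #>\<^bsub>free_Abelian_group (carrier M \<times> carrier V)\<^esub> x"

definition tensor_elem ::
  "'r ring \<Rightarrow> ('r, 'm) bimodule \<Rightarrow> ('r, 'v) module \<Rightarrow> 'm \<Rightarrow> 'v \<Rightarrow> (('m \<times> 'v) \<Rightarrow>\<^sub>0 int) set"
  where "tensor_elem R M V m v = tensor_class R M V (frag_of (m, v))"

text \<open>
  In \<open>smult\<close> below and in \<open>tensor_functor\<close>, the classes in the union over the representatives \<open>x\<close> of
  a coset \<open>X\<close> all coincide, because the map on free abelian groups preserves the relations; the
  union is thus the image coset.
\<close>

definition tensor ::
  "'r ring \<Rightarrow> ('r, 'm) bimodule \<Rightarrow> ('r, 'v) module \<Rightarrow> ('r, (('m \<times> 'v) \<Rightarrow>\<^sub>0 int) set) module"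
  where "tensor R M V =
    (let G = free_Abelian_group (carrier M \<times> carrier V) Mod tensor_subgroup R M V in
     \<lparr>carrier = carrier G, monoid.mult = undefined, one = undefined, ring.zero = one G, add = monoid.mult G,
      smult = (\<lambda>r X. \<Union>x\<in>X. tensor_class R M V (frag_extend (\<lambda>(m, v). frag_of (r \<odot>\<^bsub>M\<^esub> m, v)) x))\<rparr>)"

section \<open>The tensor structure on finitely generated projective modules\<close>

text \<open>
  A choice of unit object and tensor products in the category of finitely generated projective
  modules with carriers in the type \<^typ>\<open>'v\<close>: a module \<open>unit_obj\<close> with a generator \<open>unit_gen\<close>
  that identifies it with \<open>R\<close>, and for all \<open>V\<close>, \<open>V'\<close> an object \<open>tens_obj V V'\<close> together with
  \<open>tens V V' v v'\<close>, the element \<open>v \<otimes> v'\<close>.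
\<close>

record ('r, 'v) tensor_data =
  unit_obj :: "('r, 'v) module"
  unit_gen :: 'v
  tens_obj :: "('r, 'v) module \<Rightarrow> ('r, 'v) module \<Rightarrow> ('r, 'v) module"
  tens :: "('r, 'v) module \<Rightarrow> ('r, 'v) module \<Rightarrow> 'v \<Rightarrow> 'v \<Rightarrow> 'v"

text \<open>
  The injection makes the universe large enough: since a summand of \<open>R\<^sup>n\<close> is isomorphic to a
  submodule of \<open>R\<^sup>n\<close>, every finitely generated projective module is then isomorphic to one with
  carrier in \<^typ>\<open>'v\<close>. In particular, \<open>proj_modules R\<close> is equivalent to the category of all
  finitely generated projective modules, and tensor data exist.
\<close>

definition is_tensor_data :: "'r ring \<Rightarrow> ('r, 'v) tensor_data \<Rightarrow> bool"
  where "is_tensor_data R K \<longleftrightarrow>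
    (\<exists>u :: 'r list \<Rightarrow> 'v. inj u) \<and>
    unit_obj K \<in> proj_modules R \<and>
    unit_gen K \<in> carrier (unit_obj K) \<and>
    bij_betw (\<lambda>r. r \<odot>\<^bsub>unit_obj K\<^esub> unit_gen K) (carrier R) (carrier (unit_obj K)) \<and>
    (\<forall>V\<in>proj_modules R. \<forall>V'\<in>proj_modules R.
       tens_obj K V V' \<in> proj_modules R \<and>
       (\<exists>h\<in>mod_hom R (tensor R (symmetric_bimodule V) V') (tens_obj K V V').
          bij_betw h (carrier (tensor R (symmetric_bimodule V) V')) (carrier (tens_obj K V V')) \<and>
          (\<forall>v\<in>carrier V. \<forall>v'\<in>carrier V'.
             h (tensor_elem R (symmetric_bimodule V) V' v v') = tens K V V' v v')))"

definition tens_map ::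
  "'r ring \<Rightarrow> ('r, 'v) tensor_data \<Rightarrow> ('r, 'v) module \<Rightarrow> ('r, 'v) module \<Rightarrow>
   ('r, 'v) module \<Rightarrow> ('r, 'v) module \<Rightarrow> ('v \<Rightarrow> 'v) \<Rightarrow> ('v \<Rightarrow> 'v) \<Rightarrow> 'v \<Rightarrow> 'v"
  where "tens_map R K V V' W W' f f' =
    (THE h. h \<in> mod_hom R (tens_obj K V V') (tens_obj K W W') \<and>
       (\<forall>v\<in>carrier V. \<forall>v'\<in>carrier V'. h (tens K V V' v v') = tens K W W' (f v) (f' v')))"

definition associator ::
  "'r ring \<Rightarrow> ('r, 'v) tensor_data \<Rightarrow> ('r, 'v) module \<Rightarrow> ('r, 'v) module \<Rightarrow> ('r, 'v) module \<Rightarrow> 'v \<Rightarrow> 'v"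
  where "associator R K V V' V'' =
    (THE h. h \<in> mod_hom R (tens_obj K (tens_obj K V V') V'') (tens_obj K V (tens_obj K V' V'')) \<and>
       (\<forall>v\<in>carrier V. \<forall>v'\<in>carrier V'. \<forall>v''\<in>carrier V''.
          h (tens K (tens_obj K V V') V'' (tens K V V' v v') v'') =
          tens K V (tens_obj K V' V'') v (tens K V' V'' v' v'')))"

definition left_unitor ::
  "'r ring \<Rightarrow> ('r, 'v) tensor_data \<Rightarrow> ('r, 'v) module \<Rightarrow> 'v \<Rightarrow> 'v"
  where "left_unitor R K V =
    (THE h. h \<in> mod_hom R (tens_obj K (unit_obj K) V) V \<and>
       (\<forall>v\<in>carrier V. h (tens K (unit_obj K) V (unit_gen K) v) = v))"

definition right_unitor ::
  "'r ring \<Rightarrow> ('r, 'v) tensor_data \<Rightarrow> ('r, 'v) module \<Rightarrow> 'v \<Rightarrow> 'v"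
  where "right_unitor R K V =
    (THE h. h \<in> mod_hom R (tens_obj K V (unit_obj K)) V \<and>
       (\<forall>v\<in>carrier V. h (tens K V (unit_obj K) v (unit_gen K)) = v))"

text \<open>The element \<open>v\<close> of \<open>V\<close>, viewed as a map from the unit object to \<open>V\<close>.\<close>

definition point ::
  "'r ring \<Rightarrow> ('r, 'v) tensor_data \<Rightarrow> ('r, 'v) module \<Rightarrow> 'v \<Rightarrow> 'v \<Rightarrow> 'v"
  where "point R K V v =
    (\<lambda>x\<in>carrier (unit_obj K).
       (THE r. r \<in> carrier R \<and> x = r \<odot>\<^bsub>unit_obj K\<^esub> unit_gen K) \<odot>\<^bsub>V\<^esub> v)"

section \<open>Pointed functors\<close>

text \<open>
  Functors from \<open>proj_modules R\<close> to \<open>S\<close>-modules; \<open>Ar F V W f\<close> is the value on \<open>f : V \<rightarrow> W\<close>.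
  The library's modules, hence the categories here, are over commutative rings \<open>S\<close>.
\<close>

record ('r, 'v, 's, 'c) modfun =
  Ob :: "('r, 'v) module \<Rightarrow> ('s, 'c) module"
  Ar :: "('r, 'v) module \<Rightarrow> ('r, 'v) module \<Rightarrow> ('v \<Rightarrow> 'v) \<Rightarrow> 'c \<Rightarrow> 'c"

definition pointed_functor :: "'r ring \<Rightarrow> 's ring \<Rightarrow> ('r, 'v, 's, 'c) modfun \<Rightarrow> bool"
  where "pointed_functor R S F \<longleftrightarrow>
    (\<forall>V\<in>proj_modules R. module S (Ob F V)) \<and>
    (\<forall>V\<in>proj_modules R. \<forall>W\<in>proj_modules R. \<forall>f\<in>mod_hom R V W.
       Ar F V W f \<in> mod_hom S (Ob F V) (Ob F W)) \<and>
    (\<forall>V\<in>proj_modules R. Ar F V V (\<lambda>v\<in>carrier V. v) = (\<lambda>x\<in>carrier (Ob F V). x)) \<and>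
    (\<forall>U\<in>proj_modules R. \<forall>V\<in>proj_modules R. \<forall>W\<in>proj_modules R.
       \<forall>f\<in>mod_hom R U V. \<forall>g\<in>mod_hom R V W.
         Ar F U W (compose (carrier U) g f) =
         compose (carrier (Ob F U)) (Ar F V W g) (Ar F U V f)) \<and>
    (\<forall>V\<in>proj_modules R. carrier V = {\<zero>\<^bsub>V\<^esub>} \<longrightarrow> carrier (Ob F V) = {\<zero>\<^bsub>Ob F V\<^esub>})"

definition nat_trans ::
  "'r ring \<Rightarrow> 's ring \<Rightarrow> ('r, 'v, 's, 'c) modfun \<Rightarrow> ('r, 'v, 's, 'd) modfun \<Rightarrow>
   (('r, 'v) module \<Rightarrow> 'c \<Rightarrow> 'd) set"
  where "nat_trans R S F G =
    {\<eta> \<in> extensional (proj_modules R).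
       (\<forall>V\<in>proj_modules R. \<eta> V \<in> mod_hom S (Ob F V) (Ob G V)) \<and>
       (\<forall>V\<in>proj_modules R. \<forall>W\<in>proj_modules R. \<forall>f\<in>mod_hom R V W. \<forall>x\<in>carrier (Ob F V).
          \<eta> W (Ar F V W f x) = Ar G V W f (\<eta> V x))}"

text \<open>The functor \<open>I\<close>, with \<open>R \<otimes> V\<close> identified with \<open>V\<close>, and the functor \<open>I(M)\<close>.\<close>

definition incl_functor :: "('r, 'v, 'r, 'v) modfun"
  where "incl_functor = \<lparr>Ob = (\<lambda>V. V), Ar = (\<lambda>V W f. f)\<rparr>"

definition tensor_functor ::
  "'r ring \<Rightarrow> ('r, 'm) bimodule \<Rightarrow> ('r, 'v, 'r, (('m \<times> 'v) \<Rightarrow>\<^sub>0 int) set) modfun"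
  where "tensor_functor R M =
    \<lparr>Ob = tensor R M,
     Ar = (\<lambda>V W f. \<lambda>X\<in>carrier (tensor R M V).
             \<Union>x\<in>X. tensor_class R M W (frag_extend (\<lambda>(m, v). frag_of (m, f v)) x))\<rparr>"

text \<open>
  Restriction of scalars along a ring map \<open>f\<close>. For the map from the integers it is the forgetful
  functor to abelian groups.
\<close>

definition restrict_module :: "('s \<Rightarrow> 't) \<Rightarrow> ('t, 'c) module \<Rightarrow> ('s, 'c) module"
  where "restrict_module f X =
    \<lparr>carrier = carrier X, monoid.mult = monoid.mult X, one = one X, ring.zero = ring.zero X, add = add X,
     smult = (\<lambda>s x. f s \<odot>\<^bsub>X\<^esub> x)\<rparr>"

definition restrict_functor :: "('s \<Rightarrow> 't) \<Rightarrow> ('r, 'v, 't, 'c) modfun \<Rightarrow> ('r, 'v, 's, 'c) modfun"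
  where "restrict_functor f F = \<lparr>Ob = (\<lambda>V. restrict_module f (Ob F V)), Ar = Ar F\<rparr>"

definition from_int :: "'r ring \<Rightarrow> int \<Rightarrow> 'r"
  where "from_int R n = add_pow R n \<one>\<^bsub>R\<^esub>"

section \<open>Elementary extensions and splittings\<close>

text \<open>Complexes concentrated in homological degrees 1 and 0.\<close>

record ('r, 'v, 's, 'c1, 'c0) cpx =
  deg1 :: "('r, 'v, 's, 'c1) modfun"
  deg0 :: "('r, 'v, 's, 'c0) modfun"
  diff :: "('r, 'v) module \<Rightarrow> 'c1 \<Rightarrow> 'c0"

definition is_cpx :: "'r ring \<Rightarrow> 's ring \<Rightarrow> ('r, 'v, 's, 'c1, 'c0, 'z) cpx_scheme \<Rightarrow> bool"
  where "is_cpx R S C \<longleftrightarrow>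
    pointed_functor R S (deg1 C) \<and> pointed_functor R S (deg0 C) \<and>
    diff C \<in> nat_trans R S (deg1 C) (deg0 C)"

record ('r, 'v, 's, 'c1, 'c0, 'a, 'b) elext = "('r, 'v, 's, 'c1, 'c0) cpx" +
  aug :: "('r, 'v) module \<Rightarrow> 'c0 \<Rightarrow> 'a"
  inc :: "('r, 'v) module \<Rightarrow> 'b \<Rightarrow> 'c1"

text \<open>
  An elementary extension of \<open>A\<close> by \<open>B\<close>. Exactness in a functor category is pointwise.
\<close>

definition elementary_extension ::
  "'r ring \<Rightarrow> 's ring \<Rightarrow> ('r, 'v, 's, 'a) modfun \<Rightarrow> ('r, 'v, 's, 'b) modfun \<Rightarrow>
   ('r, 'v, 's, 'c1, 'c0, 'a, 'b) elext \<Rightarrow> bool"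
  where "elementary_extension R S A B E \<longleftrightarrow>
    pointed_functor R S A \<and> pointed_functor R S B \<and> is_cpx R S E \<and>
    aug E \<in> nat_trans R S (deg0 E) A \<and> inc E \<in> nat_trans R S B (deg1 E) \<and>
    (\<forall>V\<in>proj_modules R.
       inj_on (inc E V) (carrier (Ob B V)) \<and>
       inc E V ` carrier (Ob B V) = {x \<in> carrier (Ob (deg1 E) V). diff E V x = \<zero>\<^bsub>Ob (deg0 E) V\<^esub>} \<and>
       diff E V ` carrier (Ob (deg1 E) V) = {x \<in> carrier (Ob (deg0 E) V). aug E V x = \<zero>\<^bsub>Ob A V\<^esub>} \<and>
       aug E V ` carrier (Ob (deg0 E) V) = carrier (Ob A V))"

definition restrict_elext ::
  "('s \<Rightarrow> 't) \<Rightarrow> ('r, 'v, 't, 'c1, 'c0, 'a, 'b) elext \<Rightarrow> ('r, 'v, 's, 'c1, 'c0, 'a, 'b) elext"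
  where "restrict_elext f E =
    \<lparr>deg1 = restrict_functor f (deg1 E), deg0 = restrict_functor f (deg0 E),
     diff = diff E, aug = aug E, inc = inc E\<rparr>"

definition splitting ::
  "'r ring \<Rightarrow> 's ring \<Rightarrow> ('r, 'v, 's, 'b) modfun \<Rightarrow> ('r, 'v, 's, 'c1, 'c0, 'a, 'b) elext \<Rightarrow>
   ('r, 'v, 's, 'c) modfun \<Rightarrow> (('r, 'v) module \<Rightarrow> 'c \<Rightarrow> 'c0) \<Rightarrow> (('r, 'v) module \<Rightarrow> 'c1 \<Rightarrow> 'c) \<Rightarrow> bool"
  where "splitting R S B E F c0 c1 \<longleftrightarrow>
    pointed_functor R S F \<and>
    c1 \<in> nat_trans R S (deg1 E) F \<and> c0 \<in> nat_trans R S F (deg0 E) \<and>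
    (\<forall>V\<in>proj_modules R.
       inj_on (c1 V) (carrier (Ob (deg1 E) V)) \<and>
       c0 V ` carrier (Ob F V) = carrier (Ob (deg0 E) V) \<and>
       (\<forall>x\<in>carrier (Ob (deg1 E) V). c0 V (c1 V x) = diff E V x) \<and>
       {y \<in> carrier (Ob F V). c0 V y = \<zero>\<^bsub>Ob (deg0 E) V\<^esub>} = c1 V ` inc E V ` carrier (Ob B V))"

section \<open>Multiplicative structures\<close>

definition bilinear_map ::
  "'s ring \<Rightarrow> ('s, 'a) module \<Rightarrow> ('s, 'b) module \<Rightarrow> ('s, 'c) module \<Rightarrow> ('a \<Rightarrow> 'b \<Rightarrow> 'c) \<Rightarrow> bool"
  where "bilinear_map S X Y Z \<beta> \<longleftrightarrow>
    (\<forall>x\<in>carrier X. \<forall>y\<in>carrier Y. \<beta> x y \<in> carrier Z) \<and>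
    (\<forall>x\<in>carrier X. \<forall>x'\<in>carrier X. \<forall>y\<in>carrier Y. \<beta> (x \<oplus>\<^bsub>X\<^esub> x') y = \<beta> x y \<oplus>\<^bsub>Z\<^esub> \<beta> x' y) \<and>
    (\<forall>x\<in>carrier X. \<forall>y\<in>carrier Y. \<forall>y'\<in>carrier Y. \<beta> x (y \<oplus>\<^bsub>Y\<^esub> y') = \<beta> x y \<oplus>\<^bsub>Z\<^esub> \<beta> x y') \<and>
    (\<forall>s\<in>carrier S. \<forall>x\<in>carrier X. \<forall>y\<in>carrier Y.
       \<beta> (s \<odot>\<^bsub>X\<^esub> x) y = s \<odot>\<^bsub>Z\<^esub> \<beta> x y \<and> \<beta> x (s \<odot>\<^bsub>Y\<^esub> y) = s \<odot>\<^bsub>Z\<^esub> \<beta> x y)"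

text \<open>
  The unit map and the products
  \<open>F\<^sub>i(V) \<times> F\<^sub>j(V') \<rightarrow> F\<^sub>i\<^sub>+\<^sub>j(V \<otimes> V')\<close> for \<open>(i, j) = (0, 0), (1, 0), (0, 1)\<close>. A map out of a
  tensor product over \<open>S\<close> is given as a bilinear map.
\<close>

record ('r, 'v, 's, 'c1, 'c0) mult_data =
  munit :: "'s \<Rightarrow> 'c0"
  m00 :: "('r, 'v) module \<Rightarrow> ('r, 'v) module \<Rightarrow> 'c0 \<Rightarrow> 'c0 \<Rightarrow> 'c0"
  m10 :: "('r, 'v) module \<Rightarrow> ('r, 'v) module \<Rightarrow> 'c1 \<Rightarrow> 'c0 \<Rightarrow> 'c1"
  m01 :: "('r, 'v) module \<Rightarrow> ('r, 'v) module \<Rightarrow> 'c0 \<Rightarrow> 'c1 \<Rightarrow> 'c1"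

definition mult_bilinear ::
  "'r ring \<Rightarrow> ('r, 'v) tensor_data \<Rightarrow> 's ring \<Rightarrow> ('r, 'v, 's, 'c1, 'c0, 'z) cpx_scheme \<Rightarrow>
   ('r, 'v, 's, 'c1, 'c0) mult_data \<Rightarrow> bool"
  where "mult_bilinear R K S C \<mu> \<longleftrightarrow>
    (\<forall>V\<in>proj_modules R. \<forall>V'\<in>proj_modules R.
       bilinear_map S (Ob (deg0 C) V) (Ob (deg0 C) V') (Ob (deg0 C) (tens_obj K V V')) (m00 \<mu> V V') \<and>
       bilinear_map S (Ob (deg1 C) V) (Ob (deg0 C) V') (Ob (deg1 C) (tens_obj K V V')) (m10 \<mu> V V') \<and>
       bilinear_map S (Ob (deg0 C) V) (Ob (deg1 C) V') (Ob (deg1 C) (tens_obj K V V')) (m01 \<mu> V V'))"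

definition mult_functorial ::
  "'r ring \<Rightarrow> ('r, 'v) tensor_data \<Rightarrow> ('r, 'v, 's, 'c1, 'c0, 'z) cpx_scheme \<Rightarrow>
   ('r, 'v, 's, 'c1, 'c0) mult_data \<Rightarrow> bool"
  where "mult_functorial R K C \<mu> \<longleftrightarrow>
    (\<forall>V\<in>proj_modules R. \<forall>V'\<in>proj_modules R. \<forall>W\<in>proj_modules R. \<forall>W'\<in>proj_modules R.
     \<forall>f\<in>mod_hom R V W. \<forall>f'\<in>mod_hom R V' W'.
       (\<forall>x\<in>carrier (Ob (deg0 C) V). \<forall>x'\<in>carrier (Ob (deg0 C) V').
          Ar (deg0 C) (tens_obj K V V') (tens_obj K W W') (tens_map R K V V' W W' f f') (m00 \<mu> V V' x x') =
          m00 \<mu> W W' (Ar (deg0 C) V W f x) (Ar (deg0 C) V' W' f' x')) \<and>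
       (\<forall>x\<in>carrier (Ob (deg1 C) V). \<forall>x'\<in>carrier (Ob (deg0 C) V').
          Ar (deg1 C) (tens_obj K V V') (tens_obj K W W') (tens_map R K V V' W W' f f') (m10 \<mu> V V' x x') =
          m10 \<mu> W W' (Ar (deg1 C) V W f x) (Ar (deg0 C) V' W' f' x')) \<and>
       (\<forall>x\<in>carrier (Ob (deg0 C) V). \<forall>x'\<in>carrier (Ob (deg1 C) V').
          Ar (deg1 C) (tens_obj K V V') (tens_obj K W W') (tens_map R K V V' W W' f f') (m01 \<mu> V V' x x') =
          m01 \<mu> W W' (Ar (deg0 C) V W f x) (Ar (deg1 C) V' W' f' x')))"

text \<open>
  The last equation is the compatibility with the differential in degree 2: it says that
  \<open>d(c \<otimes> c') = d(c) \<otimes> c' - c \<otimes> d(c')\<close> goes to zero.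
\<close>

definition mult_chain_map ::
  "'r ring \<Rightarrow> ('r, 'v) tensor_data \<Rightarrow> ('r, 'v, 's, 'c1, 'c0, 'z) cpx_scheme \<Rightarrow>
   ('r, 'v, 's, 'c1, 'c0) mult_data \<Rightarrow> bool"
  where "mult_chain_map R K C \<mu> \<longleftrightarrow>
    (\<forall>V\<in>proj_modules R. \<forall>V'\<in>proj_modules R.
       (\<forall>c\<in>carrier (Ob (deg1 C) V). \<forall>x\<in>carrier (Ob (deg0 C) V').
          diff C (tens_obj K V V') (m10 \<mu> V V' c x) = m00 \<mu> V V' (diff C V c) x) \<and>
       (\<forall>x\<in>carrier (Ob (deg0 C) V). \<forall>c\<in>carrier (Ob (deg1 C) V').
          diff C (tens_obj K V V') (m01 \<mu> V V' x c) = m00 \<mu> V V' x (diff C V' c)) \<and>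
       (\<forall>c\<in>carrier (Ob (deg1 C) V). \<forall>c'\<in>carrier (Ob (deg1 C) V').
          m01 \<mu> V V' (diff C V c) c' = m10 \<mu> V V' c (diff C V' c')))"

definition mult_associative ::
  "'r ring \<Rightarrow> ('r, 'v) tensor_data \<Rightarrow> ('r, 'v, 's, 'c1, 'c0, 'z) cpx_scheme \<Rightarrow>
   ('r, 'v, 's, 'c1, 'c0) mult_data \<Rightarrow> bool"
  where "mult_associative R K C \<mu> \<longleftrightarrow>
    (\<forall>U\<in>proj_modules R. \<forall>V\<in>proj_modules R. \<forall>W\<in>proj_modules R.
       let UV = tens_obj K U V; VW = tens_obj K V W;
           L = tens_obj K UV W; N = tens_obj K U VW;
           \<alpha>0 = Ar (deg0 C) L N (associator R K U V W);
           \<alpha>1 = Ar (deg1 C) L N (associator R K U V W)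
       in
       (\<forall>x\<in>carrier (Ob (deg0 C) U). \<forall>y\<in>carrier (Ob (deg0 C) V). \<forall>z\<in>carrier (Ob (deg0 C) W).
          \<alpha>0 (m00 \<mu> UV W (m00 \<mu> U V x y) z) = m00 \<mu> U VW x (m00 \<mu> V W y z)) \<and>
       (\<forall>x\<in>carrier (Ob (deg1 C) U). \<forall>y\<in>carrier (Ob (deg0 C) V). \<forall>z\<in>carrier (Ob (deg0 C) W).
          \<alpha>1 (m10 \<mu> UV W (m10 \<mu> U V x y) z) = m10 \<mu> U VW x (m00 \<mu> V W y z)) \<and>
       (\<forall>x\<in>carrier (Ob (deg0 C) U). \<forall>y\<in>carrier (Ob (deg1 C) V). \<forall>z\<in>carrier (Ob (deg0 C) W).
          \<alpha>1 (m10 \<mu> UV W (m01 \<mu> U V x y) z) = m01 \<mu> U VW x (m10 \<mu> V W y z)) \<and>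
       (\<forall>x\<in>carrier (Ob (deg0 C) U). \<forall>y\<in>carrier (Ob (deg0 C) V). \<forall>z\<in>carrier (Ob (deg1 C) W).
          \<alpha>1 (m01 \<mu> UV W (m00 \<mu> U V x y) z) = m01 \<mu> U VW x (m01 \<mu> V W y z)))"

definition mult_unital ::
  "'r ring \<Rightarrow> ('r, 'v) tensor_data \<Rightarrow> 's ring \<Rightarrow> ('r, 'v, 's, 'c1, 'c0, 'z) cpx_scheme \<Rightarrow>
   ('r, 'v, 's, 'c1, 'c0) mult_data \<Rightarrow> bool"
  where "mult_unital R K S C \<mu> \<longleftrightarrow>
    (let U = unit_obj K; s = munit \<mu> \<one>\<^bsub>S\<^esub> in
     \<forall>V\<in>proj_modules R.
       (\<forall>x\<in>carrier (Ob (deg0 C) V).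
          Ar (deg0 C) (tens_obj K U V) V (left_unitor R K V) (m00 \<mu> U V s x) = x \<and>
          Ar (deg0 C) (tens_obj K V U) V (right_unitor R K V) (m00 \<mu> V U x s) = x) \<and>
       (\<forall>x\<in>carrier (Ob (deg1 C) V).
          Ar (deg1 C) (tens_obj K U V) V (left_unitor R K V) (m01 \<mu> U V s x) = x \<and>
          Ar (deg1 C) (tens_obj K V U) V (right_unitor R K V) (m10 \<mu> V U x s) = x))"

definition mult_structure ::
  "'r ring \<Rightarrow> ('r, 'v) tensor_data \<Rightarrow> 's ring \<Rightarrow> ('r, 'v, 's, 'c1, 'c0, 'z) cpx_scheme \<Rightarrow>
   ('r, 'v, 's, 'c1, 'c0) mult_data \<Rightarrow> bool"
  where "mult_structure R K S C \<mu> \<longleftrightarrow>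
    cring S \<and> is_cpx R S C \<and>
    munit \<mu> \<in> mod_hom S (regular_module S) (Ob (deg0 C) (unit_obj K)) \<and>
    mult_bilinear R K S C \<mu> \<and> mult_functorial R K C \<mu> \<and> mult_chain_map R K C \<mu> \<and>
    mult_associative R K C \<mu> \<and> mult_unital R K S C \<mu>"

text \<open>The map of complexes \<open>(f1, f0)\<close> from \<open>C\<close> to \<open>D\<close> is multiplicative.\<close>

definition multiplicative_map ::
  "'r ring \<Rightarrow> ('r, 'v) tensor_data \<Rightarrow> 's ring \<Rightarrow>
   ('r, 'v, 's, 'c1, 'c0, 'y) cpx_scheme \<Rightarrow> ('r, 'v, 's, 'c1, 'c0) mult_data \<Rightarrow>
   ('r, 'v, 's, 'd1, 'd0, 'z) cpx_scheme \<Rightarrow> ('r, 'v, 's, 'd1, 'd0) mult_data \<Rightarrow>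
   (('r, 'v) module \<Rightarrow> 'c1 \<Rightarrow> 'd1) \<Rightarrow> (('r, 'v) module \<Rightarrow> 'c0 \<Rightarrow> 'd0) \<Rightarrow> bool"
  where "multiplicative_map R K S C \<mu> D \<nu> f1 f0 \<longleftrightarrow>
    f1 \<in> nat_trans R S (deg1 C) (deg1 D) \<and> f0 \<in> nat_trans R S (deg0 C) (deg0 D) \<and>
    (\<forall>V\<in>proj_modules R. \<forall>x\<in>carrier (Ob (deg1 C) V). f0 V (diff C V x) = diff D V (f1 V x)) \<and>
    (\<forall>s\<in>carrier S. f0 (unit_obj K) (munit \<mu> s) = munit \<nu> s) \<and>
    (\<forall>V\<in>proj_modules R. \<forall>V'\<in>proj_modules R.
       (\<forall>x\<in>carrier (Ob (deg0 C) V). \<forall>y\<in>carrier (Ob (deg0 C) V').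
          f0 (tens_obj K V V') (m00 \<mu> V V' x y) = m00 \<nu> V V' (f0 V x) (f0 V' y)) \<and>
       (\<forall>x\<in>carrier (Ob (deg1 C) V). \<forall>y\<in>carrier (Ob (deg0 C) V').
          f1 (tens_obj K V V') (m10 \<mu> V V' x y) = m10 \<nu> V V' (f1 V x) (f0 V' y)) \<and>
       (\<forall>x\<in>carrier (Ob (deg0 C) V). \<forall>y\<in>carrier (Ob (deg1 C) V').
          f1 (tens_obj K V V') (m01 \<mu> V V' x y) = m01 \<nu> V V' (f0 V x) (f1 V' y)))"

text \<open>\<open>I\<close> as a complex concentrated in degree 0, with its tautological multiplicative structure.\<close>

definition incl_cpx :: "'r ring \<Rightarrow> ('r, 'v, 'r, unit, 'v) cpx"
  where "incl_cpx R =
    \<lparr>deg1 = \<lparr>Ob = (\<lambda>V. zero_module), Ar = (\<lambda>V W f x. ())\<rparr>, deg0 = incl_functor,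
     diff = (\<lambda>V\<in>proj_modules R. \<lambda>x\<in>UNIV. \<zero>\<^bsub>V\<^esub>)\<rparr>"

definition incl_mult :: "'r ring \<Rightarrow> ('r, 'v) tensor_data \<Rightarrow> ('r, 'v, 'r, unit, 'v) mult_data"
  where "incl_mult R K =
    \<lparr>munit = (\<lambda>r\<in>carrier R. r \<odot>\<^bsub>unit_obj K\<^esub> unit_gen K), m00 = tens K,
     m10 = (\<lambda>V V' x y. ()), m01 = (\<lambda>V V' x y. ())\<rparr>"

text \<open>
  \<open>\<phi>\<close> is an elementary extension of \<open>R\<close> by \<open>M\<close>, multiplicative with respect to \<open>\<mu>\<close>.
\<close>

definition multiplicative_extension ::
  "'r ring \<Rightarrow> ('r, 'v) tensor_data \<Rightarrow> ('r, 'm) bimodule \<Rightarrow>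
   ('r, 'v, 'r, 'c1, 'c0, 'v, (('m \<times> 'v) \<Rightarrow>\<^sub>0 int) set) elext \<Rightarrow>
   ('r, 'v, 'r, 'c1, 'c0) mult_data \<Rightarrow> bool"
  where "multiplicative_extension R K M \<phi> \<mu> \<longleftrightarrow>
    elementary_extension R R incl_functor (tensor_functor R M) \<phi> \<and>
    mult_structure R K R \<phi> \<mu> \<and>
    multiplicative_map R K R \<phi> \<mu> (incl_cpx R) (incl_mult R K)
      (\<lambda>V\<in>proj_modules R. \<lambda>x\<in>carrier (Ob (deg1 \<phi>) V). ()) (aug \<phi>)"

definition restrict_mult ::
  "'s ring \<Rightarrow> ('s \<Rightarrow> 't) \<Rightarrow> ('r, 'v, 't, 'c1, 'c0) mult_data \<Rightarrow> ('r, 'v, 's, 'c1, 'c0) mult_data"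
  where "restrict_mult S f \<mu> =
    \<lparr>munit = (\<lambda>s\<in>carrier S. munit \<mu> (f s)), m00 = m00 \<mu>, m10 = m10 \<mu>, m01 = m01 \<mu>\<rparr>"

text \<open>
  \<open>\<langle>F, c0, c1\<rangle>\<close> with \<open>\<nu>\<close> is a multiplicative splitting of \<open>E\<close>, the latter with multiplicative
  structure \<open>\<mu>\<close>.
\<close>

definition multiplicative_splitting ::
  "'r ring \<Rightarrow> ('r, 'v) tensor_data \<Rightarrow> 's ring \<Rightarrow> ('r, 'v, 's, 'b) modfun \<Rightarrow>
   ('r, 'v, 's, 'c1, 'c0, 'a, 'b) elext \<Rightarrow> ('r, 'v, 's, 'c1, 'c0) mult_data \<Rightarrow>
   ('r, 'v, 's, 'c) modfun \<Rightarrow> (('r, 'v) module \<Rightarrow> 'c \<Rightarrow> 'c0) \<Rightarrow> (('r, 'v) module \<Rightarrow> 'c1 \<Rightarrow> 'c) \<Rightarrow>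
   ('r, 'v, 's, 'c1, 'c) mult_data \<Rightarrow> bool"
  where "multiplicative_splitting R K S B E \<mu> F c0 c1 \<nu> \<longleftrightarrow>
    splitting R S B E F c0 c1 \<and>
    (let Cl = \<lparr>deg1 = deg1 E, deg0 = F, diff = c1\<rparr> in
     mult_structure R K S Cl \<nu> \<and>
     multiplicative_map R K S Cl \<nu> E \<mu>
       (\<lambda>V\<in>proj_modules R. \<lambda>x\<in>carrier (Ob (deg1 E) V). x) c0)"

section \<open>The canonical splitting\<close>

definition s_tilde ::
  "'r ring \<Rightarrow> ('r, 'v) tensor_data \<Rightarrow> ('r, 'v, 'r, 'c1, 'c0, 'a, 'b) elext \<Rightarrow>
   ('r, 'v, 'r, 'c1, 'c0) mult_data \<Rightarrow> ('r, 'v) module \<Rightarrow> 'v \<Rightarrow> 'c0"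
  where "s_tilde R K \<phi> \<mu> V v = Ar (deg0 \<phi>) (unit_obj K) V (point R K V v) (munit \<mu> \<one>\<^bsub>R\<^esub>)"

definition is_defect ::
  "'r ring \<Rightarrow> ('r, 'v) tensor_data \<Rightarrow> ('r, 'v, 'r, 'c1, 'c0, 'a, 'b) elext \<Rightarrow>
   ('r, 'v, 'r, 'c1, 'c0) mult_data \<Rightarrow> (('r, 'v) module \<Rightarrow> 'v \<Rightarrow> 'v \<Rightarrow> 'c1) \<Rightarrow> bool"
  where "is_defect R K \<phi> \<mu> c \<longleftrightarrow>
    (\<forall>V\<in>proj_modules R. \<forall>v\<in>carrier V. \<forall>w\<in>carrier V. c V v w \<in> carrier (Ob (deg1 \<phi>) V)) \<and>
    (\<forall>V\<in>proj_modules R. \<forall>W\<in>proj_modules R. \<forall>f\<in>mod_hom R V W. \<forall>v\<in>carrier V. \<forall>w\<in>carrier V.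
       Ar (deg1 \<phi>) V W f (c V v w) = c W (f v) (f w)) \<and>
    (\<forall>V\<in>proj_modules R. \<forall>v\<in>carrier V.
       c V v \<zero>\<^bsub>V\<^esub> = \<zero>\<^bsub>Ob (deg1 \<phi>) V\<^esub> \<and> c V \<zero>\<^bsub>V\<^esub> v = \<zero>\<^bsub>Ob (deg1 \<phi>) V\<^esub>) \<and>
    (\<forall>V\<in>proj_modules R. \<forall>v\<in>carrier V. \<forall>w\<in>carrier V.
       diff \<phi> V (c V v w) =
         s_tilde R K \<phi> \<mu> V v \<oplus>\<^bsub>Ob (deg0 \<phi>) V\<^esub> s_tilde R K \<phi> \<mu> V w
           \<ominus>\<^bsub>Ob (deg0 \<phi>) V\<^esub> s_tilde R K \<phi> \<mu> V (v \<oplus>\<^bsub>V\<^esub> w))"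

text \<open>
  The map \<open>c(-,-)\<close>. Its values on the carriers of projective modules are determined by
  \<^const>\<open>is_defect\<close>; the choice only concerns values outside.
\<close>

definition defect ::
  "'r ring \<Rightarrow> ('r, 'v) tensor_data \<Rightarrow> ('r, 'v, 'r, 'c1, 'c0, 'a, 'b) elext \<Rightarrow>
   ('r, 'v, 'r, 'c1, 'c0) mult_data \<Rightarrow> ('r, 'v) module \<Rightarrow> 'v \<Rightarrow> 'v \<Rightarrow> 'c1"
  where "defect R K \<phi> \<mu> = (SOME c. is_defect R K \<phi> \<mu> c)"

text \<open>The abelian group \<open>C\<^sub>0\<^sub>1(V)\<close>, with a given scalar action.\<close>

definition C01_group ::
  "'r ring \<Rightarrow> ('r, 'v) tensor_data \<Rightarrow> ('r, 'v, 'r, 'c1, 'c0, 'a, 'b) elext \<Rightarrow>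
   ('r, 'v, 'r, 'c1, 'c0) mult_data \<Rightarrow> ('r, 'v) module \<Rightarrow> ('c1 \<times> 'v) ring"
  where "C01_group R K \<phi> \<mu> V =
    \<lparr>carrier = carrier (Ob (deg1 \<phi>) V) \<times> carrier V, monoid.mult = undefined, one = undefined,
     ring.zero = (\<zero>\<^bsub>Ob (deg1 \<phi>) V\<^esub>, \<zero>\<^bsub>V\<^esub>),
     add = (\<lambda>(c, v) (c', v').
       (c \<oplus>\<^bsub>Ob (deg1 \<phi>) V\<^esub> c' \<oplus>\<^bsub>Ob (deg1 \<phi>) V\<^esub> defect R K \<phi> \<mu> V v v', v \<oplus>\<^bsub>V\<^esub> v'))\<rparr>"

definition C01_functor ::
  "'r ring \<Rightarrow> ('r, 'v) tensor_data \<Rightarrow> ('r, 'v, 'r, 'c1, 'c0, 'a, 'b) elext \<Rightarrow>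
   ('r, 'v, 'r, 'c1, 'c0) mult_data \<Rightarrow>
   (('r, 'v) module \<Rightarrow> 's \<Rightarrow> 'c1 \<times> 'v \<Rightarrow> 'c1 \<times> 'v) \<Rightarrow> ('r, 'v, 's, 'c1 \<times> 'v) modfun"
  where "C01_functor R K \<phi> \<mu> act =
    \<lparr>Ob = (\<lambda>V. let G = C01_group R K \<phi> \<mu> V in
        \<lparr>carrier = carrier G, monoid.mult = monoid.mult G, one = one G,
         ring.zero = ring.zero G, add = add G, smult = act V\<rparr>),
     Ar = (\<lambda>V W f. \<lambda>(c, v)\<in>carrier (C01_group R K \<phi> \<mu> V). (Ar (deg1 \<phi>) V W f c, f v))\<rparr>"

definition C01_int ::
  "'r ring \<Rightarrow> ('r, 'v) tensor_data \<Rightarrow> ('r, 'v, 'r, 'c1, 'c0, 'a, 'b) elext \<Rightarrow>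
   ('r, 'v, 'r, 'c1, 'c0) mult_data \<Rightarrow> ('r, 'v, int, 'c1 \<times> 'v) modfun"
  where "C01_int R K \<phi> \<mu> = C01_functor R K \<phi> \<mu> (\<lambda>V n x. add_pow (C01_group R K \<phi> \<mu> V) n x)"

definition C01_c1 ::
  "'r ring \<Rightarrow> ('r, 'v, 'r, 'c1, 'c0, 'a, 'b) elext \<Rightarrow> ('r, 'v) module \<Rightarrow> 'c1 \<Rightarrow> 'c1 \<times> 'v"
  where "C01_c1 R \<phi> = (\<lambda>V\<in>proj_modules R. \<lambda>c\<in>carrier (Ob (deg1 \<phi>) V). (c, \<zero>\<^bsub>V\<^esub>))"

definition C01_c0 ::
  "'r ring \<Rightarrow> ('r, 'v) tensor_data \<Rightarrow> ('r, 'v, 'r, 'c1, 'c0, 'a, 'b) elext \<Rightarrow>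
   ('r, 'v, 'r, 'c1, 'c0) mult_data \<Rightarrow> ('r, 'v) module \<Rightarrow> 'c1 \<times> 'v \<Rightarrow> 'c0"
  where "C01_c0 R K \<phi> \<mu> =
    (\<lambda>V\<in>proj_modules R. \<lambda>(c, v)\<in>carrier (C01_group R K \<phi> \<mu> V).
       diff \<phi> V c \<oplus>\<^bsub>Ob (deg0 \<phi>) V\<^esub> s_tilde R K \<phi> \<mu> V v)"

text \<open>
  The multiplicative structure on \<open>[C\<^sub>1 \<rightarrow> C\<^sub>0\<^sub>1]\<close> over \<open>S\<close>, with unit \<open>(0, 1)\<close>; \<open>act\<close> is the action
  of \<open>S\<close> on \<open>C\<^sub>0\<^sub>1\<close>. The products \<open>m10\<close>, \<open>m01\<close> are forced by the condition that the map from this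
  complex to \<open>\<phi>\<close> is multiplicative.
\<close>

definition C01_mult ::
  "'r ring \<Rightarrow> ('r, 'v) tensor_data \<Rightarrow> ('r, 'v, 'r, 'c1, 'c0, 'a, 'b) elext \<Rightarrow>
   ('r, 'v, 'r, 'c1, 'c0) mult_data \<Rightarrow> 's ring \<Rightarrow>
   (('r, 'v) module \<Rightarrow> 's \<Rightarrow> 'c1 \<times> 'v \<Rightarrow> 'c1 \<times> 'v) \<Rightarrow> ('r, 'v, 's, 'c1, 'c1 \<times> 'v) mult_data"
  where "C01_mult R K \<phi> \<mu> S act =
    \<lparr>munit = (\<lambda>s\<in>carrier S. act (unit_obj K) s (\<zero>\<^bsub>Ob (deg1 \<phi>) (unit_obj K)\<^esub>, unit_gen K)),
     m00 = (\<lambda>V V' (c, v) (c', v').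
       let add1 = add (Ob (deg1 \<phi>) (tens_obj K V V')) in
       (add1
          (add1 (m10 \<mu> V V' c (diff \<phi> V' c'))
                (m10 \<mu> V V' c (s_tilde R K \<phi> \<mu> V' v')))
          (m01 \<mu> V V' (s_tilde R K \<phi> \<mu> V v) c'),
        tens K V V' v v')),
     m10 = (\<lambda>V V' c x. m10 \<mu> V V' c (C01_c0 R K \<phi> \<mu> V' x)),
     m01 = (\<lambda>V V' x c. m01 \<mu> V V' (C01_c0 R K \<phi> \<mu> V x) c)\<rparr>"

section \<open>The square-zero extension corresponding to an elementary extension\<close>

definition square_zero_extension ::
  "'r ring \<Rightarrow> ('r, 'm) bimodule \<Rightarrow> 'e ring \<Rightarrow> ('m \<Rightarrow> 'e) \<Rightarrow> ('e \<Rightarrow> 'r) \<Rightarrow> bool"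
  where "square_zero_extension R M E i q \<longleftrightarrow>
    ring E \<and> q \<in> ring_hom E R \<and> i \<in> hom (add_monoid M) (add_monoid E) \<and>
    inj_on i (carrier M) \<and> i ` carrier M = {x \<in> carrier E. q x = \<zero>\<^bsub>R\<^esub>} \<and>
    q ` carrier E = carrier R \<and>
    (\<forall>m\<in>carrier M. \<forall>x\<in>carrier E.
       i m \<otimes>\<^bsub>E\<^esub> x = i (rsmult M m (q x)) \<and> x \<otimes>\<^bsub>E\<^esub> i m = i (q x \<odot>\<^bsub>M\<^esub> m)) \<and>
    (\<forall>m\<in>carrier M. \<forall>m'\<in>carrier M. i m \<otimes>\<^bsub>E\<^esub> i m' = \<zero>\<^bsub>E\<^esub>)"

text \<open>The conditions \<open>c\<^sub>0 r' = r c\<^sub>0\<close> and \<open>r' c\<^sub>1 = c\<^sub>1 r\<close>.\<close>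

definition intertwines ::
  "'r ring \<Rightarrow> ('r, 'v) tensor_data \<Rightarrow> ('r, 'v, 'r, 'c1, 'c0, 'a, 'b) elext \<Rightarrow>
   ('r, 'v, 'r, 'c1, 'c0) mult_data \<Rightarrow> (('r, 'v) module \<Rightarrow> 'c1 \<times> 'v \<Rightarrow> 'c1 \<times> 'v) \<Rightarrow> 'r \<Rightarrow> bool"
  where "intertwines R K \<phi> \<mu> r' r \<longleftrightarrow>
    (\<forall>V\<in>proj_modules R.
       (\<forall>x\<in>carrier (C01_group R K \<phi> \<mu> V).
          C01_c0 R K \<phi> \<mu> V (r' V x) = r \<odot>\<^bsub>Ob (deg0 \<phi>) V\<^esub> C01_c0 R K \<phi> \<mu> V x) \<and>
       (\<forall>c\<in>carrier (Ob (deg1 \<phi>) V).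
          r' V (C01_c1 R \<phi> V c) = C01_c1 R \<phi> V (r \<odot>\<^bsub>Ob (deg1 \<phi>) V\<^esub> c)))"

definition ext_ring ::
  "'r ring \<Rightarrow> ('r, 'v) tensor_data \<Rightarrow> ('r, 'v, 'r, 'c1, 'c0, 'a, 'b) elext \<Rightarrow>
   ('r, 'v, 'r, 'c1, 'c0) mult_data \<Rightarrow> (('r, 'v) module \<Rightarrow> 'c1 \<times> 'v \<Rightarrow> 'c1 \<times> 'v) ring"
  where "ext_ring R K \<phi> \<mu> =
    (let G = C01_group R K \<phi> \<mu> in
     \<lparr>carrier = {r' \<in> nat_trans R \<Z> (C01_int R K \<phi> \<mu>) (C01_int R K \<phi> \<mu>).
                  \<exists>r\<in>carrier R. intertwines R K \<phi> \<mu> r' r},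
      monoid.mult = (\<lambda>r' r''. \<lambda>V\<in>proj_modules R. \<lambda>x\<in>carrier (G V). r' V (r'' V x)),
      one = (\<lambda>V\<in>proj_modules R. \<lambda>x\<in>carrier (G V). x),
      ring.zero = (\<lambda>V\<in>proj_modules R. \<lambda>x\<in>carrier (G V). \<zero>\<^bsub>G V\<^esub>),
      add = (\<lambda>r' r''. \<lambda>V\<in>proj_modules R. \<lambda>x\<in>carrier (G V). r' V x \<oplus>\<^bsub>G V\<^esub> r'' V x)\<rparr>)"

definition ext_proj ::
  "'r ring \<Rightarrow> ('r, 'v) tensor_data \<Rightarrow> ('r, 'v, 'r, 'c1, 'c0, 'a, 'b) elext \<Rightarrow>
   ('r, 'v, 'r, 'c1, 'c0) mult_data \<Rightarrow> (('r, 'v) module \<Rightarrow> 'c1 \<times> 'v \<Rightarrow> 'c1 \<times> 'v) \<Rightarrow> 'r"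
  where "ext_proj R K \<phi> \<mu> r' = (THE r. r \<in> carrier R \<and> intertwines R K \<phi> \<mu> r' r)"

definition ext_incl ::
  "'r ring \<Rightarrow> ('r, 'v) tensor_data \<Rightarrow> ('r, 'm) bimodule \<Rightarrow>
   ('r, 'v, 'r, 'c1, 'c0, 'v, (('m \<times> 'v) \<Rightarrow>\<^sub>0 int) set) elext \<Rightarrow>
   ('r, 'v, 'r, 'c1, 'c0) mult_data \<Rightarrow> 'm \<Rightarrow> ('r, 'v) module \<Rightarrow> 'c1 \<times> 'v \<Rightarrow> 'c1 \<times> 'v"
  where "ext_incl R K M \<phi> \<mu> m =
    (\<lambda>V\<in>proj_modules R. \<lambda>x\<in>carrier (C01_group R K \<phi> \<mu> V).
       C01_c1 R \<phi> V (inc \<phi> V (tensor_elem R M V m (aug \<phi> V (C01_c0 R K \<phi> \<mu> V x)))))"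

end

theory Submission
  imports Defs
begin

text \<open>
  Write \<open>s(v) \<in> C\<^sub>0(V)\<close> for the image of the unit \<open>s\<close> under \<open>v\<close>, viewed as a map from the unit
  object, which is generated by \<open>u\<close>. Two principles carry the proof.

  First, products with the elements \<open>s(v)\<close> are given by functoriality: \<open>x \<cdot> s(v')\<close> is the image of
  \<open>x\<close> under the map \<open>- \<otimes> v' : V \<rightarrow> V \<otimes> V'\<close>, and symmetrically on the left (\<open>mult_st\<close>). Hence every
  natural map \<open>g : V \<rightarrow> C\<^sub>1(V)\<close> satisfies \<open>g(v) \<cdot> s(v') = g(v \<otimes> v') = s(v) \<cdot> g(v')\<close>, and the same
  holds for natural maps in several variables.

  Secondly, natural maps \<open>V\<^sup>n \<rightarrow> C\<^sub>1(V)\<close> with the same differential are equal once they agree on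
  two complementary coordinate subspaces (\<open>natural_eqI\<close>). Their difference takes values in \<open>Ker d
  \<cong> M \<otimes> V\<close>, which is additive in \<open>V\<close>, and it is determined by its value on the basis of a free
  module.

  The second principle shows that the defect \<open>c(-,-)\<close>, which exists because it can be constructed
  on the basis of a free module of rank 2, is a symmetric cocycle, so that \<open>C\<^sub>0\<^sub>1(V)\<close> is an
  abelian group. An element of \<open>R'\<close> over \<open>r \<in> R\<close> has the form \<open>(c, v) \<mapsto> (r c + g(v), r v)\<close> with
  \<open>g\<close> natural and \<open>d(g(v)) = r s(v) - s(r v)\<close>. Conversely \<open>r s - s(r u)\<close> lifts to \<open>C\<^sub>1(R)\<close>; this
  defines such a \<open>g\<close>, and the second principle shows that the resulting map is additive
  (\<open>q_surj\<close>). The elements over \<open>0\<close> are natural maps \<open>V \<rightarrow> M \<otimes> V\<close>, hence of the form \<open>v \<mapsto> m \<otimes> v\<close>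
  (\<open>i_image\<close>). So \<open>R'\<close> is a square-zero extension of \<open>R\<close> by \<open>M\<close>.

  The first principle, together with \<open>k \<cdot> d(c') = d(k) \<cdot> c'\<close> for elements of degree 1, shows that
  the product of \<open>C\<^sub>0\<^sub>1\<close> is additive in both factors (\<open>prod01_add_left\<close>, \<open>prod01_add_right\<close>) and
  that \<open>r'(x) \<cdot> y = r'(x \<cdot> y) = x \<cdot> r'(y)\<close> for \<open>r' \<in> R'\<close> (\<open>prod01_ext_left\<close>, \<open>prod01_ext_right\<close>).
  Therefore \<open>r'(r''(x \<cdot> y)) = r'(x) \<cdot> r''(y) = r''(r'(x \<cdot> y))\<close>; for \<open>y\<close> the unit this says that
  \<open>R'\<close> is commutative. As \<open>c\<^sub>0\<close> is multiplicative, associativity and unitality of the product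
  follow from those of the product of \<open>C\<^sub>\<bullet>\<close>. The integers act on \<open>C\<^sub>0\<^sub>1\<close> through \<open>R'\<close>, so that the
  multiplicative splittings over the integers and over \<open>R'\<close> are two cases of one statement
  (\<open>is_multiplicative_splitting\<close>).
\<close>

section \<open>Additive maps and module homomorphisms\<close>

lemma additive_map:
  fixes X (structure) and Y (structure)
  assumes "abelian_group X" "abelian_group Y"
    and closed: "\<And>x. x \<in> carrier X \<Longrightarrow> f x \<in> carrier Y"
    and add: "\<And>x y. x \<in> carrier X \<Longrightarrow> y \<in> carrier X \<Longrightarrow> f (x \<oplus>\<^bsub>X\<^esub> y) = f x \<oplus>\<^bsub>Y\<^esub> f y"
  shows additive_zero: "f \<zero>\<^bsub>X\<^esub> = \<zero>\<^bsub>Y\<^esub>"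
    and additive_neg: "x \<in> carrier X \<Longrightarrow> f (\<ominus>\<^bsub>X\<^esub> x) = \<ominus>\<^bsub>Y\<^esub> f x"
    and additive_diff: "x \<in> carrier X \<Longrightarrow> y \<in> carrier X \<Longrightarrow> f (x \<ominus>\<^bsub>X\<^esub> y) = f x \<ominus>\<^bsub>Y\<^esub> f y"
proof -
  interpret X: abelian_group X by fact
  interpret Y: abelian_group Y by fact
  interpret f: group_hom "add_monoid X" "add_monoid Y" f
    by (rule group_hom.intro[OF X.a_group Y.a_group], unfold_locales)
      (auto simp: hom_def closed add)
  show zero: "f \<zero>\<^bsub>X\<^esub> = \<zero>\<^bsub>Y\<^esub>" using f.hom_one by simp
  show neg: "f (\<ominus>\<^bsub>X\<^esub> x) = \<ominus>\<^bsub>Y\<^esub> f x" if "x \<in> carrier X" for x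
    using f.hom_inv[of x] that by (simp add: a_inv_def)
  show "f (x \<ominus>\<^bsub>X\<^esub> y) = f x \<ominus>\<^bsub>Y\<^esub> f y" if "x \<in> carrier X" "y \<in> carrier X"
    using that by (simp add: a_minus_def add neg)
qed

lemma additive_int_pow:
  assumes "abelian_group X" "abelian_group Y" "\<And>x. x \<in> carrier X \<Longrightarrow> f x \<in> carrier Y"
    "\<And>x y. x \<in> carrier X \<Longrightarrow> y \<in> carrier X \<Longrightarrow> f (x \<oplus>\<^bsub>X\<^esub> y) = f x \<oplus>\<^bsub>Y\<^esub> f y" "x \<in> carrier X"
  shows "f (add_pow X (n::int) x) = add_pow Y n (f x)"
proof -
  interpret X: abelian_group X by fact
  interpret Y: abelian_group Y by fact
  interpret f: group_hom "add_monoid X" "add_monoid Y" f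
    by (rule group_hom.intro[OF X.a_group Y.a_group], unfold_locales) (auto simp: hom_def assms)
  show ?thesis using f.hom_int_pow[of x n] assms(5) by (simp add: add_pow_def)
qed

lemma mod_homI:
  assumes "\<And>x. x \<in> carrier X \<Longrightarrow> f x \<in> carrier Y"
    and "\<And>x y. x \<in> carrier X \<Longrightarrow> y \<in> carrier X \<Longrightarrow> f (x \<oplus>\<^bsub>X\<^esub> y) = f x \<oplus>\<^bsub>Y\<^esub> f y"
    and "\<And>s x. s \<in> carrier S \<Longrightarrow> x \<in> carrier X \<Longrightarrow> f (s \<odot>\<^bsub>X\<^esub> x) = s \<odot>\<^bsub>Y\<^esub> f x"
    and "f \<in> extensional (carrier X)"
  shows "f \<in> mod_hom S X Y"
  using assms by (auto simp: mod_hom_def PiE_def)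

lemma mod_hom_closed: "f \<in> mod_hom S X Y \<Longrightarrow> x \<in> carrier X \<Longrightarrow> f x \<in> carrier Y"
  and mod_hom_add: "f \<in> mod_hom S X Y \<Longrightarrow> x \<in> carrier X \<Longrightarrow> y \<in> carrier X \<Longrightarrow>
    f (x \<oplus>\<^bsub>X\<^esub> y) = f x \<oplus>\<^bsub>Y\<^esub> f y"
  and mod_hom_smult: "f \<in> mod_hom S X Y \<Longrightarrow> s \<in> carrier S \<Longrightarrow> x \<in> carrier X \<Longrightarrow>
    f (s \<odot>\<^bsub>X\<^esub> x) = s \<odot>\<^bsub>Y\<^esub> f x"
  and mod_hom_extensional: "f \<in> mod_hom S X Y \<Longrightarrow> f \<in> extensional (carrier X)"
  by (auto simp: mod_hom_def PiE_def)

lemma mod_hom_zero: "f \<in> mod_hom S X Y \<Longrightarrow> module S X \<Longrightarrow> module S Y \<Longrightarrow> f \<zero>\<^bsub>X\<^esub> = \<zero>\<^bsub>Y\<^esub>"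
  by (rule additive_zero) (auto simp: module_def mod_hom_closed mod_hom_add)

lemma mod_hom_diff:
  "f \<in> mod_hom S X Y \<Longrightarrow> module S X \<Longrightarrow> module S Y \<Longrightarrow> x \<in> carrier X \<Longrightarrow> y \<in> carrier X \<Longrightarrow>
    f (x \<ominus>\<^bsub>X\<^esub> y) = f x \<ominus>\<^bsub>Y\<^esub> f y"
  by (rule additive_diff) (auto simp: module_def mod_hom_closed mod_hom_add)

lemma mod_hom_eqI:
  assumes "f \<in> mod_hom S X Y" "g \<in> mod_hom S X Y" "\<And>x. x \<in> carrier X \<Longrightarrow> f x = g x"
  shows "f = g"
  using assms by (intro extensionalityI[of f "carrier X" g]) (auto simp: mod_hom_extensional)

lemma mod_hom_compose:
  assumes "f \<in> mod_hom S X Y" "g \<in> mod_hom S Y Z" "module S X"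
  shows "compose (carrier X) g f \<in> mod_hom S X Z"
proof -
  interpret X: module S X by fact
  show ?thesis
    using assms(1,2) by (intro mod_homI) (auto simp: compose_def mod_hom_closed mod_hom_add mod_hom_smult)
qed

lemma mod_hom_id: "module S X \<Longrightarrow> (\<lambda>x\<in>carrier X. x) \<in> mod_hom S X X"
proof -
  assume "module S X"
  then interpret X: module S X .
  show ?thesis by (intro mod_homI) auto
qed

lemma mod_hom_zero_map:
  "module S X \<Longrightarrow> module S Y \<Longrightarrow> (\<lambda>x\<in>carrier X. \<zero>\<^bsub>Y\<^esub>) \<in> mod_hom S X Y"
proof -
  assume "module S X" "module S Y"
  then interpret X: module S X + Y: module S Y by simp_all
  show ?thesis by (intro mod_homI) auto
qed

section \<open>Tensor products with a bimodule\<close>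

lemma is_bimoduleD:
  assumes "is_bimodule R M"
  shows "module R M"
    and "m \<in> carrier M \<Longrightarrow> r \<in> carrier R \<Longrightarrow> rsmult M m r \<in> carrier M"
    and "m \<in> carrier M \<Longrightarrow> n \<in> carrier M \<Longrightarrow> r \<in> carrier R \<Longrightarrow>
      rsmult M (m \<oplus>\<^bsub>M\<^esub> n) r = rsmult M m r \<oplus>\<^bsub>M\<^esub> rsmult M n r"
    and "m \<in> carrier M \<Longrightarrow> r \<in> carrier R \<Longrightarrow> s \<in> carrier R \<Longrightarrow>
      rsmult M m (r \<oplus>\<^bsub>R\<^esub> s) = rsmult M m r \<oplus>\<^bsub>M\<^esub> rsmult M m s"
    and "m \<in> carrier M \<Longrightarrow> r \<in> carrier R \<Longrightarrow> s \<in> carrier R \<Longrightarrow>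
      rsmult M m (r \<otimes>\<^bsub>R\<^esub> s) = rsmult M (rsmult M m r) s"
    and "m \<in> carrier M \<Longrightarrow> rsmult M m \<one>\<^bsub>R\<^esub> = m"
    and "m \<in> carrier M \<Longrightarrow> r \<in> carrier R \<Longrightarrow> s \<in> carrier R \<Longrightarrow>
      rsmult M (r \<odot>\<^bsub>M\<^esub> m) s = r \<odot>\<^bsub>M\<^esub> rsmult M m s"
  using assms by (auto simp: is_bimodule_def)

lemma symmetric_bimodule_simps [simp]:
  "carrier (symmetric_bimodule V) = carrier V"
  "add (symmetric_bimodule V) = add V"
  "\<zero>\<^bsub>symmetric_bimodule V\<^esub> = \<zero>\<^bsub>V\<^esub>"
  "r \<odot>\<^bsub>symmetric_bimodule V\<^esub> v = r \<odot>\<^bsub>V\<^esub> v"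
  "rsmult (symmetric_bimodule V) v r = r \<odot>\<^bsub>V\<^esub> v"
  by (simp_all add: symmetric_bimodule_def)

lemma symmetric_bimodule:
  assumes "module R V"
  shows "is_bimodule R (symmetric_bimodule V)"
proof -
  interpret V: module R V by fact
  have "module R (symmetric_bimodule V)"
  proof (rule moduleI)
    show "abelian_group (symmetric_bimodule V)"
      using V.M.l_neg by (intro abelian_groupI) (auto simp: V.M.a_ac intro!: bexI[of _ "\<ominus>\<^bsub>V\<^esub> _"])
  qed (auto simp: V.smult_l_distr V.smult_r_distr V.smult_assoc1 V.R.is_cring)
  then show ?thesis
    by (auto simp: is_bimodule_def V.smult_l_distr V.smult_r_distr V.R.m_comm
        simp flip: V.smult_assoc1)
qed

lemma tensor_relationI:
  "m \<in> carrier M \<Longrightarrow> m' \<in> carrier M \<Longrightarrow> v \<in> carrier V \<Longrightarrow>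
    frag_of (m \<oplus>\<^bsub>M\<^esub> m', v) - frag_of (m, v) - frag_of (m', v) \<in> tensor_relations R M V"
  "m \<in> carrier M \<Longrightarrow> v \<in> carrier V \<Longrightarrow> v' \<in> carrier V \<Longrightarrow>
    frag_of (m, v \<oplus>\<^bsub>V\<^esub> v') - frag_of (m, v) - frag_of (m, v') \<in> tensor_relations R M V"
  "m \<in> carrier M \<Longrightarrow> r \<in> carrier R \<Longrightarrow> v \<in> carrier V \<Longrightarrow>
    frag_of (rsmult M m r, v) - frag_of (m, r \<odot>\<^bsub>V\<^esub> v) \<in> tensor_relations R M V"
  unfolding tensor_relations_def by blast+

lemma tensor_relationE:
  assumes "x \<in> tensor_relations R M V"
  obtains (left) m m' v where "m \<in> carrier M" "m' \<in> carrier M" "v \<in> carrier V"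
      "x = frag_of (m \<oplus>\<^bsub>M\<^esub> m', v) - frag_of (m, v) - frag_of (m', v)"
    | (right) m v v' where "m \<in> carrier M" "v \<in> carrier V" "v' \<in> carrier V"
      "x = frag_of (m, v \<oplus>\<^bsub>V\<^esub> v') - frag_of (m, v) - frag_of (m, v')"
    | (balanced) m r v where "m \<in> carrier M" "r \<in> carrier R" "v \<in> carrier V"
      "x = frag_of (rsmult M m r, v) - frag_of (m, r \<odot>\<^bsub>V\<^esub> v)"
  using assms unfolding tensor_relations_def by (elim UnE CollectE exE conjE) metis+

locale bimodule_tensor =
  fixes R :: "'r ring" and M :: "('r, 'm) bimodule" and V :: "('r, 'v) module"
  assumes bimodule: "is_bimodule R M" and module_V: "module R V"
begin

sublocale M: module R M
  using bimodule by (rule is_bimoduleD)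
sublocale V: module R V
  by (rule module_V)

abbreviation (input) F where "F \<equiv> free_Abelian_group (carrier M \<times> carrier V)"
abbreviation (input) H where "H \<equiv> tensor_subgroup R M V"
abbreviation cls where "cls \<equiv> tensor_class R M V"
abbreviation elem (infixl \<open>\<otimes>\<otimes>\<close> 75) where "m \<otimes>\<otimes> v \<equiv> tensor_elem R M V m v"
abbreviation MV where "MV \<equiv> tensor R M V"

lemma diff_closed: "x \<in> carrier F \<Longrightarrow> y \<in> carrier F \<Longrightarrow> x - y \<in> carrier F"
  using keys_diff[of x y] by auto

lemma frag_closed: "m \<in> carrier M \<Longrightarrow> v \<in> carrier V \<Longrightarrow> frag_of (m, v) \<in> carrier F"
  by simp

lemma relations_closed: "tensor_relations R M V \<subseteq> carrier F"
  by (rule subsetI, erule tensor_relationE)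
    (simp_all only: diff_closed frag_closed M.a_closed V.a_closed V.smult_closed
      is_bimoduleD(2)[OF bimodule])

sublocale F: comm_group F
  by (rule abelian_free_Abelian_group)

lemma subgroup_H: "subgroup H F"
  unfolding tensor_subgroup_def by (rule F.generate_is_subgroup[OF relations_closed])

sublocale H: normal H F
  by (rule F.subgroup_imp_normal[OF subgroup_H])

lemma H_closed: "x \<in> H \<Longrightarrow> y \<in> H \<Longrightarrow> x + y \<in> H" "0 \<in> H" "x \<in> H \<Longrightarrow> - x \<in> H"
  "x \<in> H \<Longrightarrow> y \<in> H \<Longrightarrow> x - y \<in> H"
  and H_sub: "x \<in> H \<Longrightarrow> x \<in> carrier F"
proof -
  have sub: "x \<in> H \<Longrightarrow> x \<in> carrier F" for x using H.subset by blast
  show "x \<in> H \<Longrightarrow> x \<in> carrier F" by (rule sub)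
  have 1: "x \<in> H \<Longrightarrow> y \<in> H \<Longrightarrow> x + y \<in> H" for x y using H.m_closed[of x y] by simp
  have 2: "- x \<in> H" if "x \<in> H" for x using H.m_inv_closed[OF that] sub[OF that] by simp
  show "0 \<in> H" using H.one_closed by simp
  show "x \<in> H \<Longrightarrow> y \<in> H \<Longrightarrow> x + y \<in> H" "x \<in> H \<Longrightarrow> - x \<in> H" by (fact 1 2)+
  show "x \<in> H \<Longrightarrow> y \<in> H \<Longrightarrow> x - y \<in> H" using 1[of x "- y"] 2[of y] by simp
qed

lemma mem_cls: "y \<in> cls x \<longleftrightarrow> y - x \<in> H"
  unfolding tensor_class_def r_coset_def
  by (auto simp: algebra_simps intro: bexI[of _ "y - x"])

lemma cls_eq_iff: "cls x = cls y \<longleftrightarrow> x - y \<in> H"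
proof
  assume "cls x = cls y"
  then show "x - y \<in> H" using H_closed(2) by (metis diff_self mem_cls)
next
  assume *: "x - y \<in> H"
  have "z - x \<in> H \<longleftrightarrow> z - y \<in> H" for z
    using H_closed(1)[of "z - x" "x - y"] H_closed(4)[of "z - y" "x - y"] * by auto
  then show "cls x = cls y" by (auto simp: mem_cls)
qed

lemma carrier_MV: "carrier MV = cls ` carrier F"
  by (auto simp: tensor_def Let_def carrier_FactGroup tensor_class_def)

lemma zero_MV: "\<zero>\<^bsub>MV\<^esub> = cls 0"
  using F.coset_mult_one[of H] H.subset
  by (simp add: tensor_def Let_def tensor_class_def FactGroup_def)

lemma add_MV: "x \<in> carrier F \<Longrightarrow> y \<in> carrier F \<Longrightarrow> cls x \<oplus>\<^bsub>MV\<^esub> cls y = cls (x + y)"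
  using H.rcos_sum[of x y] by (simp add: tensor_def Let_def tensor_class_def)

text \<open>
  For a value of \<open>I(M)\<close> this is part of the data of an elementary extension, but the tensor products
  \<open>V \<otimes> V'\<close> over \<open>R\<close> to which the tensor structure refers come without module axioms.
\<close>

lemma abelian_group_MV: "abelian_group MV"
proof (rule abelian_groupI)
  show "\<exists>y\<in>carrier MV. y \<oplus>\<^bsub>MV\<^esub> x = \<zero>\<^bsub>MV\<^esub>" if x: "x \<in> carrier MV" for x
  proof -
    obtain a where a: "x = cls a" "a \<in> carrier F" using x by (auto simp: carrier_MV)
    then have "cls (- a) \<oplus>\<^bsub>MV\<^esub> x = \<zero>\<^bsub>MV\<^esub>" using add_MV[of "- a" a] by (simp add: zero_MV)
    then show ?thesis using a by (intro bexI[of _ "cls (- a)"]) (auto simp: carrier_MV)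
  qed
next
  fix x y assume "x \<in> carrier MV" "y \<in> carrier MV"
  then obtain a b where "x = cls a" "y = cls b" "a \<in> carrier F" "b \<in> carrier F"
    by (auto simp: carrier_MV)
  then show "x \<oplus>\<^bsub>MV\<^esub> y \<in> carrier MV" "x \<oplus>\<^bsub>MV\<^esub> y = y \<oplus>\<^bsub>MV\<^esub> x"
    using F.m_closed[of a b] by (auto simp: add_MV carrier_MV add.commute)
next
  fix x y z assume "x \<in> carrier MV" "y \<in> carrier MV" "z \<in> carrier MV"
  then obtain a b c where "x = cls a" "y = cls b" "z = cls c"
    "a \<in> carrier F" "b \<in> carrier F" "c \<in> carrier F"
    by (auto simp: carrier_MV)
  then show "x \<oplus>\<^bsub>MV\<^esub> y \<oplus>\<^bsub>MV\<^esub> z = x \<oplus>\<^bsub>MV\<^esub> (y \<oplus>\<^bsub>MV\<^esub> z)"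
    using F.m_closed[of a b] F.m_closed[of b c] by (simp add: add_MV add.assoc del: carrier_free_Abelian_group_iff)
next
  show "\<zero>\<^bsub>MV\<^esub> \<in> carrier MV" by (auto simp: carrier_MV zero_MV)
  show "\<zero>\<^bsub>MV\<^esub> \<oplus>\<^bsub>MV\<^esub> x = x" if "x \<in> carrier MV" for x
    using that by (auto simp: carrier_MV zero_MV add_MV)
qed

lemma elem_closed: "m \<in> carrier M \<Longrightarrow> v \<in> carrier V \<Longrightarrow> m \<otimes>\<otimes> v \<in> carrier MV"
  by (auto simp: carrier_MV tensor_elem_def)

lemma relation_mem: "x \<in> tensor_relations R M V \<Longrightarrow> x \<in> H"
  unfolding tensor_subgroup_def by (rule generate.incl)

lemma elem_add_left:
  assumes "m \<in> carrier M" "m' \<in> carrier M" "v \<in> carrier V"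
  shows "(m \<oplus>\<^bsub>M\<^esub> m') \<otimes>\<otimes> v = m \<otimes>\<otimes> v \<oplus>\<^bsub>MV\<^esub> m' \<otimes>\<otimes> v"
proof -
  have "frag_of (m \<oplus>\<^bsub>M\<^esub> m', v) - frag_of (m, v) - frag_of (m', v) \<in> H"
    using assms by (intro relation_mem tensor_relationI)
  then show ?thesis
    using assms by (simp add: tensor_elem_def add_MV cls_eq_iff diff_diff_add)
qed

lemma elem_add_right:
  assumes "m \<in> carrier M" "v \<in> carrier V" "v' \<in> carrier V"
  shows "m \<otimes>\<otimes> (v \<oplus>\<^bsub>V\<^esub> v') = m \<otimes>\<otimes> v \<oplus>\<^bsub>MV\<^esub> m \<otimes>\<otimes> v'"
proof -
  have "frag_of (m, v \<oplus>\<^bsub>V\<^esub> v') - frag_of (m, v) - frag_of (m, v') \<in> H"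
    using assms by (intro relation_mem tensor_relationI)
  then show ?thesis
    using assms by (simp add: tensor_elem_def add_MV cls_eq_iff diff_diff_add)
qed

lemma elem_balanced:
  assumes "m \<in> carrier M" "r \<in> carrier R" "v \<in> carrier V"
  shows "rsmult M m r \<otimes>\<otimes> v = m \<otimes>\<otimes> (r \<odot>\<^bsub>V\<^esub> v)"
proof -
  have "frag_of (rsmult M m r, v) - frag_of (m, r \<odot>\<^bsub>V\<^esub> v) \<in> H"
    using assms by (intro relation_mem tensor_relationI)
  then show ?thesis
    using assms by (simp add: tensor_elem_def cls_eq_iff)
qed

lemma elem_zero_left: "v \<in> carrier V \<Longrightarrow> \<zero>\<^bsub>M\<^esub> \<otimes>\<otimes> v = \<zero>\<^bsub>MV\<^esub>"
  by (rule additive_zero[OF M.abelian_group_axioms abelian_group_MV]) (auto simp: elem_closed elem_add_left)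

lemma elem_zero_right: "m \<in> carrier M \<Longrightarrow> m \<otimes>\<otimes> \<zero>\<^bsub>V\<^esub> = \<zero>\<^bsub>MV\<^esub>"
  by (rule additive_zero[OF V.abelian_group_axioms abelian_group_MV]) (auto simp: elem_closed elem_add_right)

lemma elem_neg_left: "m \<in> carrier M \<Longrightarrow> v \<in> carrier V \<Longrightarrow> (\<ominus>\<^bsub>M\<^esub> m) \<otimes>\<otimes> v = \<ominus>\<^bsub>MV\<^esub> (m \<otimes>\<otimes> v)"
  by (rule additive_neg[OF M.abelian_group_axioms abelian_group_MV]) (auto simp: elem_closed elem_add_left)

text \<open>
  Sums of elements \<open>m \<otimes> v\<close> exhaust the tensor product, because \<open>-(m \<otimes> v) = (-m) \<otimes> v\<close>. The induction
  on the free group thus has to treat an element together with its negative.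
\<close>

lemma tensor_induct [consumes 1, case_names elem add]:
  assumes "x \<in> carrier MV"
    and elem: "\<And>m v. m \<in> carrier M \<Longrightarrow> v \<in> carrier V \<Longrightarrow> P (m \<otimes>\<otimes> v)"
    and add: "\<And>x y. x \<in> carrier MV \<Longrightarrow> y \<in> carrier MV \<Longrightarrow> P x \<Longrightarrow> P y \<Longrightarrow> P (x \<oplus>\<^bsub>MV\<^esub> y)"
  shows "P x"
proof -
  interpret MV: abelian_group MV by (rule abelian_group_MV)
  have neg: "cls (- a) = \<ominus>\<^bsub>MV\<^esub> cls a" if "a \<in> carrier F" for a
    using that by (intro MV.minus_equality[symmetric]) (auto simp: add_MV zero_MV carrier_MV)
  have "P (cls a) \<and> P (\<ominus>\<^bsub>MV\<^esub> cls a)" if "Poly_Mapping.keys a \<subseteq> carrier M \<times> carrier V" for a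
  proof (rule free_Abelian_group_induct[OF that])
    have "P (cls 0)"
      using elem[OF M.zero_closed V.zero_closed] by (simp add: elem_zero_left zero_MV)
    then show "P (cls 0) \<and> P (\<ominus>\<^bsub>MV\<^esub> cls 0)" using neg[of 0] by simp
  next
    fix a b
    assume ab: "Poly_Mapping.keys a \<subseteq> carrier M \<times> carrier V" "Poly_Mapping.keys b \<subseteq> carrier M \<times> carrier V"
      "P (cls a) \<and> P (\<ominus>\<^bsub>MV\<^esub> cls a)" "P (cls b) \<and> P (\<ominus>\<^bsub>MV\<^esub> cls b)"
    have c: "cls a \<in> carrier MV" "cls b \<in> carrier MV" using ab by (auto simp: carrier_MV)
    have "cls (a - b) = cls a \<oplus>\<^bsub>MV\<^esub> \<ominus>\<^bsub>MV\<^esub> cls b"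
      using add_MV[of a "- b"] ab by (simp add: neg)
    then show "P (cls (a - b)) \<and> P (\<ominus>\<^bsub>MV\<^esub> cls (a - b))" using ab add c by (simp add: MV.minus_add)
  next
    fix p assume "p \<in> carrier M \<times> carrier V"
    then obtain m v where "p = (m, v)" "m \<in> carrier M" "v \<in> carrier V" by auto
    then show "P (cls (frag_of p)) \<and> P (\<ominus>\<^bsub>MV\<^esub> cls (frag_of p))"
      using elem[of m v] elem[of "\<ominus>\<^bsub>M\<^esub> m" v]
      by (simp add: elem_neg_left flip: tensor_elem_def)
  qed
  then show ?thesis using assms(1) by (auto simp: carrier_MV)
qed

text \<open>
  A homomorphism from the free abelian group to \<open>N\<close> that extends \<open>\<beta>\<close> kills the relations, hence is
  constant on the cosets.
\<close>

lemma tensor_universal: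
  assumes N: "abelian_group N"
    and closed: "\<And>m v. m \<in> carrier M \<Longrightarrow> v \<in> carrier V \<Longrightarrow> \<beta> m v \<in> carrier N"
    and left: "\<And>m m' v. m \<in> carrier M \<Longrightarrow> m' \<in> carrier M \<Longrightarrow> v \<in> carrier V \<Longrightarrow>
      \<beta> (m \<oplus>\<^bsub>M\<^esub> m') v = \<beta> m v \<oplus>\<^bsub>N\<^esub> \<beta> m' v"
    and right: "\<And>m v v'. m \<in> carrier M \<Longrightarrow> v \<in> carrier V \<Longrightarrow> v' \<in> carrier V \<Longrightarrow>
      \<beta> m (v \<oplus>\<^bsub>V\<^esub> v') = \<beta> m v \<oplus>\<^bsub>N\<^esub> \<beta> m v'"
    and balanced: "\<And>m r v. m \<in> carrier M \<Longrightarrow> r \<in> carrier R \<Longrightarrow> v \<in> carrier V \<Longrightarrow>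
      \<beta> (rsmult M m r) v = \<beta> m (r \<odot>\<^bsub>V\<^esub> v)"
  obtains h where "h \<in> hom (add_monoid MV) (add_monoid N)"
    and "\<And>m v. m \<in> carrier M \<Longrightarrow> v \<in> carrier V \<Longrightarrow> h (m \<otimes>\<otimes> v) = \<beta> m v"
proof -
  interpret N: abelian_group N by fact
  interpret MV: abelian_group MV by (rule abelian_group_MV)
  have im: "(\<lambda>(m, v). \<beta> m v) ` (carrier M \<times> carrier V) \<subseteq> carrier (add_monoid N)"
    using closed by auto
  obtain g where g: "g \<in> hom F (add_monoid N)"
    and g_of: "\<And>p. p \<in> carrier M \<times> carrier V \<Longrightarrow> g (frag_of p) = (\<lambda>(m, v). \<beta> m v) p"
    using comm_group.free_Abelian_group_universal[OF N.a_comm_group im] by auto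
  interpret g: group_hom F "add_monoid N" g
    using g by unfold_locales
  have g_closed: "a \<in> carrier F \<Longrightarrow> g a \<in> carrier N" for a
    using g.hom_closed by simp
  have g_add: "a \<in> carrier F \<Longrightarrow> b \<in> carrier F \<Longrightarrow> g (a + b) = g a \<oplus>\<^bsub>N\<^esub> g b" for a b
    using g.hom_mult[of a b] by simp
  have g_neg: "a \<in> carrier F \<Longrightarrow> g (- a) = \<ominus>\<^bsub>N\<^esub> g a" for a
    using g.hom_inv[of a] by (simp add: a_inv_def)
  have g_diff: "g (a - b) = g a \<ominus>\<^bsub>N\<^esub> g b" if "a \<in> carrier F" "b \<in> carrier F" for a b
    using g_add[of a "- b"] g_neg[of b] that by (simp add: a_minus_def)
  note bim = is_bimoduleD(2)[OF bimodule]
  have cancel2: "x \<ominus>\<^bsub>N\<^esub> x = \<zero>\<^bsub>N\<^esub>" if "x \<in> carrier N" for x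
    using that by (simp add: N.minus_eq N.r_neg)
  have cancel3: "x \<oplus>\<^bsub>N\<^esub> y \<ominus>\<^bsub>N\<^esub> x \<ominus>\<^bsub>N\<^esub> y = \<zero>\<^bsub>N\<^esub>" if "x \<in> carrier N" "y \<in> carrier N" for x y
    using that by (simp add: N.minus_eq N.a_assoc N.r_neg N.r_neg2 N.a_comm[of x y])
  have "tensor_relations R M V \<subseteq> kernel F (add_monoid N) g"
  proof
    fix a assume a: "a \<in> tensor_relations R M V"
    have "g a = \<zero>\<^bsub>N\<^esub>"
      using a
      by (elim tensor_relationE)
        (simp_all only: g_diff frag_closed diff_closed M.a_closed V.a_closed V.smult_closed bim g_of
          mem_Sigma_iff split_conv left right balanced closed cancel2 cancel3 simp_thms)
    then show "a \<in> kernel F (add_monoid N) g"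
      using subsetD[OF relations_closed a] by (simp add: kernel_def)
  qed
  then have "H \<subseteq> kernel F (add_monoid N) g"
    unfolding tensor_subgroup_def
    by (rule F.generate_subgroup_incl[OF _ g.subgroup_kernel])
  then have g_H: "a \<in> H \<Longrightarrow> g a = \<zero>\<^bsub>N\<^esub>" for a by (auto simp: kernel_def)
  define h where "h X = g (SOME x. x \<in> X)" for X
  have h: "h (cls a) = g a" if a: "a \<in> carrier F" for a
  proof -
    define b where "b = (SOME x. x \<in> cls a)"
    have "b \<in> cls a" unfolding b_def by (rule someI[of _ a]) (simp add: mem_cls H_closed)
    then have d: "b - a \<in> H" by (simp add: mem_cls)
    have "g (b - a + a) = g (b - a) \<oplus>\<^bsub>N\<^esub> g a"
      by (rule g_add[OF H_sub[OF d] a])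
    then show ?thesis using g_closed[OF a] g_H[OF d] by (simp add: h_def b_def)
  qed
  have "h \<in> hom (add_monoid MV) (add_monoid N)"
  proof (rule homI)
    fix x assume "x \<in> carrier (add_monoid MV)"
    then show "h x \<in> carrier (add_monoid N)"
      using g_closed by (auto simp: carrier_MV h)
  next
    fix x y assume "x \<in> carrier (add_monoid MV)" "y \<in> carrier (add_monoid MV)"
    then obtain a b where "x = cls a" "y = cls b" "a \<in> carrier F" "b \<in> carrier F"
      by (auto simp: carrier_MV)
    then show "h (x \<otimes>\<^bsub>add_monoid MV\<^esub> y) = h x \<otimes>\<^bsub>add_monoid N\<^esub> h y"
      using F.m_closed[of a b] g_add[of a b] h[of a] h[of b] h[of "a + b"] by (simp add: add_MV)
  qed
  moreover have "h (m \<otimes>\<otimes> v) = \<beta> m v" if "m \<in> carrier M" "v \<in> carrier V" for m v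
    using that by (simp add: tensor_elem_def h g_of)
  ultimately show ?thesis by (rule that)
qed

end

text \<open>
  Maps \<open>M \<rightarrow> M'\<close>, \<open>V \<rightarrow> V'\<close> that preserve the structure send relations to relations. This evaluates
  the unions over representatives by which the scalar action and \<^const>\<open>tensor_functor\<close> are defined.
\<close>

lemma tensor_map_class:
  assumes "bimodule_tensor R M V" "bimodule_tensor R M' V'"
    and \<alpha>: "\<And>m. m \<in> carrier M \<Longrightarrow> \<alpha> m \<in> carrier M'"
      "\<And>m n. m \<in> carrier M \<Longrightarrow> n \<in> carrier M \<Longrightarrow> \<alpha> (m \<oplus>\<^bsub>M\<^esub> n) = \<alpha> m \<oplus>\<^bsub>M'\<^esub> \<alpha> n"
      "\<And>m r. m \<in> carrier M \<Longrightarrow> r \<in> carrier R \<Longrightarrow> \<alpha> (rsmult M m r) = rsmult M' (\<alpha> m) r"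
    and \<beta>: "\<And>v. v \<in> carrier V \<Longrightarrow> \<beta> v \<in> carrier V'"
      "\<And>v w. v \<in> carrier V \<Longrightarrow> w \<in> carrier V \<Longrightarrow> \<beta> (v \<oplus>\<^bsub>V\<^esub> w) = \<beta> v \<oplus>\<^bsub>V'\<^esub> \<beta> w"
      "\<And>v r. v \<in> carrier V \<Longrightarrow> r \<in> carrier R \<Longrightarrow> \<beta> (r \<odot>\<^bsub>V\<^esub> v) = r \<odot>\<^bsub>V'\<^esub> \<beta> v"
    and "a \<in> carrier (free_Abelian_group (carrier M \<times> carrier V))"
  shows "(\<Union>x\<in>tensor_class R M V a. tensor_class R M' V' (frag_extend (\<lambda>(m, v). frag_of (\<alpha> m, \<beta> v)) x)) =
    tensor_class R M' V' (frag_extend (\<lambda>(m, v). frag_of (\<alpha> m, \<beta> v)) a)"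
proof -
  interpret A: bimodule_tensor R M V by fact
  interpret B: bimodule_tensor R M' V' by fact
  define \<psi> where "\<psi> = frag_extend (\<lambda>(m, v). frag_of (\<alpha> m, \<beta> v))"
  have \<psi>_of: "\<psi> (frag_of (m, v)) = frag_of (\<alpha> m, \<beta> v)" for m v by (simp add: \<psi>_def)
  have \<psi>_diff: "\<psi> (x - y) = \<psi> x - \<psi> y" for x y by (simp add: \<psi>_def frag_extend_diff)
  have \<psi>_add: "\<psi> (x + y) = \<psi> x + \<psi> y" for x y by (simp add: \<psi>_def frag_extend_add)
  have \<psi>_0: "\<psi> 0 = 0" by (simp add: \<psi>_def)
  have \<psi>_neg: "\<psi> (- x) = - \<psi> x" for x using \<psi>_diff[of 0 x] by (simp add: \<psi>_0)
  have rel: "\<psi> x \<in> tensor_relations R M' V'" if "x \<in> tensor_relations R M V" for x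
  proof -
    from that show ?thesis
    proof (cases rule: tensor_relationE)
      case (left m m' v)
      then have "\<psi> x = frag_of (\<alpha> m \<oplus>\<^bsub>M'\<^esub> \<alpha> m', \<beta> v) - frag_of (\<alpha> m, \<beta> v) - frag_of (\<alpha> m', \<beta> v)"
        by (simp add: \<psi>_diff \<psi>_of \<alpha>)
      then show ?thesis using left \<alpha>(1) \<beta>(1) by (simp only: tensor_relationI)
    next
      case (right m v v')
      then have "\<psi> x = frag_of (\<alpha> m, \<beta> v \<oplus>\<^bsub>V'\<^esub> \<beta> v') - frag_of (\<alpha> m, \<beta> v) - frag_of (\<alpha> m, \<beta> v')"
        by (simp add: \<psi>_diff \<psi>_of \<beta>)
      then show ?thesis using right \<alpha>(1) \<beta>(1) by (simp only: tensor_relationI)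
    next
      case (balanced m r v)
      then have "\<psi> x = frag_of (rsmult M' (\<alpha> m) r, \<beta> v) - frag_of (\<alpha> m, r \<odot>\<^bsub>V'\<^esub> \<beta> v)"
        by (simp add: \<psi>_diff \<psi>_of \<alpha> \<beta>)
      then show ?thesis using balanced \<alpha>(1) \<beta>(1) by (simp only: tensor_relationI)
    qed
  qed
  have H: "\<psi> x \<in> B.H" if "x \<in> A.H" for x
    using that unfolding tensor_subgroup_def
  proof (induction rule: generate.induct)
    case one
    then show ?case using B.H_closed(2) by (simp add: \<psi>_0 flip: tensor_subgroup_def)
  next
    case (incl h)
    then show ?case using rel by (simp add: generate.incl)
  next
    case (inv h)
    then have "h \<in> carrier A.F" using A.relations_closed by blast
    then have "inv\<^bsub>A.F\<^esub> h = - h" by simp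
    then show ?case using B.H_closed(3)[OF B.relation_mem[OF rel[OF inv]]]
      by (simp add: \<psi>_neg flip: tensor_subgroup_def)
  next
    case (eng h1 h2)
    then show ?case using B.H_closed(1)[of "\<psi> h1" "\<psi> h2"] by (simp add: \<psi>_add flip: tensor_subgroup_def)
  qed
  have "B.cls (\<psi> x) = B.cls (\<psi> a)" if "x \<in> A.cls a" for x
    using H that by (simp add: A.mem_cls B.cls_eq_iff flip: \<psi>_diff)
  moreover have "a \<in> A.cls a" by (simp add: A.mem_cls A.H_closed)
  ultimately show ?thesis unfolding \<psi>_def[symmetric] by blast
qed

context bimodule_tensor
begin

lemma smult_cls:
  assumes "r \<in> carrier R" "a \<in> carrier F"
  shows "r \<odot>\<^bsub>MV\<^esub> cls a = cls (frag_extend (\<lambda>(m, v). frag_of (r \<odot>\<^bsub>M\<^esub> m, v)) a)"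
  using tensor_map_class[OF bimodule_tensor_axioms bimodule_tensor_axioms,
      where \<alpha> = "\<lambda>m. r \<odot>\<^bsub>M\<^esub> m" and \<beta> = "\<lambda>v. v" and a = a] assms
  by (simp add: tensor_def Let_def M.smult_r_distr is_bimoduleD(7)[OF bimodule])

lemma smult_elem:
  assumes "r \<in> carrier R" "m \<in> carrier M" "v \<in> carrier V"
  shows "r \<odot>\<^bsub>MV\<^esub> (m \<otimes>\<otimes> v) = (r \<odot>\<^bsub>M\<^esub> m) \<otimes>\<otimes> v"
  using assms by (simp add: tensor_elem_def smult_cls)

lemma smult_add_MV:
  assumes "r \<in> carrier R" "x \<in> carrier MV" "y \<in> carrier MV"
  shows "r \<odot>\<^bsub>MV\<^esub> (x \<oplus>\<^bsub>MV\<^esub> y) = r \<odot>\<^bsub>MV\<^esub> x \<oplus>\<^bsub>MV\<^esub> r \<odot>\<^bsub>MV\<^esub> y"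
proof -
  obtain a b where ab: "x = cls a" "y = cls b" "a \<in> carrier F" "b \<in> carrier F"
    using assms by (auto simp: carrier_MV)
  have ext: "frag_extend (\<lambda>(m, v). frag_of (r \<odot>\<^bsub>M\<^esub> m, v)) c \<in> carrier F" if "c \<in> carrier F" for c
  proof -
    have "Poly_Mapping.keys c \<subseteq> carrier M \<times> carrier V" using that by simp
    then have "Poly_Mapping.keys (frag_extend (\<lambda>(m, v). frag_of (r \<odot>\<^bsub>M\<^esub> m, v)) c) \<subseteq> carrier M \<times> carrier V"
      using assms(1) by (intro order_trans[OF keys_frag_extend]) auto
    then show ?thesis by simp
  qed
  have "a + b \<in> carrier F" using F.m_closed[OF ab(3,4)] by simp
  then show ?thesis
    using ab assms(1) ext
    by (simp add: add_MV smult_cls frag_extend_add del: carrier_free_Abelian_group_iff)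
qed

lemma tensor_universal_linear:
  assumes N: "module R N"
    and closed: "\<And>m v. m \<in> carrier M \<Longrightarrow> v \<in> carrier V \<Longrightarrow> \<beta> m v \<in> carrier N"
    and left: "\<And>m m' v. m \<in> carrier M \<Longrightarrow> m' \<in> carrier M \<Longrightarrow> v \<in> carrier V \<Longrightarrow>
      \<beta> (m \<oplus>\<^bsub>M\<^esub> m') v = \<beta> m v \<oplus>\<^bsub>N\<^esub> \<beta> m' v"
    and right: "\<And>m v v'. m \<in> carrier M \<Longrightarrow> v \<in> carrier V \<Longrightarrow> v' \<in> carrier V \<Longrightarrow>
      \<beta> m (v \<oplus>\<^bsub>V\<^esub> v') = \<beta> m v \<oplus>\<^bsub>N\<^esub> \<beta> m v'"
    and balanced: "\<And>m r v. m \<in> carrier M \<Longrightarrow> r \<in> carrier R \<Longrightarrow> v \<in> carrier V \<Longrightarrow>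
      \<beta> (rsmult M m r) v = \<beta> m (r \<odot>\<^bsub>V\<^esub> v)"
    and linear: "\<And>m r v. m \<in> carrier M \<Longrightarrow> r \<in> carrier R \<Longrightarrow> v \<in> carrier V \<Longrightarrow>
      \<beta> (r \<odot>\<^bsub>M\<^esub> m) v = r \<odot>\<^bsub>N\<^esub> \<beta> m v"
  obtains h where "\<And>x. x \<in> carrier MV \<Longrightarrow> h x \<in> carrier N"
    and "\<And>x y. x \<in> carrier MV \<Longrightarrow> y \<in> carrier MV \<Longrightarrow> h (x \<oplus>\<^bsub>MV\<^esub> y) = h x \<oplus>\<^bsub>N\<^esub> h y"
    and "\<And>r x. r \<in> carrier R \<Longrightarrow> x \<in> carrier MV \<Longrightarrow> h (r \<odot>\<^bsub>MV\<^esub> x) = r \<odot>\<^bsub>N\<^esub> h x"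
    and "\<And>m v. m \<in> carrier M \<Longrightarrow> v \<in> carrier V \<Longrightarrow> h (m \<otimes>\<otimes> v) = \<beta> m v"
proof -
  interpret N: module R N by fact
  interpret MV: abelian_group MV by (rule abelian_group_MV)
  obtain h where hom: "h \<in> hom (add_monoid MV) (add_monoid N)"
    and elem: "\<And>m v. m \<in> carrier M \<Longrightarrow> v \<in> carrier V \<Longrightarrow> h (m \<otimes>\<otimes> v) = \<beta> m v"
    by (rule tensor_universal[OF N.abelian_group_axioms, of \<beta>])
      (simp_all add: closed left right balanced)
  have h_closed: "x \<in> carrier MV \<Longrightarrow> h x \<in> carrier N" for x
    using hom by (auto simp: hom_def)
  have h_add: "x \<in> carrier MV \<Longrightarrow> y \<in> carrier MV \<Longrightarrow> h (x \<oplus>\<^bsub>MV\<^esub> y) = h x \<oplus>\<^bsub>N\<^esub> h y" for x y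
    using hom by (auto simp: hom_def)
  have smult_closed: "r \<odot>\<^bsub>MV\<^esub> x \<in> carrier MV" if "r \<in> carrier R" "x \<in> carrier MV" for r x
    using that(2)
  proof (induction rule: tensor_induct)
    case (elem m v)
    then show ?case using that(1) by (simp add: smult_elem elem_closed)
  next
    case (add x y)
    then show ?case using that(1) MV.a_closed by (simp add: smult_add_MV)
  qed
  have h_smult: "h (r \<odot>\<^bsub>MV\<^esub> x) = r \<odot>\<^bsub>N\<^esub> h x" if "r \<in> carrier R" "x \<in> carrier MV" for r x
    using that(2)
  proof (induction rule: tensor_induct)
    case (elem m v)
    then show ?case using that(1) by (simp add: smult_elem \<open>\<And>m v. _ \<Longrightarrow> _ \<Longrightarrow> h (m \<otimes>\<otimes> v) = _\<close> linear)
  next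
    case (add x y)
    then show ?case using that(1)
      by (simp add: smult_add_MV h_add smult_closed N.smult_r_distr h_closed)
  qed
  show ?thesis by (rule that[OF h_closed h_add h_smult elem])
qed

end

lemma tensor_functor_elem:
  assumes "is_bimodule R M" "module R V" "module R W" "f \<in> mod_hom R V W" "m \<in> carrier M" "v \<in> carrier V"
  shows "Ar (tensor_functor R M) V W f (tensor_elem R M V m v) = tensor_elem R M W m (f v)"
proof -
  interpret A: bimodule_tensor R M V by (rule bimodule_tensor.intro) fact+
  interpret B: bimodule_tensor R M W by (rule bimodule_tensor.intro) fact+
  have "(\<Union>x\<in>A.elem m v. tensor_class R M W (frag_extend (\<lambda>(m, v). frag_of (m, f v)) x)) = B.elem m (f v)"
    using tensor_map_class[OF A.bimodule_tensor_axioms B.bimodule_tensor_axioms,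
        where \<alpha> = "\<lambda>m. m" and \<beta> = f and a = "frag_of (m, v)"] assms
    by (simp add: tensor_elem_def mod_hom_closed mod_hom_add mod_hom_smult)
  then show ?thesis using assms A.elem_closed[of m v] by (simp add: tensor_functor_def)
qed

section \<open>The tensor structure on finitely generated projective modules\<close>

lemma bilinear_mapD:
  assumes "bilinear_map S X Y Z \<beta>"
  shows "x \<in> carrier X \<Longrightarrow> y \<in> carrier Y \<Longrightarrow> \<beta> x y \<in> carrier Z"
    and "x \<in> carrier X \<Longrightarrow> x' \<in> carrier X \<Longrightarrow> y \<in> carrier Y \<Longrightarrow>
      \<beta> (x \<oplus>\<^bsub>X\<^esub> x') y = \<beta> x y \<oplus>\<^bsub>Z\<^esub> \<beta> x' y"
    and "x \<in> carrier X \<Longrightarrow> y \<in> carrier Y \<Longrightarrow> y' \<in> carrier Y \<Longrightarrow>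
      \<beta> x (y \<oplus>\<^bsub>Y\<^esub> y') = \<beta> x y \<oplus>\<^bsub>Z\<^esub> \<beta> x y'"
    and "s \<in> carrier S \<Longrightarrow> x \<in> carrier X \<Longrightarrow> y \<in> carrier Y \<Longrightarrow> \<beta> (s \<odot>\<^bsub>X\<^esub> x) y = s \<odot>\<^bsub>Z\<^esub> \<beta> x y"
    and "s \<in> carrier S \<Longrightarrow> x \<in> carrier X \<Longrightarrow> y \<in> carrier Y \<Longrightarrow> \<beta> x (s \<odot>\<^bsub>Y\<^esub> y) = s \<odot>\<^bsub>Z\<^esub> \<beta> x y"
  using assms by (auto simp: bilinear_map_def)

locale proj_tensor =
  fixes R :: "'r ring" and K :: "('r, 'v) tensor_data"
  assumes cring_R: "cring R" and tensor_data: "is_tensor_data R K"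
begin

sublocale R: cring R by (rule cring_R)

abbreviation P where "P \<equiv> (proj_modules R :: ('r, 'v) module set)"
abbreviation U where "U \<equiv> unit_obj K"
abbreviation u where "u \<equiv> unit_gen K"
abbreviation T where "T \<equiv> tens_obj K"
abbreviation t where "t \<equiv> tens K"

lemma proj_module: "V \<in> P \<Longrightarrow> module R V"
  by (simp add: proj_modules_def)

lemma U_proj: "U \<in> P" and u_closed: "u \<in> carrier U"
  and u_bij: "bij_betw (\<lambda>r. r \<odot>\<^bsub>U\<^esub> u) (carrier R) (carrier U)"
  using tensor_data by (auto simp: is_tensor_data_def)

lemma T_proj: "V \<in> P \<Longrightarrow> V' \<in> P \<Longrightarrow> T V V' \<in> P"
  using tensor_data by (simp add: is_tensor_data_def)

lemma tens_iso:
  assumes "V \<in> P" "V' \<in> P"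
  obtains h where "h \<in> mod_hom R (tensor R (symmetric_bimodule V) V') (T V V')"
    "bij_betw h (carrier (tensor R (symmetric_bimodule V) V')) (carrier (T V V'))"
    "\<And>v v'. v \<in> carrier V \<Longrightarrow> v' \<in> carrier V' \<Longrightarrow>
      h (tensor_elem R (symmetric_bimodule V) V' v v') = t V V' v v'"
  using tensor_data assms unfolding is_tensor_data_def by blast

lemma bimodule_tensor: "V \<in> P \<Longrightarrow> V' \<in> P \<Longrightarrow> bimodule_tensor R (symmetric_bimodule V) V'"
  by (intro bimodule_tensor.intro symmetric_bimodule proj_module)

lemma tens_bilinear:
  assumes "V \<in> P" "V' \<in> P"
  shows "bilinear_map R V V' (T V V') (t V V')"
proof -
  interpret X: bimodule_tensor R "symmetric_bimodule V" V' by (rule bimodule_tensor[OF assms])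
  interpret V: module R V by (rule proj_module[OF assms(1)])
  obtain h where h: "h \<in> mod_hom R X.MV (T V V')"
    and elem: "\<And>v v'. v \<in> carrier V \<Longrightarrow> v' \<in> carrier V' \<Longrightarrow> t V V' v v' = h (X.elem v v')"
    using tens_iso[OF assms] by metis
  note c = X.elem_closed[unfolded symmetric_bimodule_simps]
  have bal: "X.elem v (r \<odot>\<^bsub>V'\<^esub> v') = r \<odot>\<^bsub>X.MV\<^esub> X.elem v v'"
    if "r \<in> carrier R" "v \<in> carrier V" "v' \<in> carrier V'" for r v v'
    using X.elem_balanced[of v r v'] X.smult_elem[of r v v'] that by simp
  show ?thesis
    unfolding bilinear_map_def
    using X.elem_add_left X.elem_add_right X.smult_elem
    by (auto simp: elem mod_hom_closed[OF h] c mod_hom_add[OF h] bal mod_hom_smult[OF h, symmetric])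
qed

lemmas tens_closed = bilinear_mapD(1)[OF tens_bilinear]
lemmas tens_add_left = bilinear_mapD(2)[OF tens_bilinear]
lemmas tens_add_right = bilinear_mapD(3)[OF tens_bilinear]
lemmas tens_smult_left = bilinear_mapD(4)[OF tens_bilinear]
lemmas tens_smult_right = bilinear_mapD(5)[OF tens_bilinear]

lemma tens_induct [consumes 3, case_names tens add]:
  assumes "V \<in> P" "V' \<in> P" "z \<in> carrier (T V V')"
    and tens: "\<And>v v'. v \<in> carrier V \<Longrightarrow> v' \<in> carrier V' \<Longrightarrow> Q (t V V' v v')"
    and add: "\<And>x y. x \<in> carrier (T V V') \<Longrightarrow> y \<in> carrier (T V V') \<Longrightarrow> Q x \<Longrightarrow> Q y \<Longrightarrow>
      Q (x \<oplus>\<^bsub>T V V'\<^esub> y)"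
  shows "Q z"
proof -
  interpret X: bimodule_tensor R "symmetric_bimodule V" V' by (rule bimodule_tensor[OF assms(1,2)])
  obtain h where h: "h \<in> mod_hom R X.MV (T V V')" "bij_betw h (carrier X.MV) (carrier (T V V'))"
    and elem: "\<And>v v'. v \<in> carrier V \<Longrightarrow> v' \<in> carrier V' \<Longrightarrow> h (X.elem v v') = t V V' v v'"
    by (rule tens_iso[OF assms(1,2)]) metis
  obtain x where x: "z = h x" "x \<in> carrier X.MV"
    using h(2) assms(3) by (auto simp: bij_betw_def)
  have "Q (h x)"
    using x(2)
  proof (induction rule: X.tensor_induct)
    case (elem m v)
    then show ?case using tens by (simp add: \<open>\<And>v v'. _ \<Longrightarrow> _ \<Longrightarrow> h (X.elem v v') = _\<close>)
  next
    case (add x y)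
    then show ?case using assms(5) by (simp add: mod_hom_add[OF h(1)] mod_hom_closed[OF h(1)])
  qed
  then show ?thesis by (simp add: x)
qed

lemma tens_ext:
  assumes "V \<in> P" "V' \<in> P" "f \<in> mod_hom R (T V V') W" "g \<in> mod_hom R (T V V') W"
    and "\<And>v v'. v \<in> carrier V \<Longrightarrow> v' \<in> carrier V' \<Longrightarrow> f (t V V' v v') = g (t V V' v v')"
  shows "f = g"
proof (rule mod_hom_eqI[OF assms(3,4)])
  show "f x = g x" if "x \<in> carrier (T V V')" for x
    using assms(1,2) that
    by (induction rule: tens_induct) (simp_all add: assms(5) mod_hom_add[OF assms(3)] mod_hom_add[OF assms(4)])
qed

text \<open>
  The universal property, transported from the construction of the tensor product along the bijection
  with the chosen one.
\<close>

lemma tens_lift: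
  assumes "V \<in> P" "V' \<in> P" "module R W" "bilinear_map R V V' W \<beta>"
  obtains h where "h \<in> mod_hom R (T V V') W"
    "\<And>v v'. v \<in> carrier V \<Longrightarrow> v' \<in> carrier V' \<Longrightarrow> h (t V V' v v') = \<beta> v v'"
proof -
  interpret X: bimodule_tensor R "symmetric_bimodule V" V' by (rule bimodule_tensor[OF assms(1,2)])
  interpret T: module R "T V V'" by (intro proj_module T_proj assms)
  interpret V: module R V by (intro proj_module assms)
  interpret MV: abelian_group X.MV by (rule X.abelian_group_MV)
  note b = bilinear_mapD[OF assms(4)]
  obtain j where j: "j \<in> mod_hom R X.MV (T V V')" "bij_betw j (carrier X.MV) (carrier (T V V'))"
    and j_elem: "\<And>v v'. v \<in> carrier V \<Longrightarrow> v' \<in> carrier V' \<Longrightarrow> j (X.elem v v') = t V V' v v'"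
    by (rule tens_iso[OF assms(1,2)]) metis
  obtain k where k: "\<And>x. x \<in> carrier X.MV \<Longrightarrow> k x \<in> carrier W"
    "\<And>x y. x \<in> carrier X.MV \<Longrightarrow> y \<in> carrier X.MV \<Longrightarrow> k (x \<oplus>\<^bsub>X.MV\<^esub> y) = k x \<oplus>\<^bsub>W\<^esub> k y"
    "\<And>r x. r \<in> carrier R \<Longrightarrow> x \<in> carrier X.MV \<Longrightarrow> k (r \<odot>\<^bsub>X.MV\<^esub> x) = r \<odot>\<^bsub>W\<^esub> k x"
    "\<And>v v'. v \<in> carrier V \<Longrightarrow> v' \<in> carrier V' \<Longrightarrow> k (X.elem v v') = \<beta> v v'"
  proof (rule X.tensor_universal_linear[OF assms(3), of \<beta>])
    fix h assume "\<And>x. x \<in> carrier X.MV \<Longrightarrow> h x \<in> carrier W"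
      "\<And>x y. x \<in> carrier X.MV \<Longrightarrow> y \<in> carrier X.MV \<Longrightarrow> h (x \<oplus>\<^bsub>X.MV\<^esub> y) = h x \<oplus>\<^bsub>W\<^esub> h y"
      "\<And>r x. r \<in> carrier R \<Longrightarrow> x \<in> carrier X.MV \<Longrightarrow> h (r \<odot>\<^bsub>X.MV\<^esub> x) = r \<odot>\<^bsub>W\<^esub> h x"
      "\<And>v v'. v \<in> carrier (symmetric_bimodule V) \<Longrightarrow> v' \<in> carrier V' \<Longrightarrow> h (X.elem v v') = \<beta> v v'"
    then show thesis by (intro that[of h]) simp_all
  qed (simp_all add: b)
  define i where "i = the_inv_into (carrier X.MV) j"
  have ij: "i (j x) = x" if "x \<in> carrier X.MV" for x
    using j(2) that by (simp add: i_def bij_betw_def the_inv_into_f_f)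
  have surj: "\<exists>x\<in>carrier X.MV. z = j x" if "z \<in> carrier (T V V')" for z
    using j(2) that by (auto simp: bij_betw_def)
  have smult_closed: "r \<odot>\<^bsub>X.MV\<^esub> x \<in> carrier X.MV" if "r \<in> carrier R" "x \<in> carrier X.MV" for r x
    using that(2)
  proof (induction rule: X.tensor_induct)
    case (elem m v)
    then show ?case using that(1) X.smult_elem[of r m v] X.elem_closed[of "r \<odot>\<^bsub>V\<^esub> m" v] by simp
  next
    case (add x y)
    then show ?case using that(1) MV.a_closed by (simp add: X.smult_add_MV)
  qed
  define h where "h = (\<lambda>z\<in>carrier (T V V'). k (i z))"
  have hj: "h (j x) = k x" if "x \<in> carrier X.MV" for x
    using that by (simp add: h_def ij mod_hom_closed[OF j(1)])
  have "h \<in> mod_hom R (T V V') W"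
  proof (rule mod_homI)
    show "h x \<in> carrier W" if "x \<in> carrier (T V V')" for x
      using surj[OF that] k(1) by (auto simp: hj)
    show "h (x \<oplus>\<^bsub>T V V'\<^esub> y) = h x \<oplus>\<^bsub>W\<^esub> h y" if "x \<in> carrier (T V V')" "y \<in> carrier (T V V')" for x y
      using surj[OF that(1)] surj[OF that(2)]
      by (auto simp: hj k(2) simp flip: mod_hom_add[OF j(1)])
    show "h (s \<odot>\<^bsub>T V V'\<^esub> x) = s \<odot>\<^bsub>W\<^esub> h x" if "s \<in> carrier R" "x \<in> carrier (T V V')" for s x
      using surj[OF that(2)] that(1)
      by (auto simp: hj k(3) smult_closed simp flip: mod_hom_smult[OF j(1)])
  qed (simp add: h_def)
  moreover have "h (t V V' v v') = \<beta> v v'" if "v \<in> carrier V" "v' \<in> carrier V'" for v v'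
    using that X.elem_closed[of v v'] hj[of "X.elem v v'"] by (simp add: j_elem k(4))
  ultimately show ?thesis by (rule that)
qed

text \<open>
  Evaluates the definite descriptions by which \<^const>\<open>tens_map\<close>, the associator and the unitors are
  defined.
\<close>

lemma tens_the:
  assumes "V \<in> P" "V' \<in> P" "module R W" "bilinear_map R V V' W \<beta>"
  defines "h \<equiv> THE h. h \<in> mod_hom R (T V V') W \<and>
    (\<forall>v\<in>carrier V. \<forall>v'\<in>carrier V'. h (t V V' v v') = \<beta> v v')"
  shows "h \<in> mod_hom R (T V V') W"
    and "v \<in> carrier V \<Longrightarrow> v' \<in> carrier V' \<Longrightarrow> h (t V V' v v') = \<beta> v v'"
proof -
  obtain k where k: "k \<in> mod_hom R (T V V') W"
    "\<And>v v'. v \<in> carrier V \<Longrightarrow> v' \<in> carrier V' \<Longrightarrow> k (t V V' v v') = \<beta> v v'"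
    using tens_lift[OF assms(1-4)] by blast
  have "h \<in> mod_hom R (T V V') W \<and>
    (\<forall>v\<in>carrier V. \<forall>v'\<in>carrier V'. h (t V V' v v') = \<beta> v v')"
    unfolding h_def
  proof (rule theI[of _ k])
    show "k \<in> mod_hom R (T V V') W \<and> (\<forall>v\<in>carrier V. \<forall>v'\<in>carrier V'. k (t V V' v v') = \<beta> v v')"
      using k by simp
  next
    fix l assume "l \<in> mod_hom R (T V V') W \<and> (\<forall>v\<in>carrier V. \<forall>v'\<in>carrier V'. l (t V V' v v') = \<beta> v v')"
    then show "l = k" using tens_ext[OF assms(1,2) _ k(1), of l] k(2) by simp
  qed
  then show "h \<in> mod_hom R (T V V') W"
    and "v \<in> carrier V \<Longrightarrow> v' \<in> carrier V' \<Longrightarrow> h (t V V' v v') = \<beta> v v'" by auto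
qed

lemma tens_map:
  assumes "V \<in> P" "V' \<in> P" "W \<in> P" "W' \<in> P" "f \<in> mod_hom R V W" "f' \<in> mod_hom R V' W'"
  shows tens_map_hom: "tens_map R K V V' W W' f f' \<in> mod_hom R (T V V') (T W W')"
    and tens_map_tens: "v \<in> carrier V \<Longrightarrow> v' \<in> carrier V' \<Longrightarrow>
      tens_map R K V V' W W' f f' (t V V' v v') = t W W' (f v) (f' v')"
proof -
  have "bilinear_map R V V' (T W W') (\<lambda>v v'. t W W' (f v) (f' v'))"
    unfolding bilinear_map_def
    using assms(3,4) mod_hom_closed[OF assms(5)] mod_hom_closed[OF assms(6)]
    by (auto simp: tens_closed tens_add_left tens_add_right tens_smult_left tens_smult_right
        mod_hom_add[OF assms(5)] mod_hom_add[OF assms(6)] mod_hom_smult[OF assms(5)] mod_hom_smult[OF assms(6)])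
  note * = tens_the[OF assms(1,2) proj_module[OF T_proj[OF assms(3,4)]] this, folded tens_map_def]
  show "tens_map R K V V' W W' f f' \<in> mod_hom R (T V V') (T W W')" by (rule *)
  show "tens_map R K V V' W W' f f' (t V V' v v') = t W W' (f v) (f' v')"
    if "v \<in> carrier V" "v' \<in> carrier V'" using that by (rule *)
qed

lemma left_mult_hom:
  assumes "V \<in> P" "V' \<in> P" "v \<in> carrier V"
  shows "(\<lambda>v'\<in>carrier V'. t V V' v v') \<in> mod_hom R V' (T V V')"
proof -
  interpret V': module R V' by (rule proj_module) fact
  show ?thesis
    using assms by (intro mod_homI) (auto simp: tens_closed tens_add_right tens_smult_right)
qed

lemma right_mult_hom:
  assumes "V \<in> P" "V' \<in> P" "v' \<in> carrier V'"
  shows "(\<lambda>v\<in>carrier V. t V V' v v') \<in> mod_hom R V (T V V')"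
proof -
  interpret V: module R V by (rule proj_module) fact
  show ?thesis
    using assms by (intro mod_homI) (auto simp: tens_closed tens_add_left tens_smult_left)
qed

lemma tens_zero:
  assumes "V \<in> P" "V' \<in> P"
  shows tens_zero_left: "v' \<in> carrier V' \<Longrightarrow> t V V' \<zero>\<^bsub>V\<^esub> v' = \<zero>\<^bsub>T V V'\<^esub>"
    and tens_zero_right: "v \<in> carrier V \<Longrightarrow> t V V' v \<zero>\<^bsub>V'\<^esub> = \<zero>\<^bsub>T V V'\<^esub>"
proof -
  interpret V: module R V by (rule proj_module) fact
  interpret V': module R V' by (rule proj_module) fact
  interpret T: module R "T V V'" by (intro proj_module T_proj assms)
  show "t V V' \<zero>\<^bsub>V\<^esub> v' = \<zero>\<^bsub>T V V'\<^esub>" if "v' \<in> carrier V'"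
    using mod_hom_zero[OF right_mult_hom[OF assms that] proj_module proj_module] assms T_proj by simp
  show "t V V' v \<zero>\<^bsub>V'\<^esub> = \<zero>\<^bsub>T V V'\<^esub>" if "v \<in> carrier V"
    using mod_hom_zero[OF left_mult_hom[OF assms that] proj_module proj_module] assms T_proj by simp
qed

text \<open>
  For fixed \<open>z\<close>, the map \<open>x \<otimes> y \<mapsto> x \<otimes> (y \<otimes> z)\<close> is linear; linearity in \<open>z\<close> then gives the associator.
\<close>

lemma associator:
  assumes "V \<in> P" "V' \<in> P" "V'' \<in> P"
  shows associator_hom: "associator R K V V' V'' \<in> mod_hom R (T (T V V') V'') (T V (T V' V''))"
    and associator_tens: "x \<in> carrier V \<Longrightarrow> y \<in> carrier V' \<Longrightarrow> z \<in> carrier V'' \<Longrightarrow>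
      associator R K V V' V'' (t (T V V') V'' (t V V' x y) z) = t V (T V' V'') x (t V' V'' y z)"
proof -
  let ?L = "T V V'" and ?N = "T V (T V' V'')"
  have mod: "?L \<in> P" "?N \<in> P" "T V' V'' \<in> P" "T ?L V'' \<in> P" using assms by (simp_all add: T_proj)
  interpret V'': module R V'' by (intro proj_module assms)
  interpret L: module R ?L by (intro proj_module mod)
  interpret N: module R ?N by (intro proj_module mod)
  have "\<forall>z\<in>carrier V''. \<exists>h\<in>mod_hom R ?L ?N. \<forall>x\<in>carrier V. \<forall>y\<in>carrier V'.
      h (t V V' x y) = t V (T V' V'') x (t V' V'' y z)"
  proof
    fix z assume z: "z \<in> carrier V''"
    have "bilinear_map R V V' ?N (\<lambda>x y. t V (T V' V'') x (t V' V'' y z))"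
      unfolding bilinear_map_def
      using assms mod z by (auto simp: tens_closed tens_add_left tens_add_right tens_smult_left tens_smult_right)
    then show "\<exists>h\<in>mod_hom R ?L ?N. \<forall>x\<in>carrier V. \<forall>y\<in>carrier V'.
      h (t V V' x y) = t V (T V' V'') x (t V' V'' y z)"
      using tens_lift[OF assms(1,2) proj_module[OF mod(2)]] by metis
  qed
  then obtain h where h: "\<And>z. z \<in> carrier V'' \<Longrightarrow> h z \<in> mod_hom R ?L ?N"
    and h_tens: "\<And>x y z. x \<in> carrier V \<Longrightarrow> y \<in> carrier V' \<Longrightarrow> z \<in> carrier V'' \<Longrightarrow>
      h z (t V V' x y) = t V (T V' V'') x (t V' V'' y z)"
    by metis
  have h_add: "h (z \<oplus>\<^bsub>V''\<^esub> z') w = h z w \<oplus>\<^bsub>?N\<^esub> h z' w"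
    if z: "z \<in> carrier V''" "z' \<in> carrier V''" and w: "w \<in> carrier ?L" for z z' w
    using assms(1,2) w
  proof (induction rule: tens_induct)
    case (tens v v')
    then show ?case using z assms mod by (simp add: h_tens tens_closed tens_add_right)
  next
    case (add x y)
    then show ?case using z mod_hom_closed[OF h[OF z(1)]] mod_hom_closed[OF h[OF z(2)]]
      by (simp add: mod_hom_add[OF h] N.a_ac)
  qed
  have h_smult: "h (r \<odot>\<^bsub>V''\<^esub> z) w = r \<odot>\<^bsub>?N\<^esub> h z w"
    if z: "r \<in> carrier R" "z \<in> carrier V''" and w: "w \<in> carrier ?L" for z r w
    using assms(1,2) w
  proof (induction rule: tens_induct)
    case (tens v v')
    then show ?case using z assms mod by (simp add: h_tens tens_closed tens_smult_right)
  next
    case (add x y)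
    then show ?case using z mod_hom_closed[OF h[OF z(2)]]
      by (simp add: mod_hom_add[OF h] N.smult_r_distr)
  qed
  have bil: "bilinear_map R ?L V'' ?N (\<lambda>w z. h z w)"
    unfolding bilinear_map_def
    by (auto simp: h_add h_smult mod_hom_closed[OF h] mod_hom_add[OF h] mod_hom_smult[OF h])
  \<comment> \<open>additivity extends the condition on \<open>(x \<otimes> y, z)\<close> to all pairs \<open>(w, z)\<close>\<close>
  have eq: "associator R K V V' V'' = (THE k. k \<in> mod_hom R (T ?L V'') ?N \<and>
      (\<forall>w\<in>carrier ?L. \<forall>z\<in>carrier V''. k (t ?L V'' w z) = h z w))"
    unfolding associator_def
  proof (rule arg_cong[of _ _ The], rule ext, rule conj_cong[OF refl])
    fix k assume k: "k \<in> mod_hom R (T ?L V'') ?N"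
    show "(\<forall>v\<in>carrier V. \<forall>v'\<in>carrier V'. \<forall>v''\<in>carrier V''.
          k (t ?L V'' (t V V' v v') v'') = t V (T V' V'') v (t V' V'' v' v'')) \<longleftrightarrow>
        (\<forall>w\<in>carrier ?L. \<forall>z\<in>carrier V''. k (t ?L V'' w z) = h z w)" (is "?l = ?r")
    proof
      assume l: ?l
      have "k (t ?L V'' w z) = h z w" if z: "z \<in> carrier V''" and w: "w \<in> carrier ?L" for w z
        using assms(1,2) w
      proof (induction rule: tens_induct)
        case (tens v v')
        then show ?case using l z by (simp add: h_tens)
      next
        case (add x y)
        then show ?case using z mod assms
          by (simp add: tens_add_left tens_closed mod_hom_add[OF k] mod_hom_add[OF h])
      qed
      then show ?r by simp
    next
      assume ?r
      then show ?l using assms by (simp add: h_tens tens_closed)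
    qed
  qed
  note * = tens_the[OF mod(1) assms(3) proj_module[OF mod(2)] bil, folded eq]
  show "associator R K V V' V'' \<in> mod_hom R (T (T V V') V'') (T V (T V' V''))" by (rule *)
  show "associator R K V V' V'' (t (T V V') V'' (t V V' x y) z) = t V (T V' V'') x (t V' V'' y z)"
    if "x \<in> carrier V" "y \<in> carrier V'" "z \<in> carrier V''"
    using that assms by (simp add: * h_tens tens_closed)
qed

subsection \<open>The unit object\<close>

definition coord :: "'v \<Rightarrow> 'r"
  where "coord x = (THE r. r \<in> carrier R \<and> x = r \<odot>\<^bsub>U\<^esub> u)"

lemma coord_smult_u: "r \<in> carrier R \<Longrightarrow> coord (r \<odot>\<^bsub>U\<^esub> u) = r"
  using u_bij unfolding coord_def by (intro the_equality) (auto simp: bij_betw_def inj_on_def)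

lemma coord:
  assumes "x \<in> carrier U"
  shows coord_closed: "coord x \<in> carrier R" and coord_eq: "coord x \<odot>\<^bsub>U\<^esub> u = x"
proof -
  obtain r where "r \<in> carrier R" "x = r \<odot>\<^bsub>U\<^esub> u" using u_bij assms by (auto simp: bij_betw_def)
  then show "coord x \<in> carrier R" "coord x \<odot>\<^bsub>U\<^esub> u = x" by (simp_all add: coord_smult_u)
qed

lemma coord_add: "x \<in> carrier U \<Longrightarrow> y \<in> carrier U \<Longrightarrow> coord (x \<oplus>\<^bsub>U\<^esub> y) = coord x \<oplus>\<^bsub>R\<^esub> coord y"
proof -
  assume xy: "x \<in> carrier U" "y \<in> carrier U"
  interpret U: module R U by (intro proj_module U_proj)
  have "x \<oplus>\<^bsub>U\<^esub> y = (coord x \<oplus>\<^bsub>R\<^esub> coord y) \<odot>\<^bsub>U\<^esub> u"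
    using xy by (simp add: U.smult_l_distr coord u_closed)
  then show ?thesis using xy by (simp add: coord_smult_u coord)
qed

lemma coord_smult: "r \<in> carrier R \<Longrightarrow> x \<in> carrier U \<Longrightarrow> coord (r \<odot>\<^bsub>U\<^esub> x) = r \<otimes>\<^bsub>R\<^esub> coord x"
proof -
  assume rx: "r \<in> carrier R" "x \<in> carrier U"
  interpret U: module R U by (intro proj_module U_proj)
  have "r \<odot>\<^bsub>U\<^esub> x = (r \<otimes>\<^bsub>R\<^esub> coord x) \<odot>\<^bsub>U\<^esub> u"
    using rx by (simp add: U.smult_assoc1 coord u_closed)
  then show ?thesis using rx by (simp add: coord_smult_u coord)
qed

lemma coord_u: "coord u = \<one>\<^bsub>R\<^esub>"
proof -
  interpret U: module R U by (intro proj_module U_proj)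
  show ?thesis using coord_smult_u[of "\<one>\<^bsub>R\<^esub>"] u_closed by simp
qed

lemma point_eq: "x \<in> carrier U \<Longrightarrow> point R K V v x = coord x \<odot>\<^bsub>V\<^esub> v"
  by (simp add: point_def coord_def)

lemma point_u: "V \<in> P \<Longrightarrow> v \<in> carrier V \<Longrightarrow> point R K V v u = v"
  using module.smult_one[OF proj_module[of V]] by (simp add: point_eq u_closed coord_u)

lemma point_hom:
  assumes "V \<in> P" "v \<in> carrier V"
  shows "point R K V v \<in> mod_hom R U V"
proof -
  interpret V: module R V by (intro proj_module assms)
  interpret U: module R U by (intro proj_module U_proj)
  show ?thesis
    using assms(2)
    by (intro mod_homI)
      (simp_all add: point_eq coord_closed coord_add V.smult_l_distr coord_smult V.smult_assoc1,
       simp add: point_def)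
qed

lemma U_ext:
  assumes "f \<in> mod_hom R U V" "g \<in> mod_hom R U V" "f u = g u"
  shows "f = g"
proof (rule mod_hom_eqI[OF assms(1,2)])
  fix x assume x: "x \<in> carrier U"
  show "f x = g x"
    using mod_hom_smult[OF assms(1) coord_closed[OF x] u_closed]
      mod_hom_smult[OF assms(2) coord_closed[OF x] u_closed] assms(3) by (simp add: coord_eq[OF x])
qed

lemma point_unit: "point R K U u = (\<lambda>x\<in>carrier U. x)"
  using U_proj u_closed by (intro U_ext[of _ U] point_hom mod_hom_id proj_module) (simp_all add: point_u)

lemma point_comp:
  assumes "V \<in> P" "W \<in> P" "f \<in> mod_hom R V W" "v \<in> carrier V"
  shows "compose (carrier U) f (point R K V v) = point R K W (f v)"
  using assms U_proj
  by (intro U_ext[of _ W] mod_hom_compose[of _ _ _ V] point_hom proj_module)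
    (simp_all add: mod_hom_closed compose_def point_u u_closed)

lemma left_unitor:
  assumes "V \<in> P"
  shows left_unitor_hom: "left_unitor R K V \<in> mod_hom R (T U V) V"
    and left_unitor_tens: "v \<in> carrier V \<Longrightarrow> left_unitor R K V (t U V u v) = v"
proof -
  interpret V: module R V by (intro proj_module assms)
  interpret U: module R U by (intro proj_module U_proj)
  note mod = U_proj assms
  have bil: "bilinear_map R U V V (\<lambda>x v. coord x \<odot>\<^bsub>V\<^esub> v)"
    unfolding bilinear_map_def
    by (auto simp: coord_closed coord_add coord_smult V.smult_l_distr V.smult_r_distr R.m_ac
        simp flip: V.smult_assoc1)
  have eq: "left_unitor R K V = (THE h. h \<in> mod_hom R (T U V) V \<and>
      (\<forall>x\<in>carrier U. \<forall>v\<in>carrier V. h (t U V x v) = coord x \<odot>\<^bsub>V\<^esub> v))"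
    unfolding left_unitor_def
  proof (rule arg_cong[of _ _ The], rule ext, rule conj_cong[OF refl])
    fix h assume h: "h \<in> mod_hom R (T U V) V"
    have "h (t U V x v) = coord x \<odot>\<^bsub>V\<^esub> v"
      if "x \<in> carrier U" "v \<in> carrier V" "h (t U V u v) = v" for x v
      using tens_smult_left[OF mod coord_closed[OF that(1)] u_closed that(2)]
        mod_hom_smult[OF h coord_closed[OF that(1)] tens_closed[OF mod u_closed that(2)]] that
      by (simp add: coord_eq)
    moreover have "h (t U V u v) = v"
      if "v \<in> carrier V" "h (t U V u v) = coord u \<odot>\<^bsub>V\<^esub> v" for v
      using that by (simp add: coord_u)
    ultimately show "(\<forall>v\<in>carrier V. h (t U V u v) = v) \<longleftrightarrow>
        (\<forall>x\<in>carrier U. \<forall>v\<in>carrier V. h (t U V x v) = coord x \<odot>\<^bsub>V\<^esub> v)"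
      using u_closed by blast
  qed
  note * = tens_the[OF mod proj_module[OF assms] bil, folded eq]
  show "left_unitor R K V \<in> mod_hom R (T U V) V" by (rule *)
  show "left_unitor R K V (t U V u v) = v" if "v \<in> carrier V"
    using that u_closed by (simp add: * coord_u)
qed

lemma right_unitor:
  assumes "V \<in> P"
  shows right_unitor_hom: "right_unitor R K V \<in> mod_hom R (T V U) V"
    and right_unitor_tens: "v \<in> carrier V \<Longrightarrow> right_unitor R K V (t V U v u) = v"
proof -
  interpret V: module R V by (intro proj_module assms)
  interpret U: module R U by (intro proj_module U_proj)
  note mod = assms U_proj
  have bil: "bilinear_map R V U V (\<lambda>v x. coord x \<odot>\<^bsub>V\<^esub> v)"
    unfolding bilinear_map_def
    by (auto simp: coord_closed coord_add coord_smult V.smult_l_distr V.smult_r_distr R.m_ac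
        simp flip: V.smult_assoc1)
  have eq: "right_unitor R K V = (THE h. h \<in> mod_hom R (T V U) V \<and>
      (\<forall>v\<in>carrier V. \<forall>x\<in>carrier U. h (t V U v x) = coord x \<odot>\<^bsub>V\<^esub> v))"
    unfolding right_unitor_def
  proof (rule arg_cong[of _ _ The], rule ext, rule conj_cong[OF refl])
    fix h assume h: "h \<in> mod_hom R (T V U) V"
    have "h (t V U v x) = coord x \<odot>\<^bsub>V\<^esub> v"
      if "x \<in> carrier U" "v \<in> carrier V" "h (t V U v u) = v" for x v
      using tens_smult_right[OF mod coord_closed[OF that(1)] that(2) u_closed]
        mod_hom_smult[OF h coord_closed[OF that(1)] tens_closed[OF mod that(2) u_closed]] that
      by (simp add: coord_eq)
    moreover have "h (t V U v u) = v"
      if "v \<in> carrier V" "h (t V U v u) = coord u \<odot>\<^bsub>V\<^esub> v" for v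
      using that by (simp add: coord_u)
    ultimately show "(\<forall>v\<in>carrier V. h (t V U v u) = v) \<longleftrightarrow>
        (\<forall>v\<in>carrier V. \<forall>x\<in>carrier U. h (t V U v x) = coord x \<odot>\<^bsub>V\<^esub> v)"
      using u_closed by blast
  qed
  note * = tens_the[OF mod proj_module[OF assms] bil, folded eq]
  show "right_unitor R K V \<in> mod_hom R (T V U) V" by (rule *)
  show "right_unitor R K V (t V U v u) = v" if "v \<in> carrier V"
    using that u_closed by (simp add: * coord_u)
qed

text \<open>
  Multiplication by \<open>v'\<close> on the right is the composite of \<open>V \<cong> V \<otimes> R\<close> with \<open>id \<otimes> v'\<close>, where \<open>v'\<close> is
  viewed as a map from the unit object. This is how functoriality and unitality of a product
  determine the products with the elements \<open>C\<^sub>0(v')(s)\<close>.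
\<close>

lemma right_mult_unitor:
  assumes "V \<in> P" "V' \<in> P" "v' \<in> carrier V'"
  shows "compose (carrier (T V U)) (\<lambda>v\<in>carrier V. t V V' v v') (right_unitor R K V) =
    tens_map R K V U V V' (\<lambda>v\<in>carrier V. v) (point R K V' v')"
proof (rule tens_ext[of V U _ "T V V'"])
  note mod = assms U_proj T_proj proj_module
  have id: "(\<lambda>v\<in>carrier V. v) \<in> mod_hom R V V" using mod by (intro mod_hom_id)
  note pt = point_hom[OF assms(2,3)]
  note tm = tens_map[OF assms(1) U_proj assms(1,2) id pt]
  show "compose (carrier (T V U)) (\<lambda>v\<in>carrier V. t V V' v v') (right_unitor R K V) \<in> mod_hom R (T V U) (T V V')"
    using mod by (intro mod_hom_compose[of _ _ _ V] right_unitor_hom right_mult_hom) auto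
  show "tens_map R K V U V V' (\<lambda>v\<in>carrier V. v) (point R K V' v') \<in> mod_hom R (T V U) (T V V')"
    by (rule tm)
  fix v x assume v: "v \<in> carrier V" and x: "x \<in> carrier U"
  have tx: "t V U v x = coord x \<odot>\<^bsub>T V U\<^esub> t V U v u"
    using tens_smult_right[OF assms(1) U_proj coord_closed[OF x] v u_closed] by (simp add: coord_eq x)
  have "right_unitor R K V (t V U v x) = coord x \<odot>\<^bsub>V\<^esub> v"
    using mod_hom_smult[OF right_unitor_hom[OF assms(1)] coord_closed[OF x] tens_closed[OF assms(1) U_proj v u_closed]]
    by (simp add: tx right_unitor_tens assms v)
  moreover have "coord x \<odot>\<^bsub>V\<^esub> v \<in> carrier V"
    using module.smult_closed[OF proj_module[OF assms(1)] coord_closed[OF x] v] .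
  ultimately show "compose (carrier (T V U)) (\<lambda>v\<in>carrier V. t V V' v v') (right_unitor R K V) (t V U v x) =
      tens_map R K V U V V' (\<lambda>v\<in>carrier V. v) (point R K V' v') (t V U v x)"
    using v x assms tm(2)[OF v x]
    by (simp add: compose_def tens_closed U_proj point_eq tens_smult_left tens_smult_right coord_closed)
qed (use assms U_proj in auto)

lemma left_mult_unitor:
  assumes "V \<in> P" "V' \<in> P" "v \<in> carrier V"
  shows "compose (carrier (T U V')) (\<lambda>v'\<in>carrier V'. t V V' v v') (left_unitor R K V') =
    tens_map R K U V' V V' (point R K V v) (\<lambda>v'\<in>carrier V'. v')"
proof (rule tens_ext[of U V' _ "T V V'"])
  note mod = assms U_proj T_proj proj_module
  have id: "(\<lambda>v\<in>carrier V'. v) \<in> mod_hom R V' V'" using mod by (intro mod_hom_id)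
  note pt = point_hom[OF assms(1,3)]
  note tm = tens_map[OF U_proj assms(2) assms(1,2) pt id]
  show "compose (carrier (T U V')) (\<lambda>v'\<in>carrier V'. t V V' v v') (left_unitor R K V') \<in> mod_hom R (T U V') (T V V')"
    using mod by (intro mod_hom_compose[of _ _ _ V'] left_unitor_hom left_mult_hom) auto
  show "tens_map R K U V' V V' (point R K V v) (\<lambda>v'\<in>carrier V'. v') \<in> mod_hom R (T U V') (T V V')"
    by (rule tm)
  fix x v' assume v': "v' \<in> carrier V'" and x: "x \<in> carrier U"
  have tx: "t U V' x v' = coord x \<odot>\<^bsub>T U V'\<^esub> t U V' u v'"
    using tens_smult_left[OF U_proj assms(2) coord_closed[OF x] u_closed v'] by (simp add: coord_eq x)
  have "left_unitor R K V' (t U V' x v') = coord x \<odot>\<^bsub>V'\<^esub> v'"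
    using mod_hom_smult[OF left_unitor_hom[OF assms(2)] coord_closed[OF x] tens_closed[OF U_proj assms(2) u_closed v']]
    by (simp add: tx left_unitor_tens assms v')
  moreover have "coord x \<odot>\<^bsub>V'\<^esub> v' \<in> carrier V'"
    using module.smult_closed[OF proj_module[OF assms(2)] coord_closed[OF x] v'] .
  ultimately show "compose (carrier (T U V')) (\<lambda>v'\<in>carrier V'. t V V' v v') (left_unitor R K V') (t U V' x v') =
      tens_map R K U V' V V' (point R K V v) (\<lambda>v'\<in>carrier V'. v') (t U V' x v')"
    using v' x assms tm(2)[OF x v']
    by (simp add: compose_def tens_closed U_proj point_eq tens_smult_left tens_smult_right coord_closed)
qed (use assms U_proj in auto)

end

section \<open>Free modules in the category\<close>

lemma free_module_simps:
  "carrier (free_module R n) = (\<Pi>\<^sub>E i\<in>{..<n}. carrier R)"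
  "x \<oplus>\<^bsub>free_module R n\<^esub> y = (\<lambda>i\<in>{..<n}. x i \<oplus>\<^bsub>R\<^esub> y i)"
  "r \<odot>\<^bsub>free_module R n\<^esub> x = (\<lambda>i\<in>{..<n}. r \<otimes>\<^bsub>R\<^esub> x i)"
  "\<zero>\<^bsub>free_module R n\<^esub> = (\<lambda>i\<in>{..<n}. \<zero>\<^bsub>R\<^esub>)"
  by (simp_all add: free_module_def)

lemma free_module:
  assumes "cring R"
  shows "module R (free_module R n)"
proof -
  interpret cring R by fact
  have "abelian_group (free_module R n)"
  proof (rule abelian_groupI)
    fix x assume "x \<in> carrier (free_module R n)"
    then show "\<exists>y\<in>carrier (free_module R n). y \<oplus>\<^bsub>free_module R n\<^esub> x = \<zero>\<^bsub>free_module R n\<^esub>"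
      by (intro bexI[of _ "\<lambda>i\<in>{..<n}. \<ominus>\<^bsub>R\<^esub> x i"])
        (auto simp: free_module_simps PiE_iff l_neg cong: restrict_cong)
  qed (auto simp: free_module_simps PiE_iff a_ac cong: restrict_cong intro: extensionalityI)
  then show ?thesis
    using assms
    by (intro moduleI)
      (auto simp: free_module_simps PiE_iff l_distr r_distr m_assoc cong: restrict_cong intro: extensionalityI)
qed

definition unit_vector :: "'r ring \<Rightarrow> nat \<Rightarrow> nat \<Rightarrow> nat \<Rightarrow> 'r"
  where "unit_vector R n i = (\<lambda>j\<in>{..<n}. if i = j then \<one>\<^bsub>R\<^esub> else \<zero>\<^bsub>R\<^esub>)"

lemma unit_vector_closed: "cring R \<Longrightarrow> unit_vector R n i \<in> carrier (free_module R n)"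
proof -
  assume "cring R"
  then interpret cring R .
  show ?thesis by (auto simp: unit_vector_def free_module_simps)
qed

lemma free_module_hom_exists:
  assumes "module R V" "\<And>i. i < n \<Longrightarrow> v i \<in> carrier V"
  obtains k where "k \<in> mod_hom R (free_module R n) V" "\<And>i. i < n \<Longrightarrow> k (unit_vector R n i) = v i"
proof -
  interpret V: module R V by fact
  define k where "k = (\<lambda>x\<in>carrier (free_module R n). (\<Oplus>\<^bsub>V\<^esub>i\<in>{..<n}. x i \<odot>\<^bsub>V\<^esub> v i))"
  interpret F: module R "free_module R n" by (intro free_module V.R.is_cring)
  have "k \<in> mod_hom R (free_module R n) V"
  proof (rule mod_homI)
    show "k x \<in> carrier V" if "x \<in> carrier (free_module R n)" for x
      using that assms(2) by (auto simp: k_def free_module_simps PiE_iff intro!: V.finsum_closed)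
    show "k (x \<oplus>\<^bsub>free_module R n\<^esub> y) = k x \<oplus>\<^bsub>V\<^esub> k y"
      if xy: "x \<in> carrier (free_module R n)" "y \<in> carrier (free_module R n)" for x y
    proof -
      have "k (x \<oplus>\<^bsub>free_module R n\<^esub> y) = (\<Oplus>\<^bsub>V\<^esub>i\<in>{..<n}. (x \<oplus>\<^bsub>free_module R n\<^esub> y) i \<odot>\<^bsub>V\<^esub> v i)"
        using F.a_closed[OF xy] by (simp add: k_def)
      also have "\<dots> = (\<Oplus>\<^bsub>V\<^esub>i\<in>{..<n}. x i \<odot>\<^bsub>V\<^esub> v i \<oplus>\<^bsub>V\<^esub> y i \<odot>\<^bsub>V\<^esub> v i)"
        using xy assms(2)
        by (intro V.finsum_cong') (auto simp: free_module_simps PiE_iff V.smult_l_distr)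
      also have "\<dots> = k x \<oplus>\<^bsub>V\<^esub> k y"
        using xy assms(2) unfolding k_def
        by (subst V.finsum_addf) (auto simp: free_module_simps PiE_iff)
      finally show ?thesis .
    qed
    show "k (r \<odot>\<^bsub>free_module R n\<^esub> x) = r \<odot>\<^bsub>V\<^esub> k x"
      if rx: "r \<in> carrier R" "x \<in> carrier (free_module R n)" for r x
    proof -
      have "k (r \<odot>\<^bsub>free_module R n\<^esub> x) = (\<Oplus>\<^bsub>V\<^esub>i\<in>{..<n}. (r \<odot>\<^bsub>free_module R n\<^esub> x) i \<odot>\<^bsub>V\<^esub> v i)"
        using F.smult_closed[OF rx] by (simp add: k_def)
      also have "\<dots> = (\<Oplus>\<^bsub>V\<^esub>i\<in>{..<n}. r \<odot>\<^bsub>V\<^esub> (x i \<odot>\<^bsub>V\<^esub> v i))"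
        using rx assms(2)
        by (intro V.finsum_cong') (auto simp: free_module_simps PiE_iff V.smult_assoc1)
      also have "\<dots> = r \<odot>\<^bsub>V\<^esub> k x"
        using rx assms(2) unfolding k_def
        by (subst V.finsum_smult_ldistr[symmetric]) (auto simp: free_module_simps PiE_iff)
      finally show ?thesis .
    qed
  qed (simp add: k_def)
  moreover have "k (unit_vector R n i) = v i" if i: "i < n" for i
  proof -
    have "k (unit_vector R n i) = (\<Oplus>\<^bsub>V\<^esub>j\<in>{..<n}. if i = j then v j else \<zero>\<^bsub>V\<^esub>)"
      using unit_vector_closed[OF V.R.is_cring, of n i] assms(2) unfolding k_def
      by (auto simp: unit_vector_def intro!: V.finsum_cong')
    also have "\<dots> = v i" using i assms(2) by (intro V.finsum_singleton) auto
    finally show ?thesis .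
  qed
  ultimately show ?thesis by (rule that)
qed

text \<open>
  By induction on a bound \<open>k\<close> for the indices of the nonzero coordinates, the last of which is split off.
\<close>

lemma free_module_ext:
  assumes "module R V" "f \<in> mod_hom R (free_module R n) V" "g \<in> mod_hom R (free_module R n) V"
    and e: "\<And>i. i < n \<Longrightarrow> f (unit_vector R n i) = g (unit_vector R n i)"
  shows "f = g"
proof (rule mod_hom_eqI[OF assms(2,3)])
  interpret V: module R V by fact
  let ?F = "free_module R n"
  interpret F: module R ?F by (intro free_module V.R.is_cring)
  have "f x = g x" if "x \<in> carrier ?F" "\<And>i. k \<le> i \<Longrightarrow> i < n \<Longrightarrow> x i = \<zero>\<^bsub>R\<^esub>" for k x
    using that
  proof (induction k arbitrary: x)
    case 0
    then have "x = \<zero>\<^bsub>?F\<^esub>" by (auto simp: free_module_simps PiE_iff intro: extensionalityI)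
    then show ?case
      using mod_hom_zero[OF assms(2) F.module_axioms assms(1)] mod_hom_zero[OF assms(3) F.module_axioms assms(1)]
      by simp
  next
    case (Suc k)
    show ?case
    proof (cases "k < n")
      case False
      then show ?thesis using Suc by simp
    next
      case k: True
      let ?e = "unit_vector R n k"
      define y where "y = (\<lambda>i\<in>{..<n}. if i = k then \<zero>\<^bsub>R\<^esub> else x i)"
      have xk: "x k \<in> carrier R" and y: "y \<in> carrier ?F"
        using Suc.prems(1) k by (auto simp: free_module_simps y_def PiE_iff)
      have e: "?e \<in> carrier ?F" by (intro unit_vector_closed V.R.is_cring)
      have "y i = \<zero>\<^bsub>R\<^esub>" if "k \<le> i" "i < n" for i
        using Suc.prems(2)[of i] that by (auto simp: y_def Suc_le_eq)
      then have "f y = g y" by (intro Suc.IH y)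
      moreover have "x = x k \<odot>\<^bsub>?F\<^esub> ?e \<oplus>\<^bsub>?F\<^esub> y"
        using Suc.prems(1) xk
        by (intro extensionalityI[of x "{..<n}"]) (auto simp: free_module_simps y_def unit_vector_def PiE_iff)
      ultimately show ?thesis
        using mod_hom_add[OF assms(2), of "x k \<odot>\<^bsub>?F\<^esub> ?e" y] mod_hom_add[OF assms(3), of "x k \<odot>\<^bsub>?F\<^esub> ?e" y]
          mod_hom_smult[OF assms(2) xk e] mod_hom_smult[OF assms(3) xk e] assms(4)[OF k] y e xk
        by simp
    qed
  qed
  from this[of _ n] show "f x = g x" if "x \<in> carrier ?F" for x using that by simp
qed

text \<open>Transport of structure along an injection of the carrier.\<close>

lemma module_transport:
  fixes X :: "('r, 'a) module" and g :: "'a \<Rightarrow> 'v"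
  assumes "module R X" "inj_on g (carrier X)"
  obtains Y :: "('r, 'v) module" and f h where
    "module R Y" "f \<in> mod_hom R X Y" "h \<in> mod_hom R Y X"
    "\<And>x. x \<in> carrier X \<Longrightarrow> h (f x) = x" "\<And>y. y \<in> carrier Y \<Longrightarrow> f (h y) = y"
proof -
  interpret X: module R X by fact
  define i where "i = the_inv_into (carrier X) g"
  have ig: "i (g x) = x" if "x \<in> carrier X" for x
    using assms(2) that by (simp add: i_def the_inv_into_f_f)
  define Y :: "('r, 'v) module" where "Y = \<lparr>carrier = g ` carrier X, monoid.mult = undefined, one = undefined,
    ring.zero = g \<zero>\<^bsub>X\<^esub>, add = (\<lambda>x y. g (i x \<oplus>\<^bsub>X\<^esub> i y)), smult = (\<lambda>r x. g (r \<odot>\<^bsub>X\<^esub> i x))\<rparr>"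
  have Y: "carrier Y = g ` carrier X" "\<zero>\<^bsub>Y\<^esub> = g \<zero>\<^bsub>X\<^esub>"
    "x \<oplus>\<^bsub>Y\<^esub> y = g (i x \<oplus>\<^bsub>X\<^esub> i y)" "r \<odot>\<^bsub>Y\<^esub> x = g (r \<odot>\<^bsub>X\<^esub> i x)" for x y r
    by (simp_all add: Y_def)
  have ab: "abelian_group Y"
  proof (rule abelian_groupI)
    fix y assume "y \<in> carrier Y"
    then obtain x where "y = g x" "x \<in> carrier X" by (auto simp: Y)
    then show "\<exists>z\<in>carrier Y. z \<oplus>\<^bsub>Y\<^esub> y = \<zero>\<^bsub>Y\<^esub>"
      by (intro bexI[of _ "g (\<ominus>\<^bsub>X\<^esub> x)"]) (auto simp: Y ig X.M.l_neg)
  qed (auto simp: Y ig X.M.a_ac)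
  have "module R Y"
    by (rule moduleI)
      (auto simp: ab Y ig X.smult_l_distr X.smult_r_distr X.smult_assoc1 X.R.is_cring)
  moreover have "(\<lambda>x\<in>carrier X. g x) \<in> mod_hom R X Y"
    by (rule mod_homI) (auto simp: Y ig)
  moreover have "(\<lambda>y\<in>carrier Y. i y) \<in> mod_hom R Y X"
    by (rule mod_homI) (auto simp: Y ig inj_on_eq_iff[OF assms(2)])
  ultimately show ?thesis
    by (rule that) (auto simp: Y ig)
qed

context proj_tensor
begin

text \<open>
  A free module of rank \<open>n\<close> exists in the category, since lists over \<open>R\<close> inject into the universe. Natural
  maps on \<open>V\<^sup>n\<close> are determined by their value on its basis \<open>e\<close>.
\<close>

lemma free_object:
  fixes n :: nat
  obtains F e where "F \<in> P" "\<forall>i<n. e i \<in> carrier F"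
    "\<forall>V\<in>P. \<forall>v. (\<forall>i<n. v i \<in> carrier V) \<longrightarrow> (\<exists>k\<in>mod_hom R F V. \<forall>i<n. k (e i) = v i)"
    "\<forall>V\<in>P. \<forall>f\<in>mod_hom R F V. \<forall>g\<in>mod_hom R F V. (\<forall>i<n. f (e i) = g (e i)) \<longrightarrow> f = g"
proof -
  obtain l :: "'r list \<Rightarrow> 'v" where l: "inj l"
    using tensor_data by (auto simp: is_tensor_data_def)
  let ?X = "free_module R n"
  define g where "g x = l (map x [0..<n])" for x
  have "inj_on g (carrier ?X)"
  proof (rule inj_onI)
    fix x y assume "x \<in> carrier ?X" "y \<in> carrier ?X" "g x = g y"
    then show "x = y"
      using injD[OF l, of "map x [0..<n]" "map y [0..<n]"]
      by (intro extensionalityI[of x "{..<n}" y]) (auto simp: g_def free_module_simps PiE_iff)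
  qed
  note X = free_module[OF cring_R, of n]
  obtain F :: "('r, 'v) module" and f h where F: "module R F" and f: "f \<in> mod_hom R ?X F" and h: "h \<in> mod_hom R F ?X"
    and hf: "\<And>x. x \<in> carrier ?X \<Longrightarrow> h (f x) = x" and fh: "\<And>y. y \<in> carrier F \<Longrightarrow> f (h y) = y"
    by (rule module_transport[OF X \<open>inj_on g (carrier ?X)\<close>]) metis
  have FP: "F \<in> P"
    unfolding proj_modules_def using F f h fh by blast
  have e: "unit_vector R n i \<in> carrier ?X" for i by (rule unit_vector_closed[OF cring_R])
  have fe: "f (unit_vector R n i) \<in> carrier F" for i
    by (rule mod_hom_closed[OF f e])
  show ?thesis
  proof (rule that[of F "\<lambda>i. f (unit_vector R n i)"], intro FP, simp add: fe, intro ballI allI impI)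
    show "\<exists>k\<in>mod_hom R F V. \<forall>i<n. k (f (unit_vector R n i)) = v i"
      if V: "V \<in> P" and v: "\<forall>i<n. v i \<in> carrier V" for V v
    proof -
      obtain k where k: "k \<in> mod_hom R ?X V" "\<And>i. i < n \<Longrightarrow> k (unit_vector R n i) = v i"
        by (rule free_module_hom_exists[OF proj_module[OF V], of n v]) (auto simp: v)
      have "compose (carrier F) k h \<in> mod_hom R F V" by (rule mod_hom_compose[OF h k(1) F])
      moreover have "\<forall>i<n. compose (carrier F) k h (f (unit_vector R n i)) = v i"
        by (simp add: compose_def k(2) hf e mod_hom_closed[OF f e])
      ultimately show ?thesis by blast
    qed
  next
    have "k = k'" if "V \<in> P" and k: "k \<in> mod_hom R F V" "k' \<in> mod_hom R F V"
      and eq: "\<And>i. i < n \<Longrightarrow> k (f (unit_vector R n i)) = k' (f (unit_vector R n i))" for V k k'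
    proof (rule mod_hom_eqI[OF k])
      have "compose (carrier ?X) k f = compose (carrier ?X) k' f"
      proof (rule free_module_ext[OF proj_module[OF \<open>V \<in> P\<close>] mod_hom_compose[OF f k(1) X] mod_hom_compose[OF f k(2) X]])
        show "compose (carrier ?X) k f (unit_vector R n i) = compose (carrier ?X) k' f (unit_vector R n i)"
          if "i < n" for i using that by (simp add: compose_def e eq)
      qed
      then have "k (f x) = k' (f x)" if "x \<in> carrier ?X" for x
        using that by (metis compose_eq)
      then show "k y = k' y" if "y \<in> carrier F" for y
        using that mod_hom_closed[OF h that] fh by metis
    qed
    then show "\<forall>V\<in>P. \<forall>k\<in>mod_hom R F V. \<forall>k'\<in>mod_hom R F V.
        (\<forall>i<n. k (f (unit_vector R n i)) = k' (f (unit_vector R n i))) \<longrightarrow> k = k'" by blast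
  qed
qed

text \<open>
  In rank 0 the identity and the zero map agree on the empty basis.
\<close>

lemma zero_object:
  obtains Z where "Z \<in> P" "carrier Z = {\<zero>\<^bsub>Z\<^esub>}"
proof -
  obtain F e where F: "F \<in> P"
    and uniq: "\<forall>V\<in>P. \<forall>f\<in>mod_hom R F V. \<forall>g\<in>mod_hom R F V. (\<forall>i<0::nat. f (e i) = g (e i)) \<longrightarrow> f = g"
    by (rule free_object[where n = 0])
  interpret F: module R F by (rule proj_module[OF F])
  have "(\<lambda>x\<in>carrier F. x) = (\<lambda>x\<in>carrier F. \<zero>\<^bsub>F\<^esub>)"
    using F.module_axioms
    by (intro uniq[rule_format, of F] F mod_hom_id mod_hom_zero_map) auto
  then have "x = \<zero>\<^bsub>F\<^esub>" if "x \<in> carrier F" for x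
    using that by (metis restrict_apply')
  then have "carrier F = {\<zero>\<^bsub>F\<^esub>}" by auto
  then show ?thesis by (rule that[OF F])
qed

end

section \<open>Consequences of the axioms of pointed functors and products\<close>

lemma pointed_functorD:
  assumes "pointed_functor R S F"
  shows "V \<in> proj_modules R \<Longrightarrow> module S (Ob F V)"
    and "V \<in> proj_modules R \<Longrightarrow> W \<in> proj_modules R \<Longrightarrow> f \<in> mod_hom R V W \<Longrightarrow>
      Ar F V W f \<in> mod_hom S (Ob F V) (Ob F W)"
    and "V \<in> proj_modules R \<Longrightarrow> x \<in> carrier (Ob F V) \<Longrightarrow> Ar F V V (\<lambda>v\<in>carrier V. v) x = x"
    and "X \<in> proj_modules R \<Longrightarrow> V \<in> proj_modules R \<Longrightarrow> W \<in> proj_modules R \<Longrightarrow>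
      f \<in> mod_hom R X V \<Longrightarrow> g \<in> mod_hom R V W \<Longrightarrow> x \<in> carrier (Ob F X) \<Longrightarrow>
      Ar F X W (compose (carrier X) g f) x = Ar F V W g (Ar F X V f x)"
    and "V \<in> proj_modules R \<Longrightarrow> carrier V = {\<zero>\<^bsub>V\<^esub>} \<Longrightarrow> carrier (Ob F V) = {\<zero>\<^bsub>Ob F V\<^esub>}"
  using assms by (simp_all add: pointed_functor_def compose_eq)

lemma abelian_group_diff_zero:
  fixes G (structure)
  assumes "abelian_group G" "x \<in> carrier G" "y \<in> carrier G"
  shows "x \<ominus> y = \<zero> \<longleftrightarrow> x = y"
proof -
  interpret abelian_group G by fact
  show ?thesis
    using assms(2,3) by (metis a_minus_def minus_equality minus_minus r_neg a_inv_closed)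
qed

lemma nat_transD:
  assumes "\<eta> \<in> nat_trans R S F G"
  shows "V \<in> proj_modules R \<Longrightarrow> \<eta> V \<in> mod_hom S (Ob F V) (Ob G V)"
    and "V \<in> proj_modules R \<Longrightarrow> W \<in> proj_modules R \<Longrightarrow> f \<in> mod_hom R V W \<Longrightarrow> x \<in> carrier (Ob F V) \<Longrightarrow>
      \<eta> W (Ar F V W f x) = Ar G V W f (\<eta> V x)"
    and "\<eta> \<in> extensional (proj_modules R)"
  using assms by (simp_all add: nat_trans_def)

locale mult_ext = proj_tensor R K
  for R :: "'r ring" and K :: "('r, 'v) tensor_data" +
  fixes M :: "('r, 'm) bimodule"
    and \<phi> :: "('r, 'v, 'r, 'c1, 'c0, 'v, (('m \<times> 'v) \<Rightarrow>\<^sub>0 int) set) elext"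
    and \<mu> :: "('r, 'v, 'r, 'c1, 'c0) mult_data"
  assumes bimodule: "is_bimodule R M" and extension: "multiplicative_extension R K M \<phi> \<mu>"
begin

abbreviation C1 where "C1 \<equiv> Ob (deg1 \<phi>)"
abbreviation C0 where "C0 \<equiv> Ob (deg0 \<phi>)"
abbreviation A1 where "A1 \<equiv> Ar (deg1 \<phi>)"
abbreviation A0 where "A0 \<equiv> Ar (deg0 \<phi>)"
abbreviation AM where "AM \<equiv> Ar (tensor_functor R M :: ('r, 'v, 'r, (('m \<times> 'v) \<Rightarrow>\<^sub>0 int) set) modfun)"
abbreviation TM where "TM \<equiv> tensor R M :: ('r, 'v) module \<Rightarrow> _"
abbreviation d where "d \<equiv> diff \<phi>"
abbreviation a where "a \<equiv> aug \<phi>"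
abbreviation b where "b \<equiv> inc \<phi>"
abbreviation st where "st \<equiv> s_tilde R K \<phi> \<mu>"
abbreviation s where "s \<equiv> munit \<mu> \<one>\<^bsub>R\<^esub>"
abbreviation me where "me \<equiv> tensor_elem R M :: ('r, 'v) module \<Rightarrow> _"

lemma mult_structure: "mult_structure R K R \<phi> \<mu>"
  and elementary: "elementary_extension R R incl_functor (tensor_functor R M) \<phi>"
  using extension by (simp_all add: multiplicative_extension_def)

lemma pointed: "pointed_functor R R (deg1 \<phi>)" "pointed_functor R R (deg0 \<phi>)"
    "pointed_functor R R (tensor_functor R M :: ('r, 'v, 'r, (('m \<times> 'v) \<Rightarrow>\<^sub>0 int) set) modfun)"
  and nat: "d \<in> nat_trans R R (deg1 \<phi>) (deg0 \<phi>)" "a \<in> nat_trans R R (deg0 \<phi>) incl_functor"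
    "b \<in> nat_trans R R (tensor_functor R M) (deg1 \<phi>)"
  using elementary by (simp_all add: elementary_extension_def is_cpx_def)

lemma Ob_simps [simp]: "Ob incl_functor V = V" "Ar incl_functor V W f = f" "Ob (tensor_functor R M) V = tensor R M V"
  by (simp_all add: incl_functor_def tensor_functor_def)

lemmas C1_module = pointed_functorD(1)[OF pointed(1)]
lemmas C0_module = pointed_functorD(1)[OF pointed(2)]
lemmas TM_module = pointed_functorD(1)[OF pointed(3), unfolded Ob_simps]
lemmas A1_hom = pointed_functorD(2)[OF pointed(1)]
lemmas A0_hom = pointed_functorD(2)[OF pointed(2)]
lemmas AM_hom = pointed_functorD(2)[OF pointed(3), unfolded Ob_simps]
lemmas A1_closed = mod_hom_closed[OF A1_hom]
lemmas A0_closed = mod_hom_closed[OF A0_hom]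
lemmas A1_id = pointed_functorD(3)[OF pointed(1)]
lemmas A0_id = pointed_functorD(3)[OF pointed(2)]
lemmas AM_id = pointed_functorD(3)[OF pointed(3), unfolded Ob_simps]
lemmas A1_comp = pointed_functorD(4)[OF pointed(1)]
lemmas A0_comp = pointed_functorD(4)[OF pointed(2)]
lemmas d_hom = nat_transD(1)[OF nat(1)]
lemmas a_hom = nat_transD(1)[OF nat(2), unfolded Ob_simps]
lemmas b_hom = nat_transD(1)[OF nat(3), unfolded Ob_simps]
lemmas d_closed = mod_hom_closed[OF d_hom]
lemmas a_closed = mod_hom_closed[OF a_hom]
lemmas b_closed = mod_hom_closed[OF b_hom]
lemmas d_nat = nat_transD(2)[OF nat(1)]
lemmas a_nat = nat_transD(2)[OF nat(2), unfolded Ob_simps]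
lemmas b_nat = nat_transD(2)[OF nat(3), unfolded Ob_simps]

lemma exact:
  assumes "V \<in> P"
  shows b_inj: "inj_on (b V) (carrier (TM V))"
    and ker_d: "b V ` carrier (TM V) = {x \<in> carrier (C1 V). d V x = \<zero>\<^bsub>C0 V\<^esub>}"
    and ker_a: "d V ` carrier (C1 V) = {x \<in> carrier (C0 V). a V x = \<zero>\<^bsub>V\<^esub>}"
  using elementary assms by (simp_all add: elementary_extension_def)

lemma ker_d_obtain:
  assumes "V \<in> P" "x \<in> carrier (C1 V)" "d V x = \<zero>\<^bsub>C0 V\<^esub>"
  obtains \<tau> where "\<tau> \<in> carrier (TM V)" "x = b V \<tau>"
proof -
  have "x \<in> b V ` carrier (TM V)" unfolding ker_d[OF assms(1)] using assms by simp
  then show ?thesis using that by blast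
qed

lemma ker_a_obtain:
  assumes "V \<in> P" "x \<in> carrier (C0 V)" "a V x = \<zero>\<^bsub>V\<^esub>"
  obtains c where "c \<in> carrier (C1 V)" "d V c = x"
proof -
  have "x \<in> d V ` carrier (C1 V)" unfolding ker_a[OF assms(1)] using assms by simp
  then show ?thesis using that by blast
qed

lemma db: "V \<in> P \<Longrightarrow> \<tau> \<in> carrier (TM V) \<Longrightarrow> d V (b V \<tau>) = \<zero>\<^bsub>C0 V\<^esub>"
  using ker_d[of V] by blast

lemma ad: "V \<in> P \<Longrightarrow> c \<in> carrier (C1 V) \<Longrightarrow> a V (d V c) = \<zero>\<^bsub>V\<^esub>"
  using ker_a[of V] by blast

lemma mult:
  shows mu_bilinear: "mult_bilinear R K R \<phi> \<mu>" and mu_functorial: "mult_functorial R K \<phi> \<mu>"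
    and mu_chain: "mult_chain_map R K \<phi> \<mu>" and mu_assoc: "mult_associative R K \<phi> \<mu>"
    and mu_unital: "mult_unital R K R \<phi> \<mu>"
    and munit_hom: "munit \<mu> \<in> mod_hom R (regular_module R) (C0 U)"
  using mult_structure by (simp_all add: mult_structure_def)

context
  fixes V V' assumes V: "V \<in> P" "V' \<in> P"
begin
lemma m_bilinear:
  shows m00_bilinear: "bilinear_map R (C0 V) (C0 V') (C0 (T V V')) (m00 \<mu> V V')"
    and m10_bilinear: "bilinear_map R (C1 V) (C0 V') (C1 (T V V')) (m10 \<mu> V V')"
    and m01_bilinear: "bilinear_map R (C0 V) (C1 V') (C1 (T V V')) (m01 \<mu> V V')"
  using mu_bilinear V by (simp_all add: mult_bilinear_def)
lemmas m00_closed = bilinear_mapD(1)[OF m00_bilinear]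
lemmas m10_closed = bilinear_mapD(1)[OF m10_bilinear]
lemmas m01_closed = bilinear_mapD(1)[OF m01_bilinear]
lemmas m00_add = bilinear_mapD(2,3)[OF m00_bilinear]
lemmas m10_add = bilinear_mapD(2,3)[OF m10_bilinear]
lemmas m01_add = bilinear_mapD(2,3)[OF m01_bilinear]
lemmas m10_smult = bilinear_mapD(4,5)[OF m10_bilinear]
lemmas m01_smult = bilinear_mapD(4,5)[OF m01_bilinear]
lemma m_chain:
  shows d_m10: "c \<in> carrier (C1 V) \<Longrightarrow> x \<in> carrier (C0 V') \<Longrightarrow> d (T V V') (m10 \<mu> V V' c x) = m00 \<mu> V V' (d V c) x"
    and d_m01: "y \<in> carrier (C0 V) \<Longrightarrow> c' \<in> carrier (C1 V') \<Longrightarrow> d (T V V') (m01 \<mu> V V' y c') = m00 \<mu> V V' y (d V' c')"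
    and m10_d: "c \<in> carrier (C1 V) \<Longrightarrow> c' \<in> carrier (C1 V') \<Longrightarrow> m10 \<mu> V V' c (d V' c') = m01 \<mu> V V' (d V c) c'"
  using mu_chain V unfolding mult_chain_map_def by metis+
end

lemma m01_zero:
  assumes "V \<in> P" "V' \<in> P"
  shows "c \<in> carrier (C1 V') \<Longrightarrow> m01 \<mu> V V' \<zero>\<^bsub>C0 V\<^esub> c = \<zero>\<^bsub>C1 (T V V')\<^esub>"
    and "x \<in> carrier (C0 V) \<Longrightarrow> m01 \<mu> V V' x \<zero>\<^bsub>C1 V'\<^esub> = \<zero>\<^bsub>C1 (T V V')\<^esub>"
proof -
  show "m01 \<mu> V V' \<zero>\<^bsub>C0 V\<^esub> c = \<zero>\<^bsub>C1 (T V V')\<^esub>" if "c \<in> carrier (C1 V')"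
    using assms C0_module[of V] C1_module[of "T V V'"] T_proj[of V V'] that
    by (intro additive_zero[where f = "\<lambda>x. m01 \<mu> V V' x c"]) (auto simp: module_def m01_closed m01_add)
  show "m01 \<mu> V V' x \<zero>\<^bsub>C1 V'\<^esub> = \<zero>\<^bsub>C1 (T V V')\<^esub>" if "x \<in> carrier (C0 V)"
    using assms C1_module[of V'] C1_module[of "T V V'"] T_proj[of V V'] that
    by (intro additive_zero) (auto simp: module_def m01_closed m01_add)
qed

lemma m_functorial:
  assumes "V \<in> P" "V' \<in> P" "W \<in> P" "W' \<in> P" "f \<in> mod_hom R V W" "f' \<in> mod_hom R V' W'"
  shows m00_nat: "x \<in> carrier (C0 V) \<Longrightarrow> x' \<in> carrier (C0 V') \<Longrightarrow>
      A0 (T V V') (T W W') (tens_map R K V V' W W' f f') (m00 \<mu> V V' x x') = m00 \<mu> W W' (A0 V W f x) (A0 V' W' f' x')"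
    and m10_nat: "c \<in> carrier (C1 V) \<Longrightarrow> x' \<in> carrier (C0 V') \<Longrightarrow>
      A1 (T V V') (T W W') (tens_map R K V V' W W' f f') (m10 \<mu> V V' c x') = m10 \<mu> W W' (A1 V W f c) (A0 V' W' f' x')"
    and m01_nat: "x \<in> carrier (C0 V) \<Longrightarrow> c' \<in> carrier (C1 V') \<Longrightarrow>
      A1 (T V V') (T W W') (tens_map R K V V' W W' f f') (m01 \<mu> V V' x c') = m01 \<mu> W W' (A0 V W f x) (A1 V' W' f' c')"
  using mu_functorial assms unfolding mult_functorial_def by metis+

lemma s_closed: "s \<in> carrier (C0 U)"
  using mod_hom_closed[OF munit_hom, of "\<one>\<^bsub>R\<^esub>"] by (simp add: regular_module_def)

lemma munit_eq: "r \<in> carrier R \<Longrightarrow> munit \<mu> r = r \<odot>\<^bsub>C0 U\<^esub> s"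
  using mod_hom_smult[OF munit_hom, of r "\<one>\<^bsub>R\<^esub>"] by (simp add: regular_module_def)

lemma a_s: "a U s = u"
proof -
  interpret U: module R U by (rule proj_module[OF U_proj])
  have "a U s = munit (incl_mult R K) \<one>\<^bsub>R\<^esub>"
    using extension by (simp add: multiplicative_extension_def multiplicative_map_def)
  then show ?thesis using u_closed by (simp add: incl_mult_def)
qed

lemma unital:
  assumes "V \<in> P"
  shows m00_unit_right: "x \<in> carrier (C0 V) \<Longrightarrow> A0 (T V U) V (right_unitor R K V) (m00 \<mu> V U x s) = x"
    and m01_unit_left: "c \<in> carrier (C1 V) \<Longrightarrow> A1 (T U V) V (left_unitor R K V) (m01 \<mu> U V s c) = c"
    and m10_unit_right: "c \<in> carrier (C1 V) \<Longrightarrow> A1 (T V U) V (right_unitor R K V) (m10 \<mu> V U c s) = c"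
  using mu_unital assms by (simp_all add: mult_unital_def Let_def)

text \<open>
  A zero map factors through the zero module, on which a pointed functor vanishes.
\<close>

lemma zero_map:
  assumes F: "pointed_functor R R F" and V: "V \<in> P" "W \<in> P" and x: "x \<in> carrier (Ob F V)"
  shows "Ar F V W (\<lambda>v\<in>carrier V. \<zero>\<^bsub>W\<^esub>) x = \<zero>\<^bsub>Ob F W\<^esub>"
proof -
  obtain Z where Z: "Z \<in> P" "carrier Z = {\<zero>\<^bsub>Z\<^esub>}" by (rule zero_object)
  interpret V: module R V by (rule proj_module[OF V(1)])
  interpret Z: module R Z by (rule proj_module[OF Z(1)])
  note [simp] = V Z(1)
  let ?p = "\<lambda>v\<in>carrier V. \<zero>\<^bsub>Z\<^esub>" and ?q = "\<lambda>v\<in>carrier Z. \<zero>\<^bsub>W\<^esub>"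
  have pq: "?p \<in> mod_hom R V Z" "?q \<in> mod_hom R Z W" by (simp_all add: mod_hom_zero_map proj_module)
  have "(\<lambda>v\<in>carrier V. \<zero>\<^bsub>W\<^esub>) = compose (carrier V) ?q ?p" by (auto simp: compose_def)
  then have "Ar F V W (\<lambda>v\<in>carrier V. \<zero>\<^bsub>W\<^esub>) x = Ar F Z W ?q (Ar F V Z ?p x)"
    using pointed_functorD(4)[OF F V(1) Z(1) V(2) pq x] by simp
  moreover have "Ar F V Z ?p x = \<zero>\<^bsub>Ob F Z\<^esub>"
    using mod_hom_closed[OF pointed_functorD(2)[OF F V(1) Z(1) pq(1)] x] pointed_functorD(5)[OF F Z] by simp
  ultimately show ?thesis
    using mod_hom_zero[OF pointed_functorD(2)[OF F Z(1) V(2) pq(2)]] pointed_functorD(1)[OF F] by simp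
qed

section \<open>The elements of \<open>C\<^sub>0(V)\<close> given by the unit\<close>

lemma st_closed: "V \<in> P \<Longrightarrow> v \<in> carrier V \<Longrightarrow> st V v \<in> carrier (C0 V)"
  by (simp add: s_tilde_def A0_closed U_proj point_hom s_closed)

lemma st_nat: "V \<in> P \<Longrightarrow> W \<in> P \<Longrightarrow> f \<in> mod_hom R V W \<Longrightarrow> v \<in> carrier V \<Longrightarrow> A0 V W f (st V v) = st W (f v)"
  by (simp add: s_tilde_def flip: point_comp) (simp add: A0_comp U_proj point_hom s_closed)

lemma a_st: "V \<in> P \<Longrightarrow> v \<in> carrier V \<Longrightarrow> a V (st V v) = v"
  by (simp add: s_tilde_def a_nat U_proj point_hom s_closed a_s point_u)

lemma st_u: "st U u = s"
  by (simp add: s_tilde_def point_unit A0_id U_proj s_closed)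

lemma st_zero: "V \<in> P \<Longrightarrow> st V \<zero>\<^bsub>V\<^esub> = \<zero>\<^bsub>C0 V\<^esub>"
proof -
  assume V: "V \<in> P"
  interpret V: module R V by (rule proj_module[OF V])
  have "point R K V \<zero>\<^bsub>V\<^esub> = (\<lambda>x\<in>carrier U. \<zero>\<^bsub>V\<^esub>)"
    using V U_proj by (intro U_ext[of _ V] point_hom mod_hom_zero_map proj_module) (simp_all add: point_u u_closed)
  then show ?thesis by (simp add: s_tilde_def zero_map[OF pointed(2) U_proj V s_closed])
qed

text \<open>
  The unitor carries \<open>x \<cdot> s\<close> to \<open>x\<close>, and \<open>s(v')\<close> is the image of \<open>s\<close> under the map \<open>v'\<close>; hence functoriality of
  the product makes \<open>x \<cdot> s(v')\<close> the image of \<open>x\<close> under the map \<open>- \<otimes> v'\<close>. Every later statement on products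
  with elements \<open>s(v)\<close> is reduced to naturality in this way.
\<close>

lemma mult_st:
  assumes "V \<in> P" "V' \<in> P" "v \<in> carrier V" "v' \<in> carrier V'"
  shows m00_st_right: "x \<in> carrier (C0 V) \<Longrightarrow>
      m00 \<mu> V V' x (st V' v') = A0 V (T V V') (\<lambda>v\<in>carrier V. t V V' v v') x"
    and m10_st: "c \<in> carrier (C1 V) \<Longrightarrow>
      m10 \<mu> V V' c (st V' v') = A1 V (T V V') (\<lambda>v\<in>carrier V. t V V' v v') c"
    and m01_st: "c' \<in> carrier (C1 V') \<Longrightarrow>
      m01 \<mu> V V' (st V v) c' = A1 V' (T V V') (\<lambda>v'\<in>carrier V'. t V V' v v') c'"
proof -
  note [simp] = assms U_proj T_proj proj_module s_closed
  have idV: "(\<lambda>v\<in>carrier V. v) \<in> mod_hom R V V" by (simp add: mod_hom_id)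
  have idV': "(\<lambda>v\<in>carrier V'. v) \<in> mod_hom R V' V'" by (simp add: mod_hom_id)
  note pt = point_hom[OF assms(1,3)] point_hom[OF assms(2,4)]
  note R = right_mult_unitor[OF assms(1,2,4), symmetric] right_unitor_hom[OF assms(1)] right_mult_hom[OF assms(1,2,4)]
  note L = left_mult_unitor[OF assms(1,2,3), symmetric] left_unitor_hom[OF assms(2)] left_mult_hom[OF assms(1,2,3)]
  show "m00 \<mu> V V' x (st V' v') = A0 V (T V V') (\<lambda>v\<in>carrier V. t V V' v v') x" if x: "x \<in> carrier (C0 V)"
  proof -
    have "m00 \<mu> V V' x (st V' v') = A0 (T V U) (T V V') (tens_map R K V U V V' (\<lambda>v\<in>carrier V. v) (point R K V' v')) (m00 \<mu> V U x s)"
      using m00_nat[OF _ _ _ _ idV pt(2) x s_closed] x by (simp add: A0_id s_tilde_def)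
    also have "\<dots> = A0 V (T V V') (\<lambda>v\<in>carrier V. t V V' v v') x"
      using A0_comp[OF _ _ _ R(2,3), of "m00 \<mu> V U x s"] x by (simp add: R(1) m00_closed m00_unit_right)
    finally show ?thesis .
  qed
  show "m10 \<mu> V V' c (st V' v') = A1 V (T V V') (\<lambda>v\<in>carrier V. t V V' v v') c" if x: "c \<in> carrier (C1 V)"
  proof -
    have "m10 \<mu> V V' c (st V' v') = A1 (T V U) (T V V') (tens_map R K V U V V' (\<lambda>v\<in>carrier V. v) (point R K V' v')) (m10 \<mu> V U c s)"
      using m10_nat[OF _ _ _ _ idV pt(2) x s_closed] x by (simp add: A1_id s_tilde_def)
    also have "\<dots> = A1 V (T V V') (\<lambda>v\<in>carrier V. t V V' v v') c"
      using A1_comp[OF _ _ _ R(2,3), of "m10 \<mu> V U c s"] x by (simp add: R(1) m10_closed m10_unit_right)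
    finally show ?thesis .
  qed
  show "m01 \<mu> V V' (st V v) c' = A1 V' (T V V') (\<lambda>v'\<in>carrier V'. t V V' v v') c'" if x: "c' \<in> carrier (C1 V')"
  proof -
    have "m01 \<mu> V V' (st V v) c' = A1 (T U V') (T V V') (tens_map R K U V' V V' (point R K V v) (\<lambda>v\<in>carrier V'. v)) (m01 \<mu> U V' s c')"
      using m01_nat[OF _ _ _ _ pt(1) idV' s_closed x] x by (simp add: A1_id s_tilde_def)
    also have "\<dots> = A1 V' (T V V') (\<lambda>v'\<in>carrier V'. t V V' v v') c'"
      using A1_comp[OF _ _ _ L(2,3), of "m01 \<mu> U V' s c'"] x by (simp add: L(1) m01_closed m01_unit_left)
    finally show ?thesis .
  qed
qed

lemma st_mult:
  assumes "V \<in> P" "V' \<in> P" "v \<in> carrier V" "v' \<in> carrier V'"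
  shows "m00 \<mu> V V' (st V v) (st V' v') = st (T V V') (t V V' v v')"
  using assms st_nat[OF assms(1) T_proj[OF assms(1,2)] right_mult_hom[OF assms(1,2,4)] assms(3)]
  by (simp add: m00_st_right st_closed)

section \<open>Natural families of elements of \<open>C\<^sub>1\<close>\<close>

text \<open>
  The functor \<open>I(M)\<close> is additive, while \<open>C\<^sub>0\<close> and \<open>C\<^sub>1\<close> need not be.
\<close>

lemma AM_add:
  assumes "V \<in> P" "W \<in> P" "f \<in> mod_hom R V W" "g \<in> mod_hom R V W" "k \<in> mod_hom R V W"
    and k: "\<And>v. v \<in> carrier V \<Longrightarrow> k v = f v \<oplus>\<^bsub>W\<^esub> g v"
    and "\<tau> \<in> carrier (TM V)"
  shows "AM V W k \<tau> = AM V W f \<tau> \<oplus>\<^bsub>TM W\<^esub> AM V W g \<tau>"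
proof -
  interpret X: bimodule_tensor R M V by (intro bimodule_tensor.intro bimodule proj_module assms)
  interpret Y: bimodule_tensor R M W by (intro bimodule_tensor.intro bimodule proj_module assms)
  interpret TMW: module R "TM W" by (intro TM_module assms)
  note h = AM_hom[OF assms(1,2,3)] AM_hom[OF assms(1,2,4)] AM_hom[OF assms(1,2,5)]
  show ?thesis
    using assms(7)
  proof (induction rule: X.tensor_induct)
    case (elem m v)
    then show ?case
      using assms(1-5) by (simp add: tensor_functor_elem[OF bimodule] proj_module k Y.elem_add_right mod_hom_closed)
  next
    case (add x y)
    then show ?case
      using mod_hom_closed[OF h(1)] mod_hom_closed[OF h(2)]
      by (simp add: mod_hom_add[OF h(1)] mod_hom_add[OF h(2)] mod_hom_add[OF h(3)] TMW.a_ac)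
  qed
qed

text \<open>
  A natural map \<open>h : V\<^sup>3 \<rightarrow> Ker d \<cong> M \<otimes> V\<close> is determined by its value on the generators of a free module.
  As \<open>M \<otimes> V\<close> is additive in \<open>V\<close>, the decomposition of the identity of this free module into two
  projections shows that \<open>h(x, y, z) = h(x, y, 0) + h(0, 0, z)\<close>.
\<close>

lemma natural_zero:
  assumes closed: "\<And>V x y z. V \<in> P \<Longrightarrow> x \<in> carrier V \<Longrightarrow> y \<in> carrier V \<Longrightarrow> z \<in> carrier V \<Longrightarrow>
      h V x y z \<in> carrier (C1 V)"
    and natural: "\<And>V W f x y z. V \<in> P \<Longrightarrow> W \<in> P \<Longrightarrow> f \<in> mod_hom R V W \<Longrightarrow>
      x \<in> carrier V \<Longrightarrow> y \<in> carrier V \<Longrightarrow> z \<in> carrier V \<Longrightarrow> A1 V W f (h V x y z) = h W (f x) (f y) (f z)"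
    and cycle: "\<And>V x y z. V \<in> P \<Longrightarrow> x \<in> carrier V \<Longrightarrow> y \<in> carrier V \<Longrightarrow> z \<in> carrier V \<Longrightarrow>
      d V (h V x y z) = \<zero>\<^bsub>C0 V\<^esub>"
    and left: "\<And>V x y. V \<in> P \<Longrightarrow> x \<in> carrier V \<Longrightarrow> y \<in> carrier V \<Longrightarrow> h V x y \<zero>\<^bsub>V\<^esub> = \<zero>\<^bsub>C1 V\<^esub>"
    and right: "\<And>V z. V \<in> P \<Longrightarrow> z \<in> carrier V \<Longrightarrow> h V \<zero>\<^bsub>V\<^esub> \<zero>\<^bsub>V\<^esub> z = \<zero>\<^bsub>C1 V\<^esub>"
    and V: "V \<in> P" "x \<in> carrier V" "y \<in> carrier V" "z \<in> carrier V"
  shows "h V x y z = \<zero>\<^bsub>C1 V\<^esub>"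
proof -
  obtain F e where F: "F \<in> P" and e: "\<forall>i<3::nat. e i \<in> carrier F"
    and ex: "\<forall>V\<in>P. \<forall>v. (\<forall>i<3. v i \<in> carrier V) \<longrightarrow> (\<exists>k\<in>mod_hom R F V. \<forall>i<3. k (e i) = v i)"
    and uniq: "\<forall>V\<in>P. \<forall>f\<in>mod_hom R F V. \<forall>g\<in>mod_hom R F V. (\<forall>i<3. f (e i) = g (e i)) \<longrightarrow> f = g"
    by (rule free_object[where n = 3])
  have hom3: "\<exists>k\<in>mod_hom R F W. k (e 0) = x \<and> k (e 1) = y \<and> k (e 2) = z"
    if W: "W \<in> P" and xyz: "x \<in> carrier W" "y \<in> carrier W" "z \<in> carrier W" for W x y z
  proof -
    have "(if i = 0 then x else if i = 1 then y else z) \<in> carrier W" for i :: nat using xyz by simp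
    then obtain k where "k \<in> mod_hom R F W" "\<forall>i<3. k (e i) = (if i = 0 then x else if i = 1 then y else z)"
      using ex[rule_format, OF W, of "\<lambda>i. if i = 0 then x else if i = 1 then y else z"] by auto
    then show ?thesis by (intro bexI[of _ k]) auto
  qed
  interpret F: module R F by (rule proj_module[OF F])
  interpret TF: module R "TM F" by (rule TM_module[OF F])
  interpret C1F: module R "C1 F" by (rule C1_module[OF F])
  have e': "e 0 \<in> carrier F" "e 1 \<in> carrier F" "e 2 \<in> carrier F" by (simp_all add: e)
  let ?h = "h F (e 0) (e 1) (e 2)"
  have "?h = \<zero>\<^bsub>C1 F\<^esub>"
  proof -
    obtain f where f: "f \<in> mod_hom R F F" "f (e 0) = e 0" "f (e 1) = e 1" "f (e 2) = \<zero>\<^bsub>F\<^esub>"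
      using hom3[OF F, of "e 0" "e 1" "\<zero>\<^bsub>F\<^esub>"] e' by auto
    obtain g where g: "g \<in> mod_hom R F F" "g (e 0) = \<zero>\<^bsub>F\<^esub>" "g (e 1) = \<zero>\<^bsub>F\<^esub>" "g (e 2) = e 2"
      using hom3[OF F, of "\<zero>\<^bsub>F\<^esub>" "\<zero>\<^bsub>F\<^esub>" "e 2"] e' by auto
    have fg: "(\<lambda>v\<in>carrier F. f v \<oplus>\<^bsub>F\<^esub> g v) \<in> mod_hom R F F"
      using mod_hom_closed[OF f(1)] mod_hom_closed[OF g(1)]
      by (intro mod_homI) (auto simp: mod_hom_add[OF f(1)] mod_hom_add[OF g(1)] mod_hom_smult[OF f(1)]
          mod_hom_smult[OF g(1)] F.smult_r_distr F.a_ac)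
    have id: "(\<lambda>v\<in>carrier F. v) = (\<lambda>v\<in>carrier F. f v \<oplus>\<^bsub>F\<^esub> g v)"
    proof (rule uniq[rule_format, OF F mod_hom_id[OF F.module_axioms] fg])
      fix i :: nat assume "i < 3"
      then consider "i = 0" | "i = 1" | "i = 2" by linarith
      then show "(\<lambda>v\<in>carrier F. v) (e i) = (\<lambda>v\<in>carrier F. f v \<oplus>\<^bsub>F\<^esub> g v) (e i)"
        using e' f g by cases (simp_all del: One_nat_def)
    qed
    obtain \<tau> where \<tau>: "\<tau> \<in> carrier (TM F)" "?h = b F \<tau>"
      using ker_d_obtain[OF F closed[OF F e'] cycle[OF F e']] .
    have "\<tau> = AM F F (\<lambda>v\<in>carrier F. v) \<tau>" using AM_id[OF F \<tau>(1)] by simp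
    also have "\<dots> = AM F F f \<tau> \<oplus>\<^bsub>TM F\<^esub> AM F F g \<tau>"
      unfolding id by (rule AM_add[OF F F f(1) g(1) fg _ \<tau>(1)]) simp
    finally have "?h = b F (AM F F f \<tau> \<oplus>\<^bsub>TM F\<^esub> AM F F g \<tau>)" using \<tau>(2) by simp
    also have "\<dots> = A1 F F f ?h \<oplus>\<^bsub>C1 F\<^esub> A1 F F g ?h"
      using mod_hom_closed[OF AM_hom[OF F F f(1)] \<tau>(1)] mod_hom_closed[OF AM_hom[OF F F g(1)] \<tau>(1)]
      by (simp add: mod_hom_add[OF b_hom[OF F]] b_nat[OF F F f(1) \<tau>(1)] b_nat[OF F F g(1) \<tau>(1)] \<tau>(2) del: One_nat_def)
    also have "\<dots> = \<zero>\<^bsub>C1 F\<^esub>"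
      using F e' f g by (simp add: natural left right)
    finally show ?thesis .
  qed
  moreover obtain k where "k \<in> mod_hom R F V" "k (e 0) = x" "k (e 1) = y" "k (e 2) = z"
    using hom3[OF V] by auto
  ultimately show ?thesis
    using natural[OF F V(1) _ e', of k] mod_hom_zero[OF A1_hom[OF F V(1)] C1_module[OF F] C1_module[OF V(1)], of k]
    by simp
qed

lemma natural_eqI:
  assumes closed: "\<And>V x y z. V \<in> P \<Longrightarrow> x \<in> carrier V \<Longrightarrow> y \<in> carrier V \<Longrightarrow> z \<in> carrier V \<Longrightarrow>
      h V x y z \<in> carrier (C1 V)"
    and closed': "\<And>V x y z. V \<in> P \<Longrightarrow> x \<in> carrier V \<Longrightarrow> y \<in> carrier V \<Longrightarrow> z \<in> carrier V \<Longrightarrow>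
      h' V x y z \<in> carrier (C1 V)"
    and natural: "\<And>V W f x y z. V \<in> P \<Longrightarrow> W \<in> P \<Longrightarrow> f \<in> mod_hom R V W \<Longrightarrow>
      x \<in> carrier V \<Longrightarrow> y \<in> carrier V \<Longrightarrow> z \<in> carrier V \<Longrightarrow> A1 V W f (h V x y z) = h W (f x) (f y) (f z)"
    and natural': "\<And>V W f x y z. V \<in> P \<Longrightarrow> W \<in> P \<Longrightarrow> f \<in> mod_hom R V W \<Longrightarrow>
      x \<in> carrier V \<Longrightarrow> y \<in> carrier V \<Longrightarrow> z \<in> carrier V \<Longrightarrow> A1 V W f (h' V x y z) = h' W (f x) (f y) (f z)"
    and d: "\<And>V x y z. V \<in> P \<Longrightarrow> x \<in> carrier V \<Longrightarrow> y \<in> carrier V \<Longrightarrow> z \<in> carrier V \<Longrightarrow>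
      d V (h V x y z) = d V (h' V x y z)"
    and left: "\<And>V x y. V \<in> P \<Longrightarrow> x \<in> carrier V \<Longrightarrow> y \<in> carrier V \<Longrightarrow> h V x y \<zero>\<^bsub>V\<^esub> = h' V x y \<zero>\<^bsub>V\<^esub>"
    and right: "\<And>V z. V \<in> P \<Longrightarrow> z \<in> carrier V \<Longrightarrow> h V \<zero>\<^bsub>V\<^esub> \<zero>\<^bsub>V\<^esub> z = h' V \<zero>\<^bsub>V\<^esub> \<zero>\<^bsub>V\<^esub> z"
    and V: "V \<in> P" "x \<in> carrier V" "y \<in> carrier V" "z \<in> carrier V"
  shows "h V x y z = h' V x y z"
proof -
  have ab: "abelian_group (C1 V)" "abelian_group (C0 V)" "abelian_group V" if "V \<in> P" for V
    using C1_module[OF that] C0_module[OF that] proj_module[OF that] by (simp_all add: module_def)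
  have self: "x \<ominus>\<^bsub>G\<^esub> x = \<zero>\<^bsub>G\<^esub>" if "abelian_group G" "x \<in> carrier G" for x and G :: "('z, 'y) ring_scheme"
    using that abelian_group.r_neg by (simp add: a_minus_def)
  have "h V x y z \<ominus>\<^bsub>C1 V\<^esub> h' V x y z = \<zero>\<^bsub>C1 V\<^esub>"
  proof (rule natural_zero[where h = "\<lambda>V x y z. h V x y z \<ominus>\<^bsub>C1 V\<^esub> h' V x y z"])
    fix V x y z assume V: "V \<in> P" "x \<in> carrier V" "y \<in> carrier V" "z \<in> carrier V"
    interpret C1: abelian_group "C1 V" by (rule ab[OF V(1)])
    interpret V: abelian_group V by (rule ab[OF V(1)])
    show "h V x y z \<ominus>\<^bsub>C1 V\<^esub> h' V x y z \<in> carrier (C1 V)"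
      using V by (simp add: closed closed')
    show "d V (h V x y z \<ominus>\<^bsub>C1 V\<^esub> h' V x y z) = \<zero>\<^bsub>C0 V\<^esub>"
      using V by (simp add: mod_hom_diff[OF d_hom] C1_module C0_module closed closed' d d_closed self ab)
    show "A1 V W f (h V x y z \<ominus>\<^bsub>C1 V\<^esub> h' V x y z) = h W (f x) (f y) (f z) \<ominus>\<^bsub>C1 W\<^esub> h' W (f x) (f y) (f z)"
      if "W \<in> P" "f \<in> mod_hom R V W" for W f
      using V that by (simp add: mod_hom_diff[OF A1_hom] C1_module closed closed' natural natural')
  next
    fix V x y assume V: "V \<in> P" "x \<in> carrier V" "y \<in> carrier V"
    interpret V: abelian_group V by (rule ab[OF V(1)])
    show "h V x y \<zero>\<^bsub>V\<^esub> \<ominus>\<^bsub>C1 V\<^esub> h' V x y \<zero>\<^bsub>V\<^esub> = \<zero>\<^bsub>C1 V\<^esub>"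
      using V closed'[of V x y "\<zero>\<^bsub>V\<^esub>"] by (simp add: left self ab)
  next
    fix V z assume V: "V \<in> P" "z \<in> carrier V"
    interpret V: abelian_group V by (rule ab[OF V(1)])
    show "h V \<zero>\<^bsub>V\<^esub> \<zero>\<^bsub>V\<^esub> z \<ominus>\<^bsub>C1 V\<^esub> h' V \<zero>\<^bsub>V\<^esub> \<zero>\<^bsub>V\<^esub> z = \<zero>\<^bsub>C1 V\<^esub>"
      using V closed'[of V "\<zero>\<^bsub>V\<^esub>" "\<zero>\<^bsub>V\<^esub>" z] by (simp add: right self ab)
  qed (fact V)+
  then show ?thesis
    using V closed[OF V] closed'[OF V] abelian_group_diff_zero[OF ab(1)[OF V(1)]] by simp
qed

text \<open>
  In two variables, a dummy middle variable reduces the comparison to the case of three.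
\<close>

lemma natural_eqI2:
  assumes closed: "\<And>V x y. V \<in> P \<Longrightarrow> x \<in> carrier V \<Longrightarrow> y \<in> carrier V \<Longrightarrow> h V x y \<in> carrier (C1 V)"
    and closed': "\<And>V x y. V \<in> P \<Longrightarrow> x \<in> carrier V \<Longrightarrow> y \<in> carrier V \<Longrightarrow> h' V x y \<in> carrier (C1 V)"
    and natural: "\<And>V W f x y. V \<in> P \<Longrightarrow> W \<in> P \<Longrightarrow> f \<in> mod_hom R V W \<Longrightarrow>
      x \<in> carrier V \<Longrightarrow> y \<in> carrier V \<Longrightarrow> A1 V W f (h V x y) = h W (f x) (f y)"
    and natural': "\<And>V W f x y. V \<in> P \<Longrightarrow> W \<in> P \<Longrightarrow> f \<in> mod_hom R V W \<Longrightarrow>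
      x \<in> carrier V \<Longrightarrow> y \<in> carrier V \<Longrightarrow> A1 V W f (h' V x y) = h' W (f x) (f y)"
    and d: "\<And>V x y. V \<in> P \<Longrightarrow> x \<in> carrier V \<Longrightarrow> y \<in> carrier V \<Longrightarrow> d V (h V x y) = d V (h' V x y)"
    and left: "\<And>V x. V \<in> P \<Longrightarrow> x \<in> carrier V \<Longrightarrow> h V x \<zero>\<^bsub>V\<^esub> = h' V x \<zero>\<^bsub>V\<^esub>"
    and right: "\<And>V y. V \<in> P \<Longrightarrow> y \<in> carrier V \<Longrightarrow> h V \<zero>\<^bsub>V\<^esub> y = h' V \<zero>\<^bsub>V\<^esub> y"
    and V: "V \<in> P" "x \<in> carrier V" "y \<in> carrier V"
  shows "h V x y = h' V x y"
  by (rule natural_eqI[where h = "\<lambda>V x _ y. h V x y" and h' = "\<lambda>V x _ y. h' V x y", OF _ _ _ _ _ _ _ V(1,2,2,3)])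
    (simp_all add: assms)

end

section \<open>The defect of additivity\<close>

lemma (in abelian_group) add_diff_self:
  assumes "x \<in> carrier G" "y \<in> carrier G"
  shows "x \<oplus> y \<ominus> y = x" "y \<oplus> x \<ominus> y = x" "x \<ominus> y \<oplus> y = x" "x \<ominus> x = \<zero>" "x \<ominus> \<zero> = x"
  using assms by (simp_all add: minus_eq a_assoc r_neg l_neg r_neg2 a_comm[of y x])

lemma (in abelian_group) diff_add_cancel_middle:
  "x \<in> carrier G \<Longrightarrow> p \<in> carrier G \<Longrightarrow> y \<in> carrier G \<Longrightarrow> (x \<ominus> p) \<oplus> (p \<oplus> y) = x \<oplus> y"
  by (simp add: minus_eq a_assoc r_neg1)

lemma (in abelian_group) defect_cocycle_identity:
  assumes "x \<in> carrier G" "y \<in> carrier G" "z \<in> carrier G" "p \<in> carrier G" "q \<in> carrier G" "r \<in> carrier G"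
  shows "(x \<oplus> y \<ominus> p) \<oplus> (p \<oplus> z \<ominus> q) = (y \<oplus> z \<ominus> r) \<oplus> (x \<oplus> r \<ominus> q)"
proof -
  have "(x \<oplus> y \<ominus> p) \<oplus> (p \<oplus> z \<ominus> q) = (x \<oplus> y \<ominus> p) \<oplus> (p \<oplus> (z \<ominus> q))"
    using assms by (simp add: minus_eq a_assoc)
  also have "\<dots> = (y \<oplus> z) \<oplus> (x \<ominus> q)"
    using assms by (simp add: diff_add_cancel_middle) (simp add: minus_eq a_ac)
  also have "\<dots> = (y \<oplus> z \<ominus> r) \<oplus> (r \<oplus> (x \<ominus> q))"
    using assms by (simp add: diff_add_cancel_middle)
  also have "\<dots> = (y \<oplus> z \<ominus> r) \<oplus> (x \<oplus> r \<ominus> q)"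
    using assms by (simp add: minus_eq a_assoc a_comm[of x r])
  finally show ?thesis .
qed

context mult_ext
begin

lemma abelian:
  assumes "V \<in> P"
  shows C1_abelian: "abelian_group (C1 V)" and C0_abelian: "abelian_group (C0 V)" and V_abelian: "abelian_group V"
  using C1_module[OF assms] C0_module[OF assms] proj_module[OF assms] by (simp_all add: module_def)

text \<open>
  A natural map \<open>V\<^sup>2 \<rightarrow> C\<^sub>1(V)\<close> amounts to an element of \<open>C\<^sub>1(F)\<close>, where \<open>F\<close> is free on \<open>e\<^sub>0, e\<^sub>1\<close>. The element
  \<open>y\<close> of \<open>C\<^sub>0(F)\<close> that the differential of the defect must hit is killed by the augmentation, so it
  lifts to some \<open>x\<^sub>0\<close>; removing from \<open>x\<^sub>0\<close> its values on the two axes, which are cycles, normalizes it.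
\<close>

lemma defect_exists: "\<exists>c. is_defect R K \<phi> \<mu> c"
proof -
  obtain F e where F: "F \<in> P" and e: "\<forall>i<2::nat. e i \<in> carrier F"
    and ex: "\<forall>V\<in>P. \<forall>v. (\<forall>i<2. v i \<in> carrier V) \<longrightarrow> (\<exists>k\<in>mod_hom R F V. \<forall>i<2. k (e i) = v i)"
    and uniq: "\<forall>V\<in>P. \<forall>f\<in>mod_hom R F V. \<forall>g\<in>mod_hom R F V. (\<forall>i<2. f (e i) = g (e i)) \<longrightarrow> f = g"
    by (rule free_object[where n = 2])
  define e0 where "e0 = e 0"
  define e1 where "e1 = e 1"
  have e01: "e0 \<in> carrier F" "e1 \<in> carrier F" using e by (simp_all add: e0_def e1_def)
  have lt2: "i < 2 \<Longrightarrow> i = 0 \<or> i = 1" for i :: nat by linarith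
  have ex2: "\<exists>k. k \<in> mod_hom R F V \<and> k e0 = v \<and> k e1 = w" if V: "V \<in> P" "v \<in> carrier V" "w \<in> carrier V" for V v w
  proof -
    have "(if i = 0 then v else w) \<in> carrier V" for i :: nat using V by simp
    then obtain k where "k \<in> mod_hom R F V" "\<forall>i<2. k (e i) = (if i = 0 then v else w)"
      using ex[rule_format, OF V(1), of "\<lambda>i. if i = 0 then v else w"] by auto
    then show ?thesis by (intro exI[of _ k]) (auto simp: e0_def e1_def)
  qed
  have uniq2: "f = g" if "V \<in> P" "f \<in> mod_hom R F V" "g \<in> mod_hom R F V" "f e0 = g e0" "f e1 = g e1" for V f g
    using uniq[rule_format, OF that(1-3)] that(4,5) lt2 unfolding e0_def e1_def by metis
  interpret F: module R F by (rule proj_module[OF F])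
  interpret C1: module R "C1 F" by (rule C1_module[OF F])
  interpret C0: module R "C0 F" by (rule C0_module[OF F])
  obtain f where f: "f \<in> mod_hom R F F" "f e0 = e0" "f e1 = \<zero>\<^bsub>F\<^esub>" using ex2[OF F] e01 by blast
  obtain g where g: "g \<in> mod_hom R F F" "g e0 = \<zero>\<^bsub>F\<^esub>" "g e1 = e1" using ex2[OF F] e01 by blast
  define y where "y = st F e0 \<oplus>\<^bsub>C0 F\<^esub> st F e1 \<ominus>\<^bsub>C0 F\<^esub> st F (e0 \<oplus>\<^bsub>F\<^esub> e1)"
  have st: "st F e0 \<in> carrier (C0 F)" "st F e1 \<in> carrier (C0 F)" "st F (e0 \<oplus>\<^bsub>F\<^esub> e1) \<in> carrier (C0 F)"
    using F e01 by (simp_all add: st_closed)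
  have y: "y \<in> carrier (C0 F)" using st by (simp add: y_def)
  have "a F y = \<zero>\<^bsub>F\<^esub>"
    using st F e01 by (simp add: y_def mod_hom_diff[OF a_hom] mod_hom_add[OF a_hom] C0_module F.module_axioms a_st F.add_diff_self)
  then obtain x0 where x0: "x0 \<in> carrier (C1 F)" "d F x0 = y"
    using ker_a_obtain[OF F y] by blast
  define x where "x = x0 \<ominus>\<^bsub>C1 F\<^esub> A1 F F f x0 \<ominus>\<^bsub>C1 F\<^esub> A1 F F g x0"
  have cl: "A1 F F f x0 \<in> carrier (C1 F)" "A1 F F g x0 \<in> carrier (C1 F)"
    by (simp_all add: A1_closed F f g x0)
  have x: "x \<in> carrier (C1 F)" using cl x0 by (simp add: x_def)
  have A0y: "A0 F V k y = st V (k e0) \<oplus>\<^bsub>C0 V\<^esub> st V (k e1) \<ominus>\<^bsub>C0 V\<^esub> st V (k e0 \<oplus>\<^bsub>V\<^esub> k e1)"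
    if "V \<in> P" "k \<in> mod_hom R F V" for V k
    using st F e01 that
    by (simp add: y_def mod_hom_diff[OF A0_hom] mod_hom_add[OF A0_hom] C0_module st_nat mod_hom_add[OF that(2)])
  have "A0 F F f y = \<zero>\<^bsub>C0 F\<^esub>" "A0 F F g y = \<zero>\<^bsub>C0 F\<^esub>"
    using st e01 by (simp_all add: A0y[OF F f(1)] A0y[OF F g(1)] f g st_zero[OF F] C0.add_diff_self)
  then have dx: "d F x = y"
    using x0 cl F f(1) g(1) y
    by (simp add: x_def mod_hom_diff[OF d_hom] C1_module C0_module d_nat C0.add_diff_self)
  have ff: "compose (carrier F) f f = f"
    by (rule uniq2[OF F mod_hom_compose[OF f(1) f(1) F.module_axioms] f(1)])
      (simp_all add: compose_def f e01 mod_hom_zero[OF f(1) F.module_axioms F.module_axioms])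
  have gg: "compose (carrier F) g g = g"
    by (rule uniq2[OF F mod_hom_compose[OF g(1) g(1) F.module_axioms] g(1)])
      (simp_all add: compose_def g e01 mod_hom_zero[OF g(1) F.module_axioms F.module_axioms])
  have fg: "compose (carrier F) f g = (\<lambda>v\<in>carrier F. \<zero>\<^bsub>F\<^esub>)"
    by (rule uniq2[OF F mod_hom_compose[OF g(1) f(1) F.module_axioms] mod_hom_zero_map[OF F.module_axioms F.module_axioms]])
      (simp_all add: compose_def f g e01 mod_hom_zero[OF f(1) F.module_axioms F.module_axioms])
  have gf: "compose (carrier F) g f = (\<lambda>v\<in>carrier F. \<zero>\<^bsub>F\<^esub>)"
    by (rule uniq2[OF F mod_hom_compose[OF f(1) g(1) F.module_axioms] mod_hom_zero_map[OF F.module_axioms F.module_axioms]])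
      (simp_all add: compose_def f g e01 mod_hom_zero[OF g(1) F.module_axioms F.module_axioms])
  have A1c: "A1 F F f (A1 F F f x0) = A1 F F f x0" "A1 F F g (A1 F F g x0) = A1 F F g x0"
    "A1 F F f (A1 F F g x0) = \<zero>\<^bsub>C1 F\<^esub>" "A1 F F g (A1 F F f x0) = \<zero>\<^bsub>C1 F\<^esub>"
    using A1_comp[OF F F F f(1) f(1) x0(1)] A1_comp[OF F F F g(1) g(1) x0(1)]
      A1_comp[OF F F F g(1) f(1) x0(1)] A1_comp[OF F F F f(1) g(1) x0(1)]
    by (simp_all add: ff gg fg gf zero_map[OF pointed(1) F F x0(1)])
  have "A1 F F f x = \<zero>\<^bsub>C1 F\<^esub>" "A1 F F g x = \<zero>\<^bsub>C1 F\<^esub>"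
    using x0(1) cl F f(1) g(1)
    by (simp_all add: x_def mod_hom_diff[OF A1_hom[OF F F f(1)]] mod_hom_diff[OF A1_hom[OF F F g(1)]] C1_module
        A1c C1.add_diff_self)
  note fx = this
  define k where "k V v w = (SOME k. k \<in> mod_hom R F V \<and> k e0 = v \<and> k e1 = w)" for V :: "('r, 'v) module" and v w
  have k: "k V v w \<in> mod_hom R F V" "k V v w e0 = v" "k V v w e1 = w"
    if "V \<in> P" "v \<in> carrier V" "w \<in> carrier V" for V v w
    using someI_ex[OF ex2[OF that]] by (simp_all add: k_def)
  have zero: "A1 F V (k V v \<zero>\<^bsub>V\<^esub>) x = \<zero>\<^bsub>C1 V\<^esub>" "A1 F V (k V \<zero>\<^bsub>V\<^esub> v) x = \<zero>\<^bsub>C1 V\<^esub>"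
    if V: "V \<in> P" "v \<in> carrier V" for V v
  proof -
    interpret V: module R V by (rule proj_module[OF V(1)])
    note k1 = k[OF V V.zero_closed] and k2 = k[OF V(1) V.zero_closed V(2)]
    have "k V v \<zero>\<^bsub>V\<^esub> = compose (carrier F) (k V v \<zero>\<^bsub>V\<^esub>) f"
      using f e01 mod_hom_zero[OF k1(1) F.module_axioms V.module_axioms]
      by (intro uniq2[OF V(1)] k1 mod_hom_compose[OF f(1)]) (simp_all add: compose_def k1 F.module_axioms)
    then show "A1 F V (k V v \<zero>\<^bsub>V\<^esub>) x = \<zero>\<^bsub>C1 V\<^esub>"
      using A1_comp[OF F F V(1) f(1) k1(1) x] mod_hom_zero[OF A1_hom[OF F V(1) k1(1)] C1_module[OF F] C1_module[OF V(1)]]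
      by (simp add: fx)
    have "k V \<zero>\<^bsub>V\<^esub> v = compose (carrier F) (k V \<zero>\<^bsub>V\<^esub> v) g"
      using g e01 mod_hom_zero[OF k2(1) F.module_axioms V.module_axioms]
      by (intro uniq2[OF V(1)] k2 mod_hom_compose[OF g(1)]) (simp_all add: compose_def k2 F.module_axioms)
    then show "A1 F V (k V \<zero>\<^bsub>V\<^esub> v) x = \<zero>\<^bsub>C1 V\<^esub>"
      using A1_comp[OF F F V(1) g(1) k2(1) x] mod_hom_zero[OF A1_hom[OF F V(1) k2(1)] C1_module[OF F] C1_module[OF V(1)]]
      by (simp add: fx)
  qed
  have nat: "A1 V W l (A1 F V (k V v w) x) = A1 F W (k W (l v) (l w)) x"
    if V: "V \<in> P" "W \<in> P" "l \<in> mod_hom R V W" "v \<in> carrier V" "w \<in> carrier V" for V W l v w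
  proof -
    note kV = k[OF V(1,4,5)] and kW = k[OF V(2) mod_hom_closed[OF V(3,4)] mod_hom_closed[OF V(3,5)]]
    have "k W (l v) (l w) = compose (carrier F) l (k V v w)"
      using e01 by (intro uniq2[OF V(2)] kW mod_hom_compose[OF kV(1) V(3)]) (simp_all add: compose_def kV kW F.module_axioms)
    then show ?thesis using A1_comp[OF F V(1,2) kV(1) V(3) x] by simp
  qed
  have "is_defect R K \<phi> \<mu> (\<lambda>V v w. A1 F V (k V v w) x)"
    unfolding is_defect_def
    using F x by (auto simp: A1_closed k zero nat d_nat dx A0y)
  then show ?thesis by (rule exI[of "is_defect R K \<phi> \<mu>"])
qed

abbreviation df where "df \<equiv> defect R K \<phi> \<mu>"

lemma is_defect: "is_defect R K \<phi> \<mu> df"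
  unfolding defect_def by (rule someI_ex[OF defect_exists])

lemma df:
  shows df_closed: "V \<in> P \<Longrightarrow> v \<in> carrier V \<Longrightarrow> w \<in> carrier V \<Longrightarrow> df V v w \<in> carrier (C1 V)"
    and df_nat: "V \<in> P \<Longrightarrow> W \<in> P \<Longrightarrow> f \<in> mod_hom R V W \<Longrightarrow> v \<in> carrier V \<Longrightarrow> w \<in> carrier V \<Longrightarrow>
      A1 V W f (df V v w) = df W (f v) (f w)"
    and df_zero: "V \<in> P \<Longrightarrow> v \<in> carrier V \<Longrightarrow> df V v \<zero>\<^bsub>V\<^esub> = \<zero>\<^bsub>C1 V\<^esub>"
      "V \<in> P \<Longrightarrow> v \<in> carrier V \<Longrightarrow> df V \<zero>\<^bsub>V\<^esub> v = \<zero>\<^bsub>C1 V\<^esub>"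
    and d_df: "V \<in> P \<Longrightarrow> v \<in> carrier V \<Longrightarrow> w \<in> carrier V \<Longrightarrow>
      d V (df V v w) = st V v \<oplus>\<^bsub>C0 V\<^esub> st V w \<ominus>\<^bsub>C0 V\<^esub> st V (v \<oplus>\<^bsub>V\<^esub> w)"
  using is_defect unfolding is_defect_def by blast+

text \<open>
  Commutativity and, by the cocycle condition below, associativity of the addition of \<open>C\<^sub>0\<^sub>1\<close>: both
  sides are natural, have the same differential and agree when one of the variables is zero.
\<close>

lemma df_sym: "V \<in> P \<Longrightarrow> v \<in> carrier V \<Longrightarrow> w \<in> carrier V \<Longrightarrow> df V v w = df V w v"
proof (rule natural_eqI2[where h = df and h' = "\<lambda>V v w. df V w v"])
  fix V x y assume V: "V \<in> P" "x \<in> carrier V" "y \<in> carrier V"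
  interpret V: abelian_group V by (rule V_abelian[OF V(1)])
  interpret C0: abelian_group "C0 V" by (rule C0_abelian[OF V(1)])
  show "d V (df V x y) = d V (df V y x)"
    using V by (simp add: d_df V.a_comm C0.a_comm st_closed)
qed (simp_all add: df)

lemma df_cocycle:
  assumes "V \<in> P" "x \<in> carrier V" "y \<in> carrier V" "z \<in> carrier V"
  shows "df V x y \<oplus>\<^bsub>C1 V\<^esub> df V (x \<oplus>\<^bsub>V\<^esub> y) z = df V y z \<oplus>\<^bsub>C1 V\<^esub> df V x (y \<oplus>\<^bsub>V\<^esub> z)"
proof (rule natural_eqI[where h = "\<lambda>V x y z. df V x y \<oplus>\<^bsub>C1 V\<^esub> df V (x \<oplus>\<^bsub>V\<^esub> y) z"
        and h' = "\<lambda>V x y z. df V y z \<oplus>\<^bsub>C1 V\<^esub> df V x (y \<oplus>\<^bsub>V\<^esub> z)"])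
  fix V x y z assume V: "V \<in> P" "x \<in> carrier V" "y \<in> carrier V" "z \<in> carrier V"
  interpret V: abelian_group V by (rule V_abelian[OF V(1)])
  interpret C0: abelian_group "C0 V" by (rule C0_abelian[OF V(1)])
  interpret C1: abelian_group "C1 V" by (rule C1_abelian[OF V(1)])
  show "df V x y \<oplus>\<^bsub>C1 V\<^esub> df V (x \<oplus>\<^bsub>V\<^esub> y) z \<in> carrier (C1 V)"
    "df V y z \<oplus>\<^bsub>C1 V\<^esub> df V x (y \<oplus>\<^bsub>V\<^esub> z) \<in> carrier (C1 V)"
    using V by (simp_all add: df)
  show "d V (df V x y \<oplus>\<^bsub>C1 V\<^esub> df V (x \<oplus>\<^bsub>V\<^esub> y) z) = d V (df V y z \<oplus>\<^bsub>C1 V\<^esub> df V x (y \<oplus>\<^bsub>V\<^esub> z))"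
    using V by (simp add: mod_hom_add[OF d_hom] df V.a_assoc)
      (rule C0.defect_cocycle_identity; simp add: st_closed)
  show "A1 V W f (df V x y \<oplus>\<^bsub>C1 V\<^esub> df V (x \<oplus>\<^bsub>V\<^esub> y) z) =
      df W (f x) (f y) \<oplus>\<^bsub>C1 W\<^esub> df W (f x \<oplus>\<^bsub>W\<^esub> f y) (f z)"
    "A1 V W f (df V y z \<oplus>\<^bsub>C1 V\<^esub> df V x (y \<oplus>\<^bsub>V\<^esub> z)) =
      df W (f y) (f z) \<oplus>\<^bsub>C1 W\<^esub> df W (f x) (f y \<oplus>\<^bsub>W\<^esub> f z)" if "W \<in> P" "f \<in> mod_hom R V W" for W f
    using V that by (simp_all add: mod_hom_add[OF A1_hom] df mod_hom_add[OF that(2)])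
next
  fix V x y assume V: "V \<in> P" "x \<in> carrier V" "y \<in> carrier V"
  interpret V: abelian_group V by (rule V_abelian[OF V(1)])
  interpret C1: abelian_group "C1 V" by (rule C1_abelian[OF V(1)])
  show "df V x y \<oplus>\<^bsub>C1 V\<^esub> df V (x \<oplus>\<^bsub>V\<^esub> y) \<zero>\<^bsub>V\<^esub> = df V y \<zero>\<^bsub>V\<^esub> \<oplus>\<^bsub>C1 V\<^esub> df V x (y \<oplus>\<^bsub>V\<^esub> \<zero>\<^bsub>V\<^esub>)"
    using V by (simp add: df)
next
  fix V z assume V: "V \<in> P" "z \<in> carrier V"
  interpret V: abelian_group V by (rule V_abelian[OF V(1)])
  interpret C1: abelian_group "C1 V" by (rule C1_abelian[OF V(1)])
  show "df V \<zero>\<^bsub>V\<^esub> \<zero>\<^bsub>V\<^esub> \<oplus>\<^bsub>C1 V\<^esub> df V (\<zero>\<^bsub>V\<^esub> \<oplus>\<^bsub>V\<^esub> \<zero>\<^bsub>V\<^esub>) z = df V \<zero>\<^bsub>V\<^esub> z \<oplus>\<^bsub>C1 V\<^esub> df V \<zero>\<^bsub>V\<^esub> (\<zero>\<^bsub>V\<^esub> \<oplus>\<^bsub>V\<^esub> z)"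
    using V by (simp add: df)
qed (fact assms)+

section \<open>The group \<open>C\<^sub>0\<^sub>1(V)\<close>\<close>

abbreviation G where "G \<equiv> C01_group R K \<phi> \<mu>"
abbreviation c1 where "c1 \<equiv> C01_c1 R \<phi>"
abbreviation c0 where "c0 \<equiv> C01_c0 R K \<phi> \<mu>"

lemma G_simps:
  "carrier (G V) = carrier (C1 V) \<times> carrier V"
  "\<zero>\<^bsub>G V\<^esub> = (\<zero>\<^bsub>C1 V\<^esub>, \<zero>\<^bsub>V\<^esub>)"
  "(c, v) \<oplus>\<^bsub>G V\<^esub> (c', v') = (c \<oplus>\<^bsub>C1 V\<^esub> c' \<oplus>\<^bsub>C1 V\<^esub> df V v v', v \<oplus>\<^bsub>V\<^esub> v')"
  by (simp_all add: C01_group_def)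

lemma G_abelian:
  assumes V: "V \<in> P"
  shows "abelian_group (G V)"
proof -
  interpret V: abelian_group V by (rule V_abelian[OF V(1)])
  interpret C1: abelian_group "C1 V" by (rule C1_abelian[OF V(1)])
  show ?thesis
  proof (rule abelian_groupI)
    fix x y assume "x \<in> carrier (G V)" "y \<in> carrier (G V)"
    then show "x \<oplus>\<^bsub>G V\<^esub> y \<in> carrier (G V)" "x \<oplus>\<^bsub>G V\<^esub> y = y \<oplus>\<^bsub>G V\<^esub> x"
      using V by (auto simp: G_simps df_closed df_sym V.a_comm C1.a_comm)
  next
    fix x y z assume "x \<in> carrier (G V)" "y \<in> carrier (G V)" "z \<in> carrier (G V)"
    then obtain c1 v1 c2 v2 c3 v3 where xyz: "x = (c1, v1)" "y = (c2, v2)" "z = (c3, v3)"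
      and c: "c1 \<in> carrier (C1 V)" "c2 \<in> carrier (C1 V)" "c3 \<in> carrier (C1 V)"
      and v: "v1 \<in> carrier V" "v2 \<in> carrier V" "v3 \<in> carrier V"
      by (auto simp: G_simps)
    have eq: "(c1 \<oplus>\<^bsub>C1 V\<^esub> c2 \<oplus>\<^bsub>C1 V\<^esub> p) \<oplus>\<^bsub>C1 V\<^esub> c3 \<oplus>\<^bsub>C1 V\<^esub> q = c1 \<oplus>\<^bsub>C1 V\<^esub> (c2 \<oplus>\<^bsub>C1 V\<^esub> c3 \<oplus>\<^bsub>C1 V\<^esub> p') \<oplus>\<^bsub>C1 V\<^esub> q'"
      if "p \<oplus>\<^bsub>C1 V\<^esub> q = p' \<oplus>\<^bsub>C1 V\<^esub> q'" "p \<in> carrier (C1 V)" "q \<in> carrier (C1 V)" "p' \<in> carrier (C1 V)" "q' \<in> carrier (C1 V)" for p q p' q'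
    proof -
      have "(c1 \<oplus>\<^bsub>C1 V\<^esub> c2 \<oplus>\<^bsub>C1 V\<^esub> p) \<oplus>\<^bsub>C1 V\<^esub> c3 \<oplus>\<^bsub>C1 V\<^esub> q = c1 \<oplus>\<^bsub>C1 V\<^esub> c2 \<oplus>\<^bsub>C1 V\<^esub> c3 \<oplus>\<^bsub>C1 V\<^esub> (p \<oplus>\<^bsub>C1 V\<^esub> q)"
        using c that by (simp add: C1.a_ac)
      also have "\<dots> = c1 \<oplus>\<^bsub>C1 V\<^esub> (c2 \<oplus>\<^bsub>C1 V\<^esub> c3 \<oplus>\<^bsub>C1 V\<^esub> p') \<oplus>\<^bsub>C1 V\<^esub> q'"
        unfolding that(1) using c that(2-5) by (simp add: C1.a_ac)
      finally show ?thesis .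
    qed
    show "x \<oplus>\<^bsub>G V\<^esub> y \<oplus>\<^bsub>G V\<^esub> z = x \<oplus>\<^bsub>G V\<^esub> (y \<oplus>\<^bsub>G V\<^esub> z)"
      using v V by (simp add: xyz G_simps V.a_assoc) (intro eq df_cocycle df_closed; simp)
  next
    fix x assume "x \<in> carrier (G V)"
    then obtain c v where x: "x = (c, v)" "c \<in> carrier (C1 V)" "v \<in> carrier V" by (auto simp: G_simps)
    have w: "df V (\<ominus>\<^bsub>V\<^esub> v) v \<in> carrier (C1 V)" using V x by (simp add: df_closed)
    then have "(\<ominus>\<^bsub>C1 V\<^esub> (c \<oplus>\<^bsub>C1 V\<^esub> df V (\<ominus>\<^bsub>V\<^esub> v) v), \<ominus>\<^bsub>V\<^esub> v) \<oplus>\<^bsub>G V\<^esub> x = \<zero>\<^bsub>G V\<^esub>"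
      using x by (simp add: G_simps V.l_neg C1.a_assoc C1.l_neg)
    then show "\<exists>y\<in>carrier (G V). y \<oplus>\<^bsub>G V\<^esub> x = \<zero>\<^bsub>G V\<^esub>"
      using w x by (intro bexI[of _ "(\<ominus>\<^bsub>C1 V\<^esub> (c \<oplus>\<^bsub>C1 V\<^esub> df V (\<ominus>\<^bsub>V\<^esub> v) v), \<ominus>\<^bsub>V\<^esub> v)"]) (simp_all add: G_simps)
  next
    show "\<zero>\<^bsub>G V\<^esub> \<in> carrier (G V)" by (simp add: G_simps)
    show "\<zero>\<^bsub>G V\<^esub> \<oplus>\<^bsub>G V\<^esub> x = x" if "x \<in> carrier (G V)" for x
      using that V by (auto simp: G_simps df_zero)
  qed
qed

lemma c0_eq: "V \<in> P \<Longrightarrow> c \<in> carrier (C1 V) \<Longrightarrow> v \<in> carrier V \<Longrightarrow> c0 V (c, v) = d V c \<oplus>\<^bsub>C0 V\<^esub> st V v"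
  by (simp add: C01_c0_def G_simps)

lemma c1_eq: "V \<in> P \<Longrightarrow> c \<in> carrier (C1 V) \<Longrightarrow> c1 V c = (c, \<zero>\<^bsub>V\<^esub>)"
  by (simp add: C01_c1_def)

lemma c0_closed: "V \<in> P \<Longrightarrow> x \<in> carrier (G V) \<Longrightarrow> c0 V x \<in> carrier (C0 V)"
proof -
  assume V: "V \<in> P" and x: "x \<in> carrier (G V)"
  interpret C0: abelian_group "C0 V" by (rule C0_abelian[OF V(1)])
  show ?thesis using V x by (auto simp: G_simps c0_eq d_closed st_closed)
qed

lemma c1_closed: "V \<in> P \<Longrightarrow> c \<in> carrier (C1 V) \<Longrightarrow> c1 V c \<in> carrier (G V)"
proof -
  assume V: "V \<in> P" and c: "c \<in> carrier (C1 V)"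
  interpret V: abelian_group V by (rule V_abelian[OF V(1)])
  show ?thesis using V c by (simp add: c1_eq G_simps)
qed

lemma c0_add:
  assumes "V \<in> P" "x \<in> carrier (G V)" "y \<in> carrier (G V)"
  shows "c0 V (x \<oplus>\<^bsub>G V\<^esub> y) = c0 V x \<oplus>\<^bsub>C0 V\<^esub> c0 V y"
proof -
  interpret V: abelian_group V by (rule V_abelian[OF assms(1)])
  interpret C0: abelian_group "C0 V" by (rule C0_abelian[OF assms(1)])
  interpret C1: abelian_group "C1 V" by (rule C1_abelian[OF assms(1)])
  have *: "p \<oplus>\<^bsub>C0 V\<^esub> q \<oplus>\<^bsub>C0 V\<^esub> (x \<oplus>\<^bsub>C0 V\<^esub> y \<ominus>\<^bsub>C0 V\<^esub> z) \<oplus>\<^bsub>C0 V\<^esub> z = p \<oplus>\<^bsub>C0 V\<^esub> x \<oplus>\<^bsub>C0 V\<^esub> (q \<oplus>\<^bsub>C0 V\<^esub> y)"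
    if "p \<in> carrier (C0 V)" "q \<in> carrier (C0 V)" "x \<in> carrier (C0 V)" "y \<in> carrier (C0 V)" "z \<in> carrier (C0 V)" for p q x y z
  proof -
    have "p \<oplus>\<^bsub>C0 V\<^esub> q \<oplus>\<^bsub>C0 V\<^esub> (x \<oplus>\<^bsub>C0 V\<^esub> y \<ominus>\<^bsub>C0 V\<^esub> z) \<oplus>\<^bsub>C0 V\<^esub> z = p \<oplus>\<^bsub>C0 V\<^esub> q \<oplus>\<^bsub>C0 V\<^esub> ((x \<oplus>\<^bsub>C0 V\<^esub> y \<ominus>\<^bsub>C0 V\<^esub> z) \<oplus>\<^bsub>C0 V\<^esub> z)"
      using that by (simp add: C0.a_assoc)
    also have "\<dots> = p \<oplus>\<^bsub>C0 V\<^esub> q \<oplus>\<^bsub>C0 V\<^esub> (x \<oplus>\<^bsub>C0 V\<^esub> y)"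
      using that by (simp only: C0.add_diff_self C0.a_closed)
    finally show ?thesis using that by (simp add: C0.a_ac)
  qed
  show ?thesis
    using assms
    by (auto simp: G_simps c0_eq df mod_hom_add[OF d_hom] intro!: * d_closed st_closed)
qed

lemma c1_add:
  assumes "V \<in> P" "x \<in> carrier (C1 V)" "y \<in> carrier (C1 V)"
  shows "c1 V (x \<oplus>\<^bsub>C1 V\<^esub> y) = c1 V x \<oplus>\<^bsub>G V\<^esub> c1 V y"
proof -
  interpret V: abelian_group V by (rule V_abelian[OF assms(1)])
  interpret C1: abelian_group "C1 V" by (rule C1_abelian[OF assms(1)])
  show ?thesis using assms by (simp add: c1_eq G_simps df)
qed

lemma c0_c1: "V \<in> P \<Longrightarrow> c \<in> carrier (C1 V) \<Longrightarrow> c0 V (c1 V c) = d V c"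
proof -
  assume V: "V \<in> P" and c: "c \<in> carrier (C1 V)"
  interpret V: abelian_group V by (rule V_abelian[OF V])
  interpret C0: abelian_group "C0 V" by (rule C0_abelian[OF V])
  show ?thesis using V c by (simp add: c1_eq c0_eq st_zero d_closed)
qed

lemma a_c0: "V \<in> P \<Longrightarrow> c \<in> carrier (C1 V) \<Longrightarrow> v \<in> carrier V \<Longrightarrow> a V (c0 V (c, v)) = v"
proof -
  assume V: "V \<in> P" and c: "c \<in> carrier (C1 V)" "v \<in> carrier V"
  interpret V: abelian_group V by (rule V_abelian[OF V])
  show ?thesis using V c by (simp add: c0_eq mod_hom_add[OF a_hom] d_closed st_closed ad a_st)
qed

text \<open>
  An additive endomorphism of \<open>C\<^sub>0\<^sub>1\<close> is determined by its restrictions to \<open>C\<^sub>1\<close> and to the elements \<open>(0, v)\<close>.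
\<close>

lemma G_decompose: "V \<in> P \<Longrightarrow> c \<in> carrier (C1 V) \<Longrightarrow> v \<in> carrier V \<Longrightarrow> (c, v) = c1 V c \<oplus>\<^bsub>G V\<^esub> (\<zero>\<^bsub>C1 V\<^esub>, v)"
proof -
  assume V: "V \<in> P" and c: "c \<in> carrier (C1 V)" "v \<in> carrier V"
  interpret V: abelian_group V by (rule V_abelian[OF V])
  interpret C1: abelian_group "C1 V" by (rule C1_abelian[OF V])
  show ?thesis using V c by (simp add: c1_eq G_simps df)
qed

lemma c0_nat:
  assumes "V \<in> P" "W \<in> P" "f \<in> mod_hom R V W" "c \<in> carrier (C1 V)" "v \<in> carrier V"
  shows "A0 V W f (c0 V (c, v)) = c0 W (A1 V W f c, f v)"
  using assms
  by (simp add: c0_eq mod_hom_add[OF A0_hom] d_closed st_closed A1_closed mod_hom_closed[OF assms(3)] st_nat d_nat)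

lemma c0_surj: "V \<in> P \<Longrightarrow> c0 V ` carrier (G V) = carrier (C0 V)"
proof (intro equalityI subsetI)
  fix x assume V: "V \<in> P" and "x \<in> c0 V ` carrier (G V)"
  then show "x \<in> carrier (C0 V)" using c0_closed by auto
next
  fix x assume V: "V \<in> P" and x: "x \<in> carrier (C0 V)"
  interpret C0: abelian_group "C0 V" by (rule C0_abelian[OF V])
  interpret V: abelian_group V by (rule V_abelian[OF V])
  have ax: "a V x \<in> carrier V" using a_closed[OF V x] .
  have "a V (x \<ominus>\<^bsub>C0 V\<^esub> st V (a V x)) = \<zero>\<^bsub>V\<^esub>"
    using V x ax by (simp add: mod_hom_diff[OF a_hom] C0_module proj_module st_closed a_st V.add_diff_self)
  then obtain c where c: "c \<in> carrier (C1 V)" "d V c = x \<ominus>\<^bsub>C0 V\<^esub> st V (a V x)"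
    using ker_a_obtain[OF V C0.minus_closed[OF x st_closed[OF V ax]]] by blast
  then have "c0 V (c, a V x) = x" using V x ax st_closed[OF V ax] by (simp add: c0_eq C0.add_diff_self)
  moreover have "(c, a V x) \<in> carrier (G V)" using c ax by (simp add: G_simps)
  ultimately show "x \<in> c0 V ` carrier (G V)" by (metis imageI)
qed

lemma c0_kernel:
  assumes "V \<in> P" "x \<in> carrier (G V)" "c0 V x = \<zero>\<^bsub>C0 V\<^esub>"
  obtains \<tau> where "\<tau> \<in> carrier (TM V)" "x = c1 V (b V \<tau>)"
proof -
  obtain c v where x: "x = (c, v)" "c \<in> carrier (C1 V)" "v \<in> carrier V" using assms(2) by (auto simp: G_simps)
  have v: "v = \<zero>\<^bsub>V\<^esub>"
    using a_c0[OF assms(1) x(2,3)] assms mod_hom_zero[OF a_hom[OF assms(1)] C0_module proj_module] x by simp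
  then have "d V c = \<zero>\<^bsub>C0 V\<^esub>" using c0_c1[OF assms(1) x(2)] assms x by (simp add: c1_eq)
  then obtain \<tau> where "\<tau> \<in> carrier (TM V)" "c = b V \<tau>" using ker_d_obtain[OF assms(1) x(2)] by blast
  then show ?thesis using that x v assms(1) by (simp add: c1_eq)
qed

end

section \<open>The square-zero extension\<close>

lemma (in abelian_group) defect_scalar_identity:
  assumes "x \<in> carrier G" "y \<in> carrier G" "p \<in> carrier G" "x' \<in> carrier G" "y' \<in> carrier G" "p' \<in> carrier G"
  shows "(x \<oplus> y \<ominus> p) \<oplus> (p \<ominus> p') = (x \<ominus> x') \<oplus> (y \<ominus> y') \<oplus> (x' \<oplus> y' \<ominus> p')"
proof -
  have "(x \<ominus> x') \<oplus> (y \<ominus> y') \<oplus> (x' \<oplus> y' \<ominus> p') = (y \<ominus> y') \<oplus> (y' \<oplus> ((x \<ominus> x') \<oplus> (x' \<ominus> p')))"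
    using assms by (simp add: minus_eq a_ac)
  also have "(x \<ominus> x') \<oplus> (x' \<ominus> p') = x \<ominus> p'"
    using assms by (simp add: minus_eq a_assoc r_neg1)
  also have "(y \<ominus> y') \<oplus> (y' \<oplus> (x \<ominus> p')) = x \<oplus> y \<ominus> p'"
    using assms by (simp add: diff_add_cancel_middle) (simp add: minus_eq a_ac)
  also have "\<dots> = (x \<oplus> y \<ominus> p) \<oplus> (p \<ominus> p')"
    using assms by (simp add: minus_eq a_assoc r_neg1)
  finally show ?thesis by simp
qed

context mult_ext
begin

abbreviation CI where "CI \<equiv> C01_int R K \<phi> \<mu>"
abbreviation AG where "AG \<equiv> Ar CI"
abbreviation E where "E \<equiv> ext_ring R K \<phi> \<mu>"
abbreviation q where "q \<equiv> ext_proj R K \<phi> \<mu>"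
abbreviation i where "i \<equiv> ext_incl R K M \<phi> \<mu>"

lemma C01_functor_simps [simp]:
  "carrier (Ob (C01_functor R K \<phi> \<mu> act) V) = carrier (G V)"
  "add (Ob (C01_functor R K \<phi> \<mu> act) V) = add (G V)"
  "\<zero>\<^bsub>Ob (C01_functor R K \<phi> \<mu> act) V\<^esub> = \<zero>\<^bsub>G V\<^esub>"
  "r \<odot>\<^bsub>Ob (C01_functor R K \<phi> \<mu> act) V\<^esub> x = act V r x"
  "Ar (C01_functor R K \<phi> \<mu> act) = AG"
  by (simp_all add: C01_functor_def C01_int_def Let_def)

lemma CI_simps [simp]:
  "carrier (Ob CI V) = carrier (G V)" "add (Ob CI V) = add (G V)"
  "\<zero>\<^bsub>Ob CI V\<^esub> = \<zero>\<^bsub>G V\<^esub>" "n \<odot>\<^bsub>Ob CI V\<^esub> x = add_pow (G V) n x"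
  by (simp_all add: C01_int_def)

lemma AG_eq: "c \<in> carrier (C1 V) \<Longrightarrow> v \<in> carrier V \<Longrightarrow> AG V W f (c, v) = (A1 V W f c, f v)"
  by (simp add: C01_int_def C01_functor_def G_simps)

lemma AG_extensional: "AG V W f \<in> extensional (carrier (G V))"
  by (simp add: C01_int_def C01_functor_def)

lemma G_cases:
  assumes "x \<in> carrier (G V)"
  obtains c v where "x = (c, v)" "c \<in> carrier (C1 V)" "v \<in> carrier V"
  using assms by (auto simp: G_simps)

lemma AG_closed: "V \<in> P \<Longrightarrow> W \<in> P \<Longrightarrow> f \<in> mod_hom R V W \<Longrightarrow> x \<in> carrier (G V) \<Longrightarrow> AG V W f x \<in> carrier (G W)"
  by (erule G_cases) (simp add: AG_eq G_simps A1_closed mod_hom_closed)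

lemma AG_add:
  assumes "V \<in> P" "W \<in> P" "f \<in> mod_hom R V W" "x \<in> carrier (G V)" "y \<in> carrier (G V)"
  shows "AG V W f (x \<oplus>\<^bsub>G V\<^esub> y) = AG V W f x \<oplus>\<^bsub>G W\<^esub> AG V W f y"
proof -
  interpret V: abelian_group V by (rule V_abelian[OF assms(1)])
  interpret C1: abelian_group "C1 V" by (rule C1_abelian[OF assms(1)])
  obtain c v c' v' where x: "x = (c, v)" "c \<in> carrier (C1 V)" "v \<in> carrier V"
    and y: "y = (c', v')" "c' \<in> carrier (C1 V)" "v' \<in> carrier V"
    using assms(4,5) by (elim G_cases)
  show ?thesis
    using assms(1-3) x y
    by (simp add: G_simps AG_eq df mod_hom_add[OF A1_hom] mod_hom_add[OF assms(3)] mod_hom_closed[OF assms(3)])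
qed

lemma AG_c1: "V \<in> P \<Longrightarrow> W \<in> P \<Longrightarrow> f \<in> mod_hom R V W \<Longrightarrow> c \<in> carrier (C1 V) \<Longrightarrow> AG V W f (c1 V c) = c1 W (A1 V W f c)"
proof -
  assume V: "V \<in> P" and *: "W \<in> P" "f \<in> mod_hom R V W" "c \<in> carrier (C1 V)"
  interpret V: abelian_group V by (rule V_abelian[OF V(1)])
  show ?thesis using V * by (simp add: c1_eq AG_eq A1_closed mod_hom_zero proj_module)
qed

lemma AG_c0:
  "V \<in> P \<Longrightarrow> W \<in> P \<Longrightarrow> f \<in> mod_hom R V W \<Longrightarrow> x \<in> carrier (G V) \<Longrightarrow> c0 W (AG V W f x) = A0 V W f (c0 V x)"
  by (erule G_cases) (simp add: AG_eq c0_nat)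

text \<open>
  Additive maps are linear over the integers, so only additivity and naturality remain.
\<close>

lemma nat_trans_CI:
  "r' \<in> nat_trans R \<Z> CI CI \<longleftrightarrow> r' \<in> extensional P \<and>
    (\<forall>V\<in>P. r' V \<in> extensional (carrier (G V)) \<and> (\<forall>x\<in>carrier (G V). r' V x \<in> carrier (G V)) \<and>
      (\<forall>x\<in>carrier (G V). \<forall>y\<in>carrier (G V). r' V (x \<oplus>\<^bsub>G V\<^esub> y) = r' V x \<oplus>\<^bsub>G V\<^esub> r' V y) \<and>
      (\<forall>W\<in>P. \<forall>f\<in>mod_hom R V W. \<forall>x\<in>carrier (G V). r' W (AG V W f x) = AG V W f (r' V x)))"
proof -
  have "h \<in> mod_hom \<Z> (Ob CI V) (Ob CI V) \<longleftrightarrow> h \<in> extensional (carrier (G V)) \<and>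
      (\<forall>x\<in>carrier (G V). h x \<in> carrier (G V)) \<and>
      (\<forall>x\<in>carrier (G V). \<forall>y\<in>carrier (G V). h (x \<oplus>\<^bsub>G V\<^esub> y) = h x \<oplus>\<^bsub>G V\<^esub> h y)"
    if V: "V \<in> P" for V h
    using additive_int_pow[OF G_abelian[OF V] G_abelian[OF V], of h] by (auto simp: mod_hom_def PiE_iff)
  then show ?thesis by (simp add: nat_trans_def) blast
qed

text \<open>
  The augmentation recovers \<open>r\<close>: applied to \<open>c\<^sub>0(r'(x)) = r c\<^sub>0(x)\<close> at \<open>x = (0, u)\<close>, it gives \<open>r u\<close>.
\<close>

lemma intertwines_unique:
  assumes r': "\<And>x. x \<in> carrier (G U) \<Longrightarrow> r' U x \<in> carrier (G U)"
    and "r1 \<in> carrier R" "r2 \<in> carrier R" "intertwines R K \<phi> \<mu> r' r1" "intertwines R K \<phi> \<mu> r' r2"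
  shows "r1 = r2"
proof -
  interpret C1: abelian_group "C1 U" by (rule C1_abelian[OF U_proj])
  let ?x = "(\<zero>\<^bsub>C1 U\<^esub>, u)"
  have x: "?x \<in> carrier (G U)" using u_closed by (simp add: G_simps)
  have c: "c0 U ?x \<in> carrier (C0 U)" by (rule c0_closed[OF U_proj x])
  have "r1 \<odot>\<^bsub>C0 U\<^esub> c0 U ?x = r2 \<odot>\<^bsub>C0 U\<^esub> c0 U ?x"
    using assms(4,5) x U_proj unfolding intertwines_def by metis
  then have "r1 \<odot>\<^bsub>U\<^esub> u = r2 \<odot>\<^bsub>U\<^esub> u"
    using mod_hom_smult[OF a_hom[OF U_proj] assms(2) c] mod_hom_smult[OF a_hom[OF U_proj] assms(3) c]
      a_c0[OF U_proj C1.zero_closed u_closed] by simp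
  then show ?thesis using coord_smult_u assms(2,3) by metis
qed

lemma ext_carrier: "r' \<in> carrier E \<longleftrightarrow> r' \<in> nat_trans R \<Z> CI CI \<and> (\<exists>r\<in>carrier R. intertwines R K \<phi> \<mu> r' r)"
  by (simp add: ext_ring_def Let_def)

lemma extI:
  assumes "r' \<in> extensional P"
    and "\<And>V. V \<in> P \<Longrightarrow> r' V \<in> extensional (carrier (G V))"
    and "\<And>V x. V \<in> P \<Longrightarrow> x \<in> carrier (G V) \<Longrightarrow> r' V x \<in> carrier (G V)"
    and "\<And>V x y. V \<in> P \<Longrightarrow> x \<in> carrier (G V) \<Longrightarrow> y \<in> carrier (G V) \<Longrightarrow>
      r' V (x \<oplus>\<^bsub>G V\<^esub> y) = r' V x \<oplus>\<^bsub>G V\<^esub> r' V y"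
    and "\<And>V W f x. V \<in> P \<Longrightarrow> W \<in> P \<Longrightarrow> f \<in> mod_hom R V W \<Longrightarrow> x \<in> carrier (G V) \<Longrightarrow>
      r' W (AG V W f x) = AG V W f (r' V x)"
    and "r \<in> carrier R"
    and "\<And>V x. V \<in> P \<Longrightarrow> x \<in> carrier (G V) \<Longrightarrow> c0 V (r' V x) = r \<odot>\<^bsub>C0 V\<^esub> c0 V x"
    and "\<And>V c. V \<in> P \<Longrightarrow> c \<in> carrier (C1 V) \<Longrightarrow> r' V (c1 V c) = c1 V (r \<odot>\<^bsub>C1 V\<^esub> c)"
  shows "r' \<in> carrier E \<and> q r' = r"
proof
  have int: "intertwines R K \<phi> \<mu> r' r" using assms by (simp add: intertwines_def)
  have "r' \<in> nat_trans R \<Z> CI CI" unfolding nat_trans_CI using assms by simp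
  then show "r' \<in> carrier E" using int assms(6) by (auto simp: ext_carrier)
  show "q r' = r"
    unfolding ext_proj_def
    using intertwines_unique[of r', OF assms(3)[OF U_proj]] int assms(6) by (intro the_equality) auto
qed

lemma ext:
  assumes "r' \<in> carrier E"
  shows ext_extensional: "r' \<in> extensional P"
    and ext_extensional': "V \<in> P \<Longrightarrow> r' V \<in> extensional (carrier (G V))"
    and ext_closed: "V \<in> P \<Longrightarrow> x \<in> carrier (G V) \<Longrightarrow> r' V x \<in> carrier (G V)"
    and ext_add: "V \<in> P \<Longrightarrow> x \<in> carrier (G V) \<Longrightarrow> y \<in> carrier (G V) \<Longrightarrow>
      r' V (x \<oplus>\<^bsub>G V\<^esub> y) = r' V x \<oplus>\<^bsub>G V\<^esub> r' V y"
    and ext_nat: "V \<in> P \<Longrightarrow> W \<in> P \<Longrightarrow> f \<in> mod_hom R V W \<Longrightarrow> x \<in> carrier (G V) \<Longrightarrow>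
      r' W (AG V W f x) = AG V W f (r' V x)"
    and q_closed: "q r' \<in> carrier R"
    and c0_ext: "V \<in> P \<Longrightarrow> x \<in> carrier (G V) \<Longrightarrow> c0 V (r' V x) = q r' \<odot>\<^bsub>C0 V\<^esub> c0 V x"
    and ext_c1: "V \<in> P \<Longrightarrow> c \<in> carrier (C1 V) \<Longrightarrow> r' V (c1 V c) = c1 V (q r' \<odot>\<^bsub>C1 V\<^esub> c)"
proof -
  have r': "r' \<in> nat_trans R \<Z> CI CI" and ex: "\<exists>r\<in>carrier R. intertwines R K \<phi> \<mu> r' r"
    using assms by (simp_all add: ext_carrier)
  note n = r'[unfolded nat_trans_CI]
  show "r' \<in> extensional P" "V \<in> P \<Longrightarrow> r' V \<in> extensional (carrier (G V))"
    "V \<in> P \<Longrightarrow> x \<in> carrier (G V) \<Longrightarrow> r' V x \<in> carrier (G V)"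
    "V \<in> P \<Longrightarrow> x \<in> carrier (G V) \<Longrightarrow> y \<in> carrier (G V) \<Longrightarrow> r' V (x \<oplus>\<^bsub>G V\<^esub> y) = r' V x \<oplus>\<^bsub>G V\<^esub> r' V y"
    "V \<in> P \<Longrightarrow> W \<in> P \<Longrightarrow> f \<in> mod_hom R V W \<Longrightarrow> x \<in> carrier (G V) \<Longrightarrow> r' W (AG V W f x) = AG V W f (r' V x)"
    using n by blast+
  obtain r where r: "r \<in> carrier R" "intertwines R K \<phi> \<mu> r' r" using ex by blast
  have "q r' = r"
    unfolding ext_proj_def using n r U_proj intertwines_unique[of r'] by (intro the_equality) auto
  then show "q r' \<in> carrier R" "V \<in> P \<Longrightarrow> x \<in> carrier (G V) \<Longrightarrow> c0 V (r' V x) = q r' \<odot>\<^bsub>C0 V\<^esub> c0 V x"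
    "V \<in> P \<Longrightarrow> c \<in> carrier (C1 V) \<Longrightarrow> r' V (c1 V c) = c1 V (q r' \<odot>\<^bsub>C1 V\<^esub> c)"
    using r by (simp_all add: intertwines_def)
qed

lemma ext_eqI:
  assumes "r' \<in> carrier E" "r'' \<in> carrier E" "\<And>V x. V \<in> P \<Longrightarrow> x \<in> carrier (G V) \<Longrightarrow> r' V x = r'' V x"
  shows "r' = r''"
proof (rule extensionalityI[OF ext_extensional[OF assms(1)] ext_extensional[OF assms(2)]])
  show "r' V = r'' V" if "V \<in> P" for V
    by (rule extensionalityI[OF ext_extensional'[OF assms(1) that] ext_extensional'[OF assms(2) that] assms(3)[OF that]])
qed

subsection \<open>The ring structure\<close>

lemma ext_ring_simps:
  assumes "V \<in> P" "x \<in> carrier (G V)"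
  shows "(r' \<oplus>\<^bsub>E\<^esub> r'') V x = r' V x \<oplus>\<^bsub>G V\<^esub> r'' V x"
    and "(r' \<otimes>\<^bsub>E\<^esub> r'') V x = r' V (r'' V x)"
    and "\<zero>\<^bsub>E\<^esub> V x = \<zero>\<^bsub>G V\<^esub>" and "\<one>\<^bsub>E\<^esub> V x = x"
  using assms by (simp_all add: ext_ring_def Let_def)

lemma ext_ring_ext:
  "r' \<oplus>\<^bsub>E\<^esub> r'' \<in> extensional P" "V \<in> P \<Longrightarrow> (r' \<oplus>\<^bsub>E\<^esub> r'') V \<in> extensional (carrier (G V))"
  "r' \<otimes>\<^bsub>E\<^esub> r'' \<in> extensional P" "V \<in> P \<Longrightarrow> (r' \<otimes>\<^bsub>E\<^esub> r'') V \<in> extensional (carrier (G V))"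
  "\<zero>\<^bsub>E\<^esub> \<in> extensional P" "V \<in> P \<Longrightarrow> \<zero>\<^bsub>E\<^esub> V \<in> extensional (carrier (G V))"
  "\<one>\<^bsub>E\<^esub> \<in> extensional P" "V \<in> P \<Longrightarrow> \<one>\<^bsub>E\<^esub> V \<in> extensional (carrier (G V))"
  by (simp_all add: ext_ring_def Let_def)

lemma G_zero: "V \<in> P \<Longrightarrow> c1 V \<zero>\<^bsub>C1 V\<^esub> = \<zero>\<^bsub>G V\<^esub>" "V \<in> P \<Longrightarrow> c0 V \<zero>\<^bsub>G V\<^esub> = \<zero>\<^bsub>C0 V\<^esub>"
proof -
  assume V: "V \<in> P"
  show "c1 V \<zero>\<^bsub>C1 V\<^esub> = \<zero>\<^bsub>G V\<^esub>"
    by (rule additive_zero[OF C1_abelian[OF V] G_abelian[OF V]]) (simp_all add: V c1_closed c1_add)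
  show "c0 V \<zero>\<^bsub>G V\<^esub> = \<zero>\<^bsub>C0 V\<^esub>"
    by (rule additive_zero[OF G_abelian[OF V] C0_abelian[OF V]]) (simp_all add: V c0_closed c0_add)
qed

lemma AG_zero: "V \<in> P \<Longrightarrow> W \<in> P \<Longrightarrow> f \<in> mod_hom R V W \<Longrightarrow> AG V W f \<zero>\<^bsub>G V\<^esub> = \<zero>\<^bsub>G W\<^esub>"
  by (rule additive_zero[OF G_abelian G_abelian]) (simp_all add: AG_closed AG_add)

lemma ext_add_mem:
  assumes "r' \<in> carrier E" "r'' \<in> carrier E"
  shows ext_add_closed: "r' \<oplus>\<^bsub>E\<^esub> r'' \<in> carrier E" and q_add: "q (r' \<oplus>\<^bsub>E\<^esub> r'') = q r' \<oplus>\<^bsub>R\<^esub> q r''"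
proof -
  note a = ext[OF assms(1)] and b = ext[OF assms(2)]
  have Gc: "x \<oplus>\<^bsub>G V\<^esub> y \<in> carrier (G V)" if "V \<in> P" "x \<in> carrier (G V)" "y \<in> carrier (G V)" for V x y
  proof -
    interpret G: abelian_group "G V" by (rule G_abelian[OF that(1)])
    show ?thesis using that by simp
  qed
  have "r' \<oplus>\<^bsub>E\<^esub> r'' \<in> carrier E \<and> q (r' \<oplus>\<^bsub>E\<^esub> r'') = q r' \<oplus>\<^bsub>R\<^esub> q r''"
  proof (rule extI; (intro ext_ring_ext; assumption)?)
    fix V x y assume V: "V \<in> P" and x: "x \<in> carrier (G V)" and y: "y \<in> carrier (G V)"
    interpret G: abelian_group "G V" by (rule G_abelian[OF V])
    show "(r' \<oplus>\<^bsub>E\<^esub> r'') V (x \<oplus>\<^bsub>G V\<^esub> y) = (r' \<oplus>\<^bsub>E\<^esub> r'') V x \<oplus>\<^bsub>G V\<^esub> (r' \<oplus>\<^bsub>E\<^esub> r'') V y"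
      using V x y a(3) b(3) by (simp add: ext_ring_simps a(4) b(4) G.a_ac)
  next
    fix V x assume V: "V \<in> P" and x: "x \<in> carrier (G V)"
    interpret C0: module R "C0 V" by (rule C0_module[OF V])
    show "c0 V ((r' \<oplus>\<^bsub>E\<^esub> r'') V x) = (q r' \<oplus>\<^bsub>R\<^esub> q r'') \<odot>\<^bsub>C0 V\<^esub> c0 V x"
      using V x a b by (simp add: ext_ring_simps c0_add C0.smult_l_distr c0_closed)
  next
    fix V c assume V: "V \<in> P" and c: "c \<in> carrier (C1 V)"
    interpret C1: module R "C1 V" by (rule C1_module[OF V])
    show "(r' \<oplus>\<^bsub>E\<^esub> r'') V (c1 V c) = c1 V ((q r' \<oplus>\<^bsub>R\<^esub> q r'') \<odot>\<^bsub>C1 V\<^esub> c)"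
      using V c a b by (simp add: ext_ring_simps c1_closed c1_add C1.smult_l_distr)
  qed (simp_all add: ext_ring_simps a b AG_closed AG_add Gc)
  then show "r' \<oplus>\<^bsub>E\<^esub> r'' \<in> carrier E" "q (r' \<oplus>\<^bsub>E\<^esub> r'') = q r' \<oplus>\<^bsub>R\<^esub> q r''" by simp_all
qed

lemma ext_mult_mem:
  assumes "r' \<in> carrier E" "r'' \<in> carrier E"
  shows ext_mult_closed: "r' \<otimes>\<^bsub>E\<^esub> r'' \<in> carrier E" and q_mult: "q (r' \<otimes>\<^bsub>E\<^esub> r'') = q r' \<otimes>\<^bsub>R\<^esub> q r''"
proof -
  note a = ext[OF assms(1)] and b = ext[OF assms(2)]
  have Gc: "x \<oplus>\<^bsub>G V\<^esub> y \<in> carrier (G V)" if "V \<in> P" "x \<in> carrier (G V)" "y \<in> carrier (G V)" for V x y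
  proof -
    interpret G: abelian_group "G V" by (rule G_abelian[OF that(1)])
    show ?thesis using that by simp
  qed
  have "r' \<otimes>\<^bsub>E\<^esub> r'' \<in> carrier E \<and> q (r' \<otimes>\<^bsub>E\<^esub> r'') = q r' \<otimes>\<^bsub>R\<^esub> q r''"
  proof (rule extI; (intro ext_ring_ext; assumption)?)
    fix V x assume V: "V \<in> P" and x: "x \<in> carrier (G V)"
    interpret C0: module R "C0 V" by (rule C0_module[OF V])
    show "c0 V ((r' \<otimes>\<^bsub>E\<^esub> r'') V x) = (q r' \<otimes>\<^bsub>R\<^esub> q r'') \<odot>\<^bsub>C0 V\<^esub> c0 V x"
      using V x a b by (simp add: ext_ring_simps C0.smult_assoc1 c0_closed)
  next
    fix V c assume V: "V \<in> P" and c: "c \<in> carrier (C1 V)"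
    interpret C1: module R "C1 V" by (rule C1_module[OF V])
    show "(r' \<otimes>\<^bsub>E\<^esub> r'') V (c1 V c) = c1 V ((q r' \<otimes>\<^bsub>R\<^esub> q r'') \<odot>\<^bsub>C1 V\<^esub> c)"
      using V c a b by (simp add: ext_ring_simps c1_closed C1.smult_assoc1)
  qed (simp_all add: ext_ring_simps a b AG_closed Gc)
  then show "r' \<otimes>\<^bsub>E\<^esub> r'' \<in> carrier E" "q (r' \<otimes>\<^bsub>E\<^esub> r'') = q r' \<otimes>\<^bsub>R\<^esub> q r''" by simp_all
qed

lemma ext_zero_closed: "\<zero>\<^bsub>E\<^esub> \<in> carrier E"
proof -
  have "\<zero>\<^bsub>E\<^esub> \<in> carrier E \<and> q \<zero>\<^bsub>E\<^esub> = \<zero>\<^bsub>R\<^esub>"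
  proof (rule extI; (intro ext_ring_ext; assumption)?)
    fix V x y assume V: "V \<in> P" and x: "x \<in> carrier (G V)" "y \<in> carrier (G V)"
    interpret G: abelian_group "G V" by (rule G_abelian[OF V])
    show "\<zero>\<^bsub>E\<^esub> V x \<in> carrier (G V)" "\<zero>\<^bsub>E\<^esub> V (x \<oplus>\<^bsub>G V\<^esub> y) = \<zero>\<^bsub>E\<^esub> V x \<oplus>\<^bsub>G V\<^esub> \<zero>\<^bsub>E\<^esub> V y"
      using V x by (simp_all add: ext_ring_simps)
  next
    fix V x assume V: "V \<in> P" and x: "x \<in> carrier (G V)"
    interpret C0: module R "C0 V" by (rule C0_module[OF V])
    show "c0 V (\<zero>\<^bsub>E\<^esub> V x) = \<zero>\<^bsub>R\<^esub> \<odot>\<^bsub>C0 V\<^esub> c0 V x"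
      using V x by (simp add: ext_ring_simps G_zero c0_closed)
  next
    fix V c assume V: "V \<in> P" and c: "c \<in> carrier (C1 V)"
    interpret C1: module R "C1 V" by (rule C1_module[OF V])
    show "\<zero>\<^bsub>E\<^esub> V (c1 V c) = c1 V (\<zero>\<^bsub>R\<^esub> \<odot>\<^bsub>C1 V\<^esub> c)"
      using V c by (simp add: ext_ring_simps c1_closed G_zero)
  qed (simp_all add: ext_ring_simps AG_closed AG_zero abelian_groupE(2)[OF G_abelian])
  then show ?thesis by simp
qed

lemma ext_one_mem:
  shows ext_one_closed: "\<one>\<^bsub>E\<^esub> \<in> carrier E" and q_one: "q \<one>\<^bsub>E\<^esub> = \<one>\<^bsub>R\<^esub>"
proof -
  have "\<one>\<^bsub>E\<^esub> \<in> carrier E \<and> q \<one>\<^bsub>E\<^esub> = \<one>\<^bsub>R\<^esub>"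
  proof (rule extI; (intro ext_ring_ext; assumption)?)
    fix V x assume V: "V \<in> P" and x: "x \<in> carrier (G V)"
    interpret C0: module R "C0 V" by (rule C0_module[OF V])
    show "c0 V (\<one>\<^bsub>E\<^esub> V x) = \<one>\<^bsub>R\<^esub> \<odot>\<^bsub>C0 V\<^esub> c0 V x"
      using V x by (simp add: ext_ring_simps c0_closed)
  next
    fix V c assume V: "V \<in> P" and c: "c \<in> carrier (C1 V)"
    interpret C1: module R "C1 V" by (rule C1_module[OF V])
    show "\<one>\<^bsub>E\<^esub> V (c1 V c) = c1 V (\<one>\<^bsub>R\<^esub> \<odot>\<^bsub>C1 V\<^esub> c)"
      using V c by (simp add: ext_ring_simps c1_closed)
  qed (simp_all add: ext_ring_simps AG_closed abelian_groupE(1)[OF G_abelian])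
  then show "\<one>\<^bsub>E\<^esub> \<in> carrier E" "q \<one>\<^bsub>E\<^esub> = \<one>\<^bsub>R\<^esub>" by simp_all
qed

lemma ext_neg_mem:
  assumes r': "r' \<in> carrier E"
  shows "(\<lambda>V\<in>P. \<lambda>x\<in>carrier (G V). \<ominus>\<^bsub>G V\<^esub> r' V x) \<in> carrier E" (is "?n \<in> _")
proof (rule conjunct1[OF extI[where r = "\<ominus>\<^bsub>R\<^esub> q r'"]])
  note a = ext[OF r']
  show "\<ominus>\<^bsub>R\<^esub> q r' \<in> carrier R" using a by simp
  fix V x y assume V: "V \<in> P" and x: "x \<in> carrier (G V)" and y: "y \<in> carrier (G V)"
  interpret G: abelian_group "G V" by (rule G_abelian[OF V])
  show "?n V (x \<oplus>\<^bsub>G V\<^esub> y) = ?n V x \<oplus>\<^bsub>G V\<^esub> ?n V y"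
    using V x y a by (simp add: G.minus_add)
  show "?n W (AG V W f x) = AG V W f (?n V x)" if W: "W \<in> P" and f: "f \<in> mod_hom R V W" for W f
    using V x W f a
      additive_neg[where f = "AG V W f", OF G_abelian[OF V] G_abelian[OF W] AG_closed[OF V W f] AG_add[OF V W f] a(3)[OF V x]]
    by (simp add: AG_closed)
  interpret C0: module R "C0 V" by (rule C0_module[OF V])
  show "c0 V (?n V x) = \<ominus>\<^bsub>R\<^esub> q r' \<odot>\<^bsub>C0 V\<^esub> c0 V x"
    using V x a additive_neg[where f = "c0 V", OF G_abelian[OF V] C0_abelian[OF V] c0_closed[OF V] c0_add[OF V] a(3)[OF V x]]
    by (simp add: C0.smult_l_minus c0_closed)
next
  note a = ext[OF r']
  fix V c assume V: "V \<in> P" and c: "c \<in> carrier (C1 V)"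
  interpret C1: module R "C1 V" by (rule C1_module[OF V])
  show "?n V (c1 V c) = c1 V (\<ominus>\<^bsub>R\<^esub> q r' \<odot>\<^bsub>C1 V\<^esub> c)"
    using V c a additive_neg[where f = "c1 V", OF C1_abelian[OF V] G_abelian[OF V] c1_closed[OF V] c1_add[OF V], of "q r' \<odot>\<^bsub>C1 V\<^esub> c"]
    by (simp add: C1.smult_l_minus c1_closed)
next
  fix V x assume V: "V \<in> P" and x: "x \<in> carrier (G V)"
  interpret G: abelian_group "G V" by (rule G_abelian[OF V])
  show "?n V x \<in> carrier (G V)" using V x ext[OF r'] by simp
qed simp_all

lemma ext_ring: "ring E"
proof (rule ringI)
  have G: "x \<oplus>\<^bsub>G V\<^esub> y \<in> carrier (G V)" "x \<oplus>\<^bsub>G V\<^esub> y = y \<oplus>\<^bsub>G V\<^esub> x" "\<zero>\<^bsub>G V\<^esub> \<oplus>\<^bsub>G V\<^esub> x = x"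
      "\<ominus>\<^bsub>G V\<^esub> x \<oplus>\<^bsub>G V\<^esub> x = \<zero>\<^bsub>G V\<^esub>"
    if "V \<in> P" "x \<in> carrier (G V)" "y \<in> carrier (G V)" for V x y
  proof -
    interpret G: abelian_group "G V" by (rule G_abelian[OF that(1)])
    show "x \<oplus>\<^bsub>G V\<^esub> y \<in> carrier (G V)" "x \<oplus>\<^bsub>G V\<^esub> y = y \<oplus>\<^bsub>G V\<^esub> x" "\<zero>\<^bsub>G V\<^esub> \<oplus>\<^bsub>G V\<^esub> x = x"
      "\<ominus>\<^bsub>G V\<^esub> x \<oplus>\<^bsub>G V\<^esub> x = \<zero>\<^bsub>G V\<^esub>"
      using that G.a_comm[of x y] by (simp_all add: G.l_neg)
  qed
  have Ga: "x \<oplus>\<^bsub>G V\<^esub> y \<oplus>\<^bsub>G V\<^esub> z = x \<oplus>\<^bsub>G V\<^esub> (y \<oplus>\<^bsub>G V\<^esub> z)"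
    if "V \<in> P" "x \<in> carrier (G V)" "y \<in> carrier (G V)" "z \<in> carrier (G V)" for V x y z
    using abelian_groupE(3)[OF G_abelian[OF that(1)] that(2-4)] .
  note c = ext_add_closed ext_mult_closed ext_zero_closed ext_one_closed
  show "abelian_group E"
  proof (rule abelian_groupI)
    fix x assume x: "x \<in> carrier E"
    show "\<exists>y\<in>carrier E. y \<oplus>\<^bsub>E\<^esub> x = \<zero>\<^bsub>E\<^esub>"
      using ext_neg_mem[OF x]
      by (rule bexI[rotated]) (rule ext_eqI, simp_all add: c x ext_neg_mem ext_ring_simps G(4) ext[OF x])
  next
    fix x y assume x: "x \<in> carrier E" and y: "y \<in> carrier E"
    show "x \<oplus>\<^bsub>E\<^esub> y = y \<oplus>\<^bsub>E\<^esub> x"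
      by (rule ext_eqI) (simp_all add: c x y ext_ring_simps G(2) ext[OF x] ext[OF y])
  next
    fix x y z assume x: "x \<in> carrier E" and y: "y \<in> carrier E" and z: "z \<in> carrier E"
    show "x \<oplus>\<^bsub>E\<^esub> y \<oplus>\<^bsub>E\<^esub> z = x \<oplus>\<^bsub>E\<^esub> (y \<oplus>\<^bsub>E\<^esub> z)"
      by (rule ext_eqI) (simp_all add: c x y z ext_ring_simps Ga ext[OF x] ext[OF y] ext[OF z])
  next
    fix x assume x: "x \<in> carrier E"
    show "\<zero>\<^bsub>E\<^esub> \<oplus>\<^bsub>E\<^esub> x = x"
      by (rule ext_eqI) (simp_all add: c x ext_ring_simps G(3) ext[OF x])
  qed (simp_all add: c)
  show "Group.monoid E"
  proof (rule monoidI)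
    fix x y z assume x: "x \<in> carrier E" and y: "y \<in> carrier E" and z: "z \<in> carrier E"
    show "x \<otimes>\<^bsub>E\<^esub> y \<otimes>\<^bsub>E\<^esub> z = x \<otimes>\<^bsub>E\<^esub> (y \<otimes>\<^bsub>E\<^esub> z)"
      by (rule ext_eqI) (simp_all add: c x y z ext_ring_simps ext[OF x] ext[OF y] ext[OF z])
  next
    fix x assume x: "x \<in> carrier E"
    show "\<one>\<^bsub>E\<^esub> \<otimes>\<^bsub>E\<^esub> x = x" "x \<otimes>\<^bsub>E\<^esub> \<one>\<^bsub>E\<^esub> = x"
      by (rule ext_eqI; simp add: c x ext_ring_simps ext[OF x])+
  qed (simp_all add: c)
  fix x y z assume x: "x \<in> carrier E" and y: "y \<in> carrier E" and z: "z \<in> carrier E"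
  show "(x \<oplus>\<^bsub>E\<^esub> y) \<otimes>\<^bsub>E\<^esub> z = x \<otimes>\<^bsub>E\<^esub> z \<oplus>\<^bsub>E\<^esub> y \<otimes>\<^bsub>E\<^esub> z"
    by (rule ext_eqI) (simp_all add: c x y z ext_ring_simps ext[OF x] ext[OF y] ext[OF z])
  show "z \<otimes>\<^bsub>E\<^esub> (x \<oplus>\<^bsub>E\<^esub> y) = z \<otimes>\<^bsub>E\<^esub> x \<oplus>\<^bsub>E\<^esub> z \<otimes>\<^bsub>E\<^esub> y"
    by (rule ext_eqI) (simp_all add: c x y z ext_ring_simps ext[OF x] ext[OF y] ext[OF z])
qed

lemma q_hom: "q \<in> ring_hom E R"
  by (rule ring_hom_memI) (simp_all add: q_closed q_mult q_add q_one)

subsection \<open>The inclusion of the bimodule\<close>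

lemma bimodule_tensor_M: "V \<in> P \<Longrightarrow> bimodule_tensor R M V"
  by (intro bimodule_tensor.intro bimodule proj_module)

lemmas me_closed = bimodule_tensor.elem_closed[OF bimodule_tensor_M]
lemmas me_add_left = bimodule_tensor.elem_add_left[OF bimodule_tensor_M]
lemmas me_add_right = bimodule_tensor.elem_add_right[OF bimodule_tensor_M]
lemmas me_zero_right = bimodule_tensor.elem_zero_right[OF bimodule_tensor_M]
lemmas me_smult = bimodule_tensor.smult_elem[OF bimodule_tensor_M]
lemmas me_balanced = bimodule_tensor.elem_balanced[OF bimodule_tensor_M]

lemma i_eq:
  assumes "V \<in> P" "x \<in> carrier (G V)"
  shows "i m V x = c1 V (b V (me V m (a V (c0 V x))))"
  using assms by (simp add: ext_incl_def)

lemma i_mem: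
  assumes m: "m \<in> carrier M"
  shows i_closed: "i m \<in> carrier E" and q_i: "q (i m) = \<zero>\<^bsub>R\<^esub>"
proof -
  have "i m \<in> carrier E \<and> q (i m) = \<zero>\<^bsub>R\<^esub>"
  proof (rule extI)
    fix V x y assume V: "V \<in> P" and x: "x \<in> carrier (G V)" and y: "y \<in> carrier (G V)"
    interpret G: abelian_group "G V" by (rule G_abelian[OF V])
    show "i m V (x \<oplus>\<^bsub>G V\<^esub> y) = i m V x \<oplus>\<^bsub>G V\<^esub> i m V y"
      using V x y m
      by (simp add: i_eq c0_add c0_closed mod_hom_add[OF a_hom] a_closed me_add_right me_closed
          mod_hom_add[OF b_hom] b_closed c1_add)
  next
    fix V x assume V: "V \<in> P" and x: "x \<in> carrier (G V)"
    show "i m V x \<in> carrier (G V)"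
      using V x m by (simp add: i_eq c1_closed b_closed me_closed a_closed c0_closed)
    show "i m W (AG V W f x) = AG V W f (i m V x)" if W: "W \<in> P" and f: "f \<in> mod_hom R V W" for W f
      using V x W f m
      by (simp add: i_eq AG_closed AG_c0 AG_c1 b_closed me_closed a_closed c0_closed a_nat[symmetric] b_nat[symmetric]
          tensor_functor_elem[OF bimodule] proj_module)
    interpret C0: module R "C0 V" by (rule C0_module[OF V])
    show "c0 V (i m V x) = \<zero>\<^bsub>R\<^esub> \<odot>\<^bsub>C0 V\<^esub> c0 V x"
      using V x m by (simp add: i_eq c0_c1 b_closed me_closed a_closed c0_closed db)
  next
    fix V c assume V: "V \<in> P" and c: "c \<in> carrier (C1 V)"
    interpret C1: module R "C1 V" by (rule C1_module[OF V])
    show "i m V (c1 V c) = c1 V (\<zero>\<^bsub>R\<^esub> \<odot>\<^bsub>C1 V\<^esub> c)"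
      using V c m by (simp add: i_eq c1_closed c0_c1 ad me_zero_right mod_hom_zero[OF b_hom] TM_module C1_module)
  qed (simp_all add: ext_incl_def)
  then show "i m \<in> carrier E" "q (i m) = \<zero>\<^bsub>R\<^esub>" by simp_all
qed

lemma M_module: "module R M"
  using bimodule by (rule is_bimoduleD)

lemma i_add:
  assumes "m \<in> carrier M" "n \<in> carrier M"
  shows "i (m \<oplus>\<^bsub>M\<^esub> n) = i m \<oplus>\<^bsub>E\<^esub> i n"
proof -
  interpret M: module R M by (rule M_module)
  show ?thesis
    by (rule ext_eqI)
      (simp_all add: assms i_closed ext_add_closed ext_ring_simps i_eq a_closed c0_closed me_add_left me_closed
          mod_hom_add[OF b_hom] b_closed c1_add)
qed

text \<open>\<open>M \<otimes> R \<cong> M\<close>, for the unit object in place of \<open>R\<close>.\<close>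

lemma me_u_inj:
  assumes "m \<in> carrier M" "n \<in> carrier M" "me U m u = me U n u"
  shows "m = n"
proof -
  interpret M: module R M by (rule M_module)
  interpret X: bimodule_tensor R M U by (rule bimodule_tensor_M[OF U_proj])
  note B = is_bimoduleD[OF bimodule]
  obtain h where h: "\<And>m v. m \<in> carrier M \<Longrightarrow> v \<in> carrier U \<Longrightarrow> h (me U m v) = rsmult M m (coord v)"
  proof (rule X.tensor_universal[OF M.abelian_group_axioms, of "\<lambda>m v. rsmult M m (coord v)"])
    fix h assume "\<And>m v. m \<in> carrier M \<Longrightarrow> v \<in> carrier U \<Longrightarrow> h (me U m v) = rsmult M m (coord v)"
    then show thesis by (rule that)
  qed (simp_all add: B(2-5) coord_closed coord_add coord_smult)
  have "m = h (me U m u)" using h[OF assms(1) u_closed] B(6)[OF assms(1)] by (simp add: coord_u)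
  also have "\<dots> = h (me U n u)" by (simp only: assms(3))
  also have "\<dots> = n" using h[OF assms(2) u_closed] B(6)[OF assms(2)] by (simp add: coord_u)
  finally show ?thesis .
qed

lemma me_u_surj:
  assumes "\<tau> \<in> carrier (TM U)"
  shows "\<exists>m\<in>carrier M. \<tau> = me U m u"
proof -
  interpret M: module R M by (rule M_module)
  interpret X: bimodule_tensor R M U by (rule bimodule_tensor_M[OF U_proj])
  note B = is_bimoduleD[OF bimodule]
  show ?thesis
    using assms
  proof (induction rule: X.tensor_induct)
    case (elem m v)
    then have "me U m v = me U (rsmult M m (coord v)) u"
      using me_balanced[OF U_proj elem(1) coord_closed[OF elem(2)] u_closed] by (simp add: coord_eq)
    then show ?case using B(2)[OF elem(1) coord_closed[OF elem(2)]] by blast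
  next
    case (add x y)
    then show ?case by (metis M.a_closed X.elem_add_left u_closed)
  qed
qed

lemma i_inj: "inj_on i (carrier M)"
proof (rule inj_onI)
  fix m n assume mn: "m \<in> carrier M" "n \<in> carrier M" "i m = i n"
  interpret C1: abelian_group "C1 U" by (rule C1_abelian[OF U_proj])
  let ?x = "(\<zero>\<^bsub>C1 U\<^esub>, u)"
  have x: "?x \<in> carrier (G U)" using u_closed by (simp add: G_simps)
  have "i m U ?x = i n U ?x" using mn by simp
  then have "b U (me U m u) = b U (me U n u)"
    using mn(1,2) by (simp add: i_eq U_proj x a_c0 u_closed c1_eq b_closed me_closed)
  then have "me U m u = me U n u"
    using inj_onD[OF b_inj[OF U_proj]] me_closed[OF U_proj] mn(1,2) u_closed by blast
  then show "m = n" by (rule me_u_inj[OF mn(1,2)])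
qed

text \<open>
  The map \<open>v\<close> sends \<open>(0, u)\<close> to \<open>(0, v)\<close>. An element of the ring is therefore determined by its image in \<open>R\<close>
  and its value on \<open>(0, u)\<close>.
\<close>

lemma ext_at_point:
  assumes "r' \<in> carrier E" "V \<in> P" "v \<in> carrier V"
  shows "r' V (\<zero>\<^bsub>C1 V\<^esub>, v) = AG U V (point R K V v) (r' U (\<zero>\<^bsub>C1 U\<^esub>, u))"
proof -
  interpret C1: abelian_group "C1 U" by (rule C1_abelian[OF U_proj])
  note pt = point_hom[OF assms(2,3)]
  have x: "(\<zero>\<^bsub>C1 U\<^esub>, u) \<in> carrier (G U)" using u_closed by (simp add: G_simps)
  have "AG U V (point R K V v) (\<zero>\<^bsub>C1 U\<^esub>, u) = (\<zero>\<^bsub>C1 V\<^esub>, v)"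
    using assms u_closed by (simp add: AG_eq point_u mod_hom_zero[OF A1_hom[OF U_proj assms(2) pt]] C1_module U_proj)
  then show ?thesis using ext_nat[OF assms(1) U_proj assms(2) pt x] by simp
qed

lemma ext_decompose:
  assumes "r' \<in> carrier E" "V \<in> P" "c \<in> carrier (C1 V)" "v \<in> carrier V"
  shows "r' V (c, v) = c1 V (q r' \<odot>\<^bsub>C1 V\<^esub> c) \<oplus>\<^bsub>G V\<^esub> r' V (\<zero>\<^bsub>C1 V\<^esub>, v)"
proof -
  interpret C1: abelian_group "C1 V" by (rule C1_abelian[OF assms(2)])
  have "(\<zero>\<^bsub>C1 V\<^esub>, v) \<in> carrier (G V)" using assms by (simp add: G_simps)
  then show ?thesis using assms G_decompose[OF assms(2-4)] ext_add[OF assms(1)] by (simp add: c1_closed ext_c1)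
qed

text \<open>
  If \<open>r'\<close> lies over 0, then \<open>r'(0, u)\<close> lies in the kernel \<open>M \<otimes> R\<close> of \<open>c\<^sub>0\<close>, hence has the form \<open>m \<otimes> u\<close>; by naturality
  \<open>r'\<close> is \<open>(c, v) \<mapsto> m \<otimes> v\<close>.
\<close>

lemma i_image: "i ` carrier M = {x \<in> carrier E. q x = \<zero>\<^bsub>R\<^esub>}"
proof (intro equalityI subsetI)
  show "x \<in> {x \<in> carrier E. q x = \<zero>\<^bsub>R\<^esub>}" if "x \<in> i ` carrier M" for x
    using that by (auto simp: i_closed q_i)
next
  fix r' assume "r' \<in> {x \<in> carrier E. q x = \<zero>\<^bsub>R\<^esub>}"
  then have r': "r' \<in> carrier E" and q0: "q r' = \<zero>\<^bsub>R\<^esub>" by auto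
  interpret C1U: abelian_group "C1 U" by (rule C1_abelian[OF U_proj])
  interpret C0U: module R "C0 U" by (rule C0_module[OF U_proj])
  let ?x = "(\<zero>\<^bsub>C1 U\<^esub>, u)"
  have x: "?x \<in> carrier (G U)" using u_closed by (simp add: G_simps)
  have "c0 U (r' U ?x) = \<zero>\<^bsub>C0 U\<^esub>"
    using c0_ext[OF r' U_proj x] by (simp add: q0 c0_closed U_proj x)
  then obtain \<tau> where \<tau>: "\<tau> \<in> carrier (TM U)" "r' U ?x = c1 U (b U \<tau>)"
    using c0_kernel[OF U_proj ext_closed[OF r' U_proj x]] by blast
  then obtain m where m: "m \<in> carrier M" "\<tau> = me U m u" using me_u_surj by blast
  have "r' = i m"
  proof (rule ext_eqI[OF r' i_closed[OF m(1)]])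
    fix V x assume V: "V \<in> P" and x: "x \<in> carrier (G V)"
    obtain c v where cv: "x = (c, v)" "c \<in> carrier (C1 V)" "v \<in> carrier V" using x by (rule G_cases)
    interpret C1: module R "C1 V" by (rule C1_module[OF V])
    interpret G: abelian_group "G V" by (rule G_abelian[OF V])
    have "r' V (\<zero>\<^bsub>C1 V\<^esub>, v) = c1 V (b V (me V m v))"
      using V cv m \<tau>(1) u_closed
      by (simp add: ext_at_point[OF r' V cv(3)] \<tau> AG_c1 U_proj point_hom b_closed b_nat[symmetric]
          tensor_functor_elem[OF bimodule] proj_module point_u)
    then show "r' V x = i m V x"
      using V x cv m by (simp add: i_eq ext_decompose[OF r' V cv(2,3)] a_c0 q0 G_zero c1_closed b_closed me_closed)
  qed
  then show "r' \<in> i ` carrier M" using m by blast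
qed

subsection \<open>Surjectivity of the projection\<close>

text \<open>
  The element \<open>r s - s(r u)\<close> of \<open>C\<^sub>0(R)\<close> is killed by the augmentation; a lift to \<open>C\<^sub>1(R)\<close> yields a natural
  map \<open>g : V \<rightarrow> C\<^sub>1(V)\<close>, and \<open>(c, v) \<mapsto> (r c + g(v), r v)\<close> lies over \<open>r\<close>. It is additive because the
  two sides of the required identity are natural in two variables, have the same differential and
  agree on the axes.
\<close>

lemma q_surj:
  assumes r: "r \<in> carrier R"
  shows "\<exists>r'\<in>carrier E. q r' = r"
proof -
  interpret U: module R U by (rule proj_module[OF U_proj])
  interpret C0U: module R "C0 U" by (rule C0_module[OF U_proj])
  have ru: "r \<odot>\<^bsub>U\<^esub> u \<in> carrier U" using r u_closed by simp
  have y: "r \<odot>\<^bsub>C0 U\<^esub> s \<ominus>\<^bsub>C0 U\<^esub> st U (r \<odot>\<^bsub>U\<^esub> u) \<in> carrier (C0 U)" (is "?y \<in> _")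
    using r s_closed ru by (simp add: st_closed U_proj)
  have "a U ?y = \<zero>\<^bsub>U\<^esub>"
    using r s_closed ru
    by (simp add: mod_hom_diff[OF a_hom] U_proj C0_module U.module_axioms st_closed mod_hom_smult[OF a_hom] a_s a_st
        U.add_diff_self)
  then obtain g0 where g0: "g0 \<in> carrier (C1 U)" "d U g0 = ?y" using ker_a_obtain[OF U_proj y] by blast
  define g where "g V v = A1 U V (point R K V v) g0" for V v
  have g: "g V v \<in> carrier (C1 V)" if "V \<in> P" "v \<in> carrier V" for V v
    using that g0 by (simp add: g_def A1_closed U_proj point_hom)
  have g_nat: "A1 V W f (g V v) = g W (f v)" if "V \<in> P" "W \<in> P" "f \<in> mod_hom R V W" "v \<in> carrier V" for V W f v
    using A1_comp[OF U_proj that(1,2) point_hom[OF that(1,4)] that(3) g0(1)] by (simp add: g_def point_comp[OF that])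
  have d_g: "d V (g V v) = r \<odot>\<^bsub>C0 V\<^esub> st V v \<ominus>\<^bsub>C0 V\<^esub> st V (r \<odot>\<^bsub>V\<^esub> v)" if V: "V \<in> P" "v \<in> carrier V" for V v
  proof -
    note pt = point_hom[OF V]
    have "d V (g V v) = A0 U V (point R K V v) ?y"
      using V g0 pt by (simp add: g_def d_nat U_proj)
    also have "\<dots> = r \<odot>\<^bsub>C0 V\<^esub> st V v \<ominus>\<^bsub>C0 V\<^esub> st V (r \<odot>\<^bsub>V\<^esub> v)"
      using V pt r s_closed ru
      by (simp add: mod_hom_diff[OF A0_hom] mod_hom_smult[OF A0_hom] C0_module U_proj st_closed st_nat
          mod_hom_smult[OF pt] u_closed point_u flip: st_u)
    finally show ?thesis .
  qed
  have g_zero: "g V \<zero>\<^bsub>V\<^esub> = \<zero>\<^bsub>C1 V\<^esub>" if V: "V \<in> P" for V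
  proof -
    interpret V: module R V by (rule proj_module[OF V])
    have "point R K V \<zero>\<^bsub>V\<^esub> = (\<lambda>x\<in>carrier U. \<zero>\<^bsub>V\<^esub>)"
      using V U_proj by (intro U_ext[of _ V] point_hom mod_hom_zero_map proj_module) (simp_all add: point_u u_closed)
    then show ?thesis by (simp add: g_def zero_map[OF pointed(1) U_proj V g0(1)])
  qed
  have g_add: "r \<odot>\<^bsub>C1 V\<^esub> df V v w \<oplus>\<^bsub>C1 V\<^esub> g V (v \<oplus>\<^bsub>V\<^esub> w) =
      g V v \<oplus>\<^bsub>C1 V\<^esub> g V w \<oplus>\<^bsub>C1 V\<^esub> df V (r \<odot>\<^bsub>V\<^esub> v) (r \<odot>\<^bsub>V\<^esub> w)"
    if "V \<in> P" "v \<in> carrier V" "w \<in> carrier V" for V v w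
  proof (rule natural_eqI2[OF _ _ _ _ _ _ _ that, where h = "\<lambda>V v w. r \<odot>\<^bsub>C1 V\<^esub> df V v w \<oplus>\<^bsub>C1 V\<^esub> g V (v \<oplus>\<^bsub>V\<^esub> w)"
        and h' = "\<lambda>V v w. g V v \<oplus>\<^bsub>C1 V\<^esub> g V w \<oplus>\<^bsub>C1 V\<^esub> df V (r \<odot>\<^bsub>V\<^esub> v) (r \<odot>\<^bsub>V\<^esub> w)"])
    fix V x y assume V: "V \<in> P" and x: "x \<in> carrier V" and y: "y \<in> carrier V"
    interpret V: module R V by (rule proj_module[OF V])
    interpret C0: module R "C0 V" by (rule C0_module[OF V])
    interpret C1: module R "C1 V" by (rule C1_module[OF V])
    show "r \<odot>\<^bsub>C1 V\<^esub> df V x y \<oplus>\<^bsub>C1 V\<^esub> g V (x \<oplus>\<^bsub>V\<^esub> y) \<in> carrier (C1 V)"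
      "g V x \<oplus>\<^bsub>C1 V\<^esub> g V y \<oplus>\<^bsub>C1 V\<^esub> df V (r \<odot>\<^bsub>V\<^esub> x) (r \<odot>\<^bsub>V\<^esub> y) \<in> carrier (C1 V)"
      using V x y r by (simp_all add: g df)
    have "r \<odot>\<^bsub>C0 V\<^esub> (st V x \<oplus>\<^bsub>C0 V\<^esub> st V y \<ominus>\<^bsub>C0 V\<^esub> st V (x \<oplus>\<^bsub>V\<^esub> y)) =
        r \<odot>\<^bsub>C0 V\<^esub> st V x \<oplus>\<^bsub>C0 V\<^esub> r \<odot>\<^bsub>C0 V\<^esub> st V y \<ominus>\<^bsub>C0 V\<^esub> r \<odot>\<^bsub>C0 V\<^esub> st V (x \<oplus>\<^bsub>V\<^esub> y)"
      using V x y r by (simp add: C0.M.minus_eq C0.smult_r_distr C0.smult_r_minus st_closed)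
    then show "d V (r \<odot>\<^bsub>C1 V\<^esub> df V x y \<oplus>\<^bsub>C1 V\<^esub> g V (x \<oplus>\<^bsub>V\<^esub> y)) =
        d V (g V x \<oplus>\<^bsub>C1 V\<^esub> g V y \<oplus>\<^bsub>C1 V\<^esub> df V (r \<odot>\<^bsub>V\<^esub> x) (r \<odot>\<^bsub>V\<^esub> y))"
      using V x y r
      by (simp add: mod_hom_add[OF d_hom] mod_hom_smult[OF d_hom] g df d_g V.smult_r_distr)
        (rule C0.M.defect_scalar_identity; simp add: st_closed)
    show "A1 V W f (r \<odot>\<^bsub>C1 V\<^esub> df V x y \<oplus>\<^bsub>C1 V\<^esub> g V (x \<oplus>\<^bsub>V\<^esub> y)) =
        r \<odot>\<^bsub>C1 W\<^esub> df W (f x) (f y) \<oplus>\<^bsub>C1 W\<^esub> g W (f x \<oplus>\<^bsub>W\<^esub> f y)"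
      "A1 V W f (g V x \<oplus>\<^bsub>C1 V\<^esub> g V y \<oplus>\<^bsub>C1 V\<^esub> df V (r \<odot>\<^bsub>V\<^esub> x) (r \<odot>\<^bsub>V\<^esub> y)) =
        g W (f x) \<oplus>\<^bsub>C1 W\<^esub> g W (f y) \<oplus>\<^bsub>C1 W\<^esub> df W (r \<odot>\<^bsub>W\<^esub> f x) (r \<odot>\<^bsub>W\<^esub> f y)"
      if "W \<in> P" "f \<in> mod_hom R V W" for W f
      using V x y r that
      by (simp_all add: mod_hom_add[OF A1_hom] mod_hom_smult[OF A1_hom] g df g_nat mod_hom_add[OF that(2)] mod_hom_smult[OF that(2)])
  next
    fix V x assume V: "V \<in> P" and x: "x \<in> carrier V"
    interpret V: module R V by (rule proj_module[OF V])
    interpret C1: module R "C1 V" by (rule C1_module[OF V])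
    show "r \<odot>\<^bsub>C1 V\<^esub> df V x \<zero>\<^bsub>V\<^esub> \<oplus>\<^bsub>C1 V\<^esub> g V (x \<oplus>\<^bsub>V\<^esub> \<zero>\<^bsub>V\<^esub>) =
        g V x \<oplus>\<^bsub>C1 V\<^esub> g V \<zero>\<^bsub>V\<^esub> \<oplus>\<^bsub>C1 V\<^esub> df V (r \<odot>\<^bsub>V\<^esub> x) (r \<odot>\<^bsub>V\<^esub> \<zero>\<^bsub>V\<^esub>)"
      "r \<odot>\<^bsub>C1 V\<^esub> df V \<zero>\<^bsub>V\<^esub> x \<oplus>\<^bsub>C1 V\<^esub> g V (\<zero>\<^bsub>V\<^esub> \<oplus>\<^bsub>V\<^esub> x) =
        g V \<zero>\<^bsub>V\<^esub> \<oplus>\<^bsub>C1 V\<^esub> g V x \<oplus>\<^bsub>C1 V\<^esub> df V (r \<odot>\<^bsub>V\<^esub> \<zero>\<^bsub>V\<^esub>) (r \<odot>\<^bsub>V\<^esub> x)"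
      using V x r by (simp_all add: df g g_zero)
  qed
  define r' where "r' = (\<lambda>V\<in>P. \<lambda>(c, v)\<in>carrier (G V). (r \<odot>\<^bsub>C1 V\<^esub> c \<oplus>\<^bsub>C1 V\<^esub> g V v, r \<odot>\<^bsub>V\<^esub> v))"
  have r'_eq: "r' V (c, v) = (r \<odot>\<^bsub>C1 V\<^esub> c \<oplus>\<^bsub>C1 V\<^esub> g V v, r \<odot>\<^bsub>V\<^esub> v)"
    if "V \<in> P" "c \<in> carrier (C1 V)" "v \<in> carrier V" for V c v
    using that by (simp add: r'_def G_simps)
  have "r' \<in> carrier E \<and> q r' = r"
  proof (rule extI)
    fix V x y assume V: "V \<in> P" and x: "x \<in> carrier (G V)" and y: "y \<in> carrier (G V)"
    interpret V: module R V by (rule proj_module[OF V])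
    interpret C1: module R "C1 V" by (rule C1_module[OF V])
    obtain c v c' v' where cv: "x = (c, v)" "c \<in> carrier (C1 V)" "v \<in> carrier V"
      and cv': "y = (c', v')" "c' \<in> carrier (C1 V)" "v' \<in> carrier V"
      using x y by (elim G_cases)
    have "r \<odot>\<^bsub>C1 V\<^esub> (c \<oplus>\<^bsub>C1 V\<^esub> c' \<oplus>\<^bsub>C1 V\<^esub> df V v v') \<oplus>\<^bsub>C1 V\<^esub> g V (v \<oplus>\<^bsub>V\<^esub> v') =
        r \<odot>\<^bsub>C1 V\<^esub> c \<oplus>\<^bsub>C1 V\<^esub> r \<odot>\<^bsub>C1 V\<^esub> c' \<oplus>\<^bsub>C1 V\<^esub> (r \<odot>\<^bsub>C1 V\<^esub> df V v v' \<oplus>\<^bsub>C1 V\<^esub> g V (v \<oplus>\<^bsub>V\<^esub> v'))"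
      using V cv cv' r by (simp add: C1.smult_r_distr df g C1.M.a_assoc)
    also have "\<dots> = (r \<odot>\<^bsub>C1 V\<^esub> c \<oplus>\<^bsub>C1 V\<^esub> g V v) \<oplus>\<^bsub>C1 V\<^esub> (r \<odot>\<^bsub>C1 V\<^esub> c' \<oplus>\<^bsub>C1 V\<^esub> g V v') \<oplus>\<^bsub>C1 V\<^esub>
        df V (r \<odot>\<^bsub>V\<^esub> v) (r \<odot>\<^bsub>V\<^esub> v')"
      using V cv cv' r by (simp only: g_add) (simp add: df g C1.M.a_ac)
    finally show "r' V (x \<oplus>\<^bsub>G V\<^esub> y) = r' V x \<oplus>\<^bsub>G V\<^esub> r' V y"
      using V cv cv' r by (simp add: r'_eq G_simps df g V.smult_r_distr)
  next
    fix V x assume V: "V \<in> P" and x: "x \<in> carrier (G V)"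
    interpret V: module R V by (rule proj_module[OF V])
    interpret C1: module R "C1 V" by (rule C1_module[OF V])
    interpret C0: module R "C0 V" by (rule C0_module[OF V])
    obtain c v where cv: "x = (c, v)" "c \<in> carrier (C1 V)" "v \<in> carrier V"
      using x by (elim G_cases)
    show "r' V x \<in> carrier (G V)"
      using V cv r by (simp add: r'_eq G_simps g)
    show "r' W (AG V W f x) = AG V W f (r' V x)" if W: "W \<in> P" and f: "f \<in> mod_hom R V W" for W f
      using V W f cv r
      by (simp add: r'_eq AG_eq g A1_closed mod_hom_closed[OF f] mod_hom_add[OF A1_hom] mod_hom_smult[OF A1_hom]
          mod_hom_smult[OF f] g_nat)
    have "st V v \<in> carrier (C0 V)" "st V (r \<odot>\<^bsub>V\<^esub> v) \<in> carrier (C0 V)" "d V c \<in> carrier (C0 V)"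
      using V cv r by (simp_all add: st_closed d_closed)
    then show "c0 V (r' V x) = r \<odot>\<^bsub>C0 V\<^esub> c0 V x"
      using V cv r
      by (simp add: r'_eq c0_eq g mod_hom_add[OF d_hom] mod_hom_smult[OF d_hom] d_g C0.smult_r_distr
          C0.M.a_assoc C0.M.add_diff_self)
  next
    fix V c assume V: "V \<in> P" and c: "c \<in> carrier (C1 V)"
    interpret V: module R V by (rule proj_module[OF V])
    interpret C1: module R "C1 V" by (rule C1_module[OF V])
    show "r' V (c1 V c) = c1 V (r \<odot>\<^bsub>C1 V\<^esub> c)"
      using V c r by (simp add: c1_eq r'_eq g_zero)
  qed (simp_all add: r r'_def)
  then show ?thesis by blast
qed

lemma square_zero: "square_zero_extension R M E i q"
proof -
  interpret E: ring E by (rule ext_ring)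
  have 1: "i m \<otimes>\<^bsub>E\<^esub> x = i (rsmult M m (q x))" "x \<otimes>\<^bsub>E\<^esub> i m = i (q x \<odot>\<^bsub>M\<^esub> m)"
    if m: "m \<in> carrier M" and x: "x \<in> carrier E" for m x
  proof -
    interpret M: module R M by (rule M_module)
    note x' = ext[OF x]
    have m': "rsmult M m (q x) \<in> carrier M" "q x \<odot>\<^bsub>M\<^esub> m \<in> carrier M"
      using m x' is_bimoduleD(2)[OF bimodule] by simp_all
    show "i m \<otimes>\<^bsub>E\<^esub> x = i (rsmult M m (q x))"
      by (rule ext_eqI)
        (simp_all add: m m' x i_closed ext_mult_closed ext_ring_simps i_eq x' mod_hom_smult[OF a_hom] c0_closed
          a_closed me_balanced)
    show "x \<otimes>\<^bsub>E\<^esub> i m = i (q x \<odot>\<^bsub>M\<^esub> m)"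
      by (rule ext_eqI)
        (simp_all add: m m' x i_closed ext_mult_closed ext_ring_simps i_eq x' c0_closed
          a_closed me_closed b_closed mod_hom_smult[OF b_hom, symmetric] me_smult)
  qed
  have 2: "i m \<otimes>\<^bsub>E\<^esub> i n = \<zero>\<^bsub>E\<^esub>" if m: "m \<in> carrier M" "n \<in> carrier M" for m n
    by (rule ext_eqI)
      (simp_all add: m i_closed ext_mult_closed ext_ring_simps i_eq c0_c1 c1_closed c0_closed a_closed me_closed b_closed db
        mod_hom_zero[OF a_hom] mod_hom_zero[OF b_hom] C0_module proj_module TM_module C1_module me_zero_right G_zero
        ext_zero_closed)
  have "i \<in> hom (add_monoid M) (add_monoid E)"
    by (auto simp: hom_def i_closed i_add)
  moreover have "q ` carrier E = carrier R"
    using q_surj q_closed by blast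
  ultimately show ?thesis
    unfolding square_zero_extension_def
    using ext_ring q_hom i_inj i_image 1 2 by blast
qed

end

section \<open>Restriction of scalars\<close>

lemma restrict_module_simps [simp]:
  "carrier (restrict_module f X) = carrier X" "add (restrict_module f X) = add X"
  "\<zero>\<^bsub>restrict_module f X\<^esub> = \<zero>\<^bsub>X\<^esub>" "r \<odot>\<^bsub>restrict_module f X\<^esub> x = f r \<odot>\<^bsub>X\<^esub> x"
  by (simp_all add: restrict_module_def)

lemma restrict_functor_simps [simp]:
  "Ob (restrict_functor f F) V = restrict_module f (Ob F V)" "Ar (restrict_functor f F) = Ar F"
  by (simp_all add: restrict_functor_def)

lemma restrict_elext_simps [simp]:
  "deg1 (restrict_elext f E) = restrict_functor f (deg1 E)" "deg0 (restrict_elext f E) = restrict_functor f (deg0 E)"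
  "diff (restrict_elext f E) = diff E" "inc (restrict_elext f E) = inc E"
  by (simp_all add: restrict_elext_def)

lemma restrict_mult_simps [simp]:
  "munit (restrict_mult S f \<mu>) = (\<lambda>r\<in>carrier S. munit \<mu> (f r))"
  "m00 (restrict_mult S f \<mu>) = m00 \<mu>" "m10 (restrict_mult S f \<mu>) = m10 \<mu>" "m01 (restrict_mult S f \<mu>) = m01 \<mu>"
  by (simp_all add: restrict_mult_def)

lemma abelian_group_transfer:
  assumes "abelian_group X" "carrier Y = carrier X" "add Y = add X" "\<zero>\<^bsub>Y\<^esub> = \<zero>\<^bsub>X\<^esub>"
  shows "abelian_group Y"
proof -
  interpret X: abelian_group X by fact
  show ?thesis
  proof (rule abelian_groupI)
    show "\<exists>y\<in>carrier Y. y \<oplus>\<^bsub>Y\<^esub> x = \<zero>\<^bsub>Y\<^esub>" if "x \<in> carrier Y" for x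
      using that assms(2-4) by (intro bexI[of _ "\<ominus>\<^bsub>X\<^esub> x"]) (simp_all add: X.l_neg)
  qed (use assms(2-4) in \<open>simp_all add: X.a_ac\<close>)
qed

lemma restrict_module:
  assumes "cring S" "f \<in> ring_hom S Q" "module Q X"
  shows "module S (restrict_module f X)"
proof -
  interpret X: module Q X by fact
  show ?thesis
    using abelian_group_transfer[OF X.abelian_group_axioms, of "restrict_module f X"] assms(1)
      ring_hom_closed[OF assms(2)] ring_hom_add[OF assms(2)] ring_hom_mult[OF assms(2)] ring_hom_one[OF assms(2)]
    by (intro moduleI) (simp_all add: X.smult_l_distr X.smult_r_distr X.smult_assoc1)
qed

lemma restrict_hom:
  assumes "f \<in> ring_hom S Q" "h \<in> mod_hom Q X Y"
  shows "h \<in> mod_hom S (restrict_module f X) (restrict_module f Y)"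
  using ring_hom_closed[OF assms(1)]
  by (intro mod_homI)
    (simp_all add: mod_hom_closed[OF assms(2)] mod_hom_add[OF assms(2)] mod_hom_smult[OF assms(2)] mod_hom_extensional[OF assms(2)])

lemma restrict_pointed:
  assumes "cring S" "f \<in> ring_hom S Q" "pointed_functor R Q F"
  shows "pointed_functor R S (restrict_functor f F)"
  using assms(3) unfolding pointed_functor_def
  by (simp add: restrict_module[OF assms(1,2)] restrict_hom[OF assms(2)])

section \<open>The product on \<open>C\<^sub>0\<^sub>1\<close>\<close>

context mult_ext
begin

lemma m_assoc:
  assumes "X \<in> P" "V \<in> P" "W \<in> P"
  shows m10_assoc: "c \<in> carrier (C1 X) \<Longrightarrow> y \<in> carrier (C0 V) \<Longrightarrow> z \<in> carrier (C0 W) \<Longrightarrow>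
      A1 (T (T X V) W) (T X (T V W)) (associator R K X V W) (m10 \<mu> (T X V) W (m10 \<mu> X V c y) z) =
      m10 \<mu> X (T V W) c (m00 \<mu> V W y z)"
    and m01_m10_assoc: "x \<in> carrier (C0 X) \<Longrightarrow> c' \<in> carrier (C1 V) \<Longrightarrow> z \<in> carrier (C0 W) \<Longrightarrow>
      A1 (T (T X V) W) (T X (T V W)) (associator R K X V W) (m10 \<mu> (T X V) W (m01 \<mu> X V x c') z) =
      m01 \<mu> X (T V W) x (m10 \<mu> V W c' z)"
    and m01_assoc: "x \<in> carrier (C0 X) \<Longrightarrow> y \<in> carrier (C0 V) \<Longrightarrow> c'' \<in> carrier (C1 W) \<Longrightarrow>
      A1 (T (T X V) W) (T X (T V W)) (associator R K X V W) (m01 \<mu> (T X V) W (m00 \<mu> X V x y) c'') =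
      m01 \<mu> X (T V W) x (m01 \<mu> V W y c'')"
  using mu_assoc assms unfolding mult_associative_def Let_def by blast+

text \<open>
  The two summands \<open>c \<cdot> d(c')\<close> and \<open>c \<cdot> s(v')\<close> of the product are collected into \<open>c \<cdot> c\<^sub>0(c', v')\<close>.
\<close>

definition prod01 :: "('r, 'v) module \<Rightarrow> ('r, 'v) module \<Rightarrow> 'c1 \<times> 'v \<Rightarrow> 'c1 \<times> 'v \<Rightarrow> 'c1 \<times> 'v"
  where "prod01 V V' x y =
    (m10 \<mu> V V' (fst x) (c0 V' y) \<oplus>\<^bsub>C1 (T V V')\<^esub> m01 \<mu> V V' (st V (snd x)) (fst y), t V V' (snd x) (snd y))"

lemma prod01_eq:
  "prod01 V V' (c, v) (c', v') =
    (m10 \<mu> V V' c (c0 V' (c', v')) \<oplus>\<^bsub>C1 (T V V')\<^esub> m01 \<mu> V V' (st V v) c', t V V' v v')"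
  by (simp add: prod01_def)

lemma C01_mult_simps:
  "munit (C01_mult R K \<phi> \<mu> S act) = (\<lambda>r\<in>carrier S. act U r (\<zero>\<^bsub>C1 U\<^esub>, u))"
  "m10 (C01_mult R K \<phi> \<mu> S act) V V' c x = m10 \<mu> V V' c (c0 V' x)"
  "m01 (C01_mult R K \<phi> \<mu> S act) V V' x c = m01 \<mu> V V' (c0 V x) c"
  by (simp_all add: C01_mult_def)

lemma C01_mult_m00:
  assumes "V \<in> P" "V' \<in> P" "x \<in> carrier (G V)" "y \<in> carrier (G V')"
  shows "m00 (C01_mult R K \<phi> \<mu> S act) V V' x y = prod01 V V' x y"
  using assms(3,4) assms(1,2)
  by (elim G_cases) (simp add: C01_mult_def Let_def prod01_eq c0_eq m10_add d_closed st_closed)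

context
  fixes V V' assumes V: "V \<in> P" "V' \<in> P"
begin

interpretation V: abelian_group V by (rule V_abelian[OF V(1)])
interpretation V': abelian_group V' by (rule V_abelian[OF V(2)])
interpretation C0V: abelian_group "C0 V" by (rule C0_abelian[OF V(1)])
interpretation C0T: abelian_group "C0 (T V V')" by (rule C0_abelian[OF T_proj[OF V]])
interpretation C1T: module R "C1 (T V V')" by (rule C1_module[OF T_proj[OF V]])
interpretation C1V: module R "C1 V" by (rule C1_module[OF V(1)])
interpretation C1V': module R "C1 V'" by (rule C1_module[OF V(2)])

lemma prod01_closed: "x \<in> carrier (G V) \<Longrightarrow> y \<in> carrier (G V') \<Longrightarrow> prod01 V V' x y \<in> carrier (G (T V V'))"
  using V by (elim G_cases) (simp add: prod01_eq G_simps m10_closed m01_closed c0_closed st_closed tens_closed)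

lemma c0_prod01:
  assumes "x \<in> carrier (G V)" "y \<in> carrier (G V')"
  shows "c0 (T V V') (prod01 V V' x y) = m00 \<mu> V V' (c0 V x) (c0 V' y)"
proof -
  obtain c v c' v' where x: "x = (c, v)" "c \<in> carrier (C1 V)" "v \<in> carrier V"
    and y: "y = (c', v')" "c' \<in> carrier (C1 V')" "v' \<in> carrier V'"
    using assms by (elim G_cases)
  have Y: "c0 V' (c', v') \<in> carrier (C0 V')" using assms V y by (simp add: c0_closed)
  have "c0 (T V V') (prod01 V V' x y) =
      m00 \<mu> V V' (d V c) (c0 V' (c', v')) \<oplus>\<^bsub>C0 (T V V')\<^esub> m00 \<mu> V V' (st V v) (d V' c') \<oplus>\<^bsub>C0 (T V V')\<^esub>
        m00 \<mu> V V' (st V v) (st V' v')"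
    using V x y Y T_proj[OF V]
    by (simp add: prod01_eq c0_eq m10_closed m01_closed tens_closed st_closed d_closed mod_hom_add[OF d_hom]
        d_m10 d_m01 st_mult)
  also have "\<dots> = m00 \<mu> V V' (d V c) (c0 V' (c', v')) \<oplus>\<^bsub>C0 (T V V')\<^esub> m00 \<mu> V V' (st V v) (c0 V' (c', v'))"
    using V x y Y by (simp add: c0_eq m00_add m00_closed d_closed st_closed C0T.a_assoc)
  also have "\<dots> = m00 \<mu> V V' (c0 V x) (c0 V' y)"
    using V x y Y by (simp add: c0_eq[OF V(1) x(2,3)] m00_add d_closed st_closed)
  finally show ?thesis .
qed

text \<open>
  Additivity of the product in the first factor: by the equation \<open>k \<cdot> d(c') = d(k) \<cdot> c'\<close> for elements \<open>k\<close>, \<open>c'\<close>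
  of degree 1, the defect of \<open>v, w\<close> times \<open>d(c')\<close> makes up for the nonadditivity of \<open>s(v)\<close>, and its
  product with \<open>s(v')\<close> is the defect of \<open>v \<otimes> v', w \<otimes> v'\<close>.
\<close>

lemma df_mult_left:
  assumes "v \<in> carrier V" "w \<in> carrier V" "c' \<in> carrier (C1 V')" "v' \<in> carrier V'"
  shows "m10 \<mu> V V' (df V v w) (c0 V' (c', v')) \<oplus>\<^bsub>C1 (T V V')\<^esub> m01 \<mu> V V' (st V (v \<oplus>\<^bsub>V\<^esub> w)) c' =
    m01 \<mu> V V' (st V v) c' \<oplus>\<^bsub>C1 (T V V')\<^esub> m01 \<mu> V V' (st V w) c' \<oplus>\<^bsub>C1 (T V V')\<^esub> df (T V V') (t V V' v v') (t V V' w v')"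
proof -
  note s = st_closed[OF V(1) assms(1)] st_closed[OF V(1) assms(2)] st_closed[OF V(1) V.a_closed[OF assms(1,2)]]
  have k: "df V v w \<in> carrier (C1 V)" using V assms by (simp add: df)
  have 1: "m10 \<mu> V V' (df V v w) (st V' v') = df (T V V') (t V V' v v') (t V V' w v')"
    using V assms df_nat[OF V(1) T_proj[OF V] right_mult_hom[OF V assms(4)] assms(1,2)]
    by (simp add: m10_st[OF V assms(1) assms(4) k])
  have "m10 \<mu> V V' (df V v w) (d V' c') \<oplus>\<^bsub>C1 (T V V')\<^esub> m01 \<mu> V V' (st V (v \<oplus>\<^bsub>V\<^esub> w)) c' =
      m01 \<mu> V V' (d V (df V v w) \<oplus>\<^bsub>C0 V\<^esub> st V (v \<oplus>\<^bsub>V\<^esub> w)) c'"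
    using V assms k s by (simp add: m10_d m01_add d_closed)
  also have "d V (df V v w) \<oplus>\<^bsub>C0 V\<^esub> st V (v \<oplus>\<^bsub>V\<^esub> w) = st V v \<oplus>\<^bsub>C0 V\<^esub> st V w"
    using V assms s by (simp add: d_df C0V.add_diff_self)
  also have "m01 \<mu> V V' (st V v \<oplus>\<^bsub>C0 V\<^esub> st V w) c' = m01 \<mu> V V' (st V v) c' \<oplus>\<^bsub>C1 (T V V')\<^esub> m01 \<mu> V V' (st V w) c'"
    using V assms s by (simp add: m01_add)
  finally have 2: "m10 \<mu> V V' (df V v w) (d V' c') \<oplus>\<^bsub>C1 (T V V')\<^esub> m01 \<mu> V V' (st V (v \<oplus>\<^bsub>V\<^esub> w)) c' =
      m01 \<mu> V V' (st V v) c' \<oplus>\<^bsub>C1 (T V V')\<^esub> m01 \<mu> V V' (st V w) c'" .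
  have cl: "m10 \<mu> V V' (df V v w) (d V' c') \<in> carrier (C1 (T V V'))" "m01 \<mu> V V' (st V (v \<oplus>\<^bsub>V\<^esub> w)) c' \<in> carrier (C1 (T V V'))"
    "df (T V V') (t V V' v v') (t V V' w v') \<in> carrier (C1 (T V V'))"
    using V assms k s by (simp_all add: m10_closed m01_closed d_closed df T_proj tens_closed)
  have "m10 \<mu> V V' (df V v w) (c0 V' (c', v')) \<oplus>\<^bsub>C1 (T V V')\<^esub> m01 \<mu> V V' (st V (v \<oplus>\<^bsub>V\<^esub> w)) c' =
      (m10 \<mu> V V' (df V v w) (d V' c') \<oplus>\<^bsub>C1 (T V V')\<^esub> m01 \<mu> V V' (st V (v \<oplus>\<^bsub>V\<^esub> w)) c') \<oplus>\<^bsub>C1 (T V V')\<^esub>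
        df (T V V') (t V V' v v') (t V V' w v')"
    using V assms k cl by (simp add: c0_eq m10_add d_closed st_closed 1 C1T.M.a_ac)
  then show ?thesis by (simp only: 2)
qed

lemma prod01_add_left:
  assumes "x \<in> carrier (G V)" "x' \<in> carrier (G V)" "y \<in> carrier (G V')"
  shows "prod01 V V' (x \<oplus>\<^bsub>G V\<^esub> x') y = prod01 V V' x y \<oplus>\<^bsub>G (T V V')\<^esub> prod01 V V' x' y"
proof -
  obtain c1 v1 c2 v2 c' v' where x: "x = (c1, v1)" "c1 \<in> carrier (C1 V)" "v1 \<in> carrier V"
    and x': "x' = (c2, v2)" "c2 \<in> carrier (C1 V)" "v2 \<in> carrier V"
    and y: "y = (c', v')" "c' \<in> carrier (C1 V')" "v' \<in> carrier V'"
    using assms by (elim G_cases)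
  let ?Y = "c0 V' (c', v')" and ?k = "df V v1 v2"
  have Y: "?Y \<in> carrier (C0 V')" using assms V y by (simp add: c0_closed)
  have k: "?k \<in> carrier (C1 V)" using V x x' by (simp add: df)
  note cl = m10_closed[OF V x(2) Y] m10_closed[OF V x'(2) Y] m10_closed[OF V k Y]
    m01_closed[OF V st_closed[OF V(1) x(3)] y(2)] m01_closed[OF V st_closed[OF V(1) x'(3)] y(2)]
    m01_closed[OF V st_closed[OF V(1) V.a_closed[OF x(3) x'(3)]] y(2)]
  have dfT: "df (T V V') (t V V' v1 v') (t V V' v2 v') \<in> carrier (C1 (T V V'))"
    using V x x' y by (simp add: df T_proj tens_closed)
  have "m10 \<mu> V V' (c1 \<oplus>\<^bsub>C1 V\<^esub> c2 \<oplus>\<^bsub>C1 V\<^esub> ?k) ?Y \<oplus>\<^bsub>C1 (T V V')\<^esub> m01 \<mu> V V' (st V (v1 \<oplus>\<^bsub>V\<^esub> v2)) c' =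
      m10 \<mu> V V' c1 ?Y \<oplus>\<^bsub>C1 (T V V')\<^esub> m10 \<mu> V V' c2 ?Y \<oplus>\<^bsub>C1 (T V V')\<^esub>
        (m10 \<mu> V V' ?k ?Y \<oplus>\<^bsub>C1 (T V V')\<^esub> m01 \<mu> V V' (st V (v1 \<oplus>\<^bsub>V\<^esub> v2)) c')"
    using V x x' Y k cl by (simp add: m10_add C1T.M.a_assoc)
  also have "\<dots> = (m10 \<mu> V V' c1 ?Y \<oplus>\<^bsub>C1 (T V V')\<^esub> m01 \<mu> V V' (st V v1) c') \<oplus>\<^bsub>C1 (T V V')\<^esub>
      (m10 \<mu> V V' c2 ?Y \<oplus>\<^bsub>C1 (T V V')\<^esub> m01 \<mu> V V' (st V v2) c') \<oplus>\<^bsub>C1 (T V V')\<^esub> df (T V V') (t V V' v1 v') (t V V' v2 v')"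
    unfolding df_mult_left[OF x(3) x'(3) y(2,3)] using cl dfT by (simp add: C1T.M.a_ac)
  finally show ?thesis
    using V x x' y by (simp add: G_simps prod01_eq tens_add_left)
qed

lemma prod01_add_right:
  assumes "x \<in> carrier (G V)" "y \<in> carrier (G V')" "y' \<in> carrier (G V')"
  shows "prod01 V V' x (y \<oplus>\<^bsub>G V'\<^esub> y') = prod01 V V' x y \<oplus>\<^bsub>G (T V V')\<^esub> prod01 V V' x y'"
proof -
  obtain c v c1 v1 c2 v2 where x: "x = (c, v)" "c \<in> carrier (C1 V)" "v \<in> carrier V"
    and y: "y = (c1, v1)" "c1 \<in> carrier (C1 V')" "v1 \<in> carrier V'"
    and y': "y' = (c2, v2)" "c2 \<in> carrier (C1 V')" "v2 \<in> carrier V'"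
    using assms by (elim G_cases)
  have k: "df V' v1 v2 \<in> carrier (C1 V')" using V y y' by (simp add: df)
  note s = st_closed[OF V(1) x(3)]
  have Y: "c0 V' (c1, v1) \<in> carrier (C0 V')" "c0 V' (c2, v2) \<in> carrier (C0 V')"
    using assms V y y' by (simp_all add: c0_closed)
  have c0: "c0 V' (c1 \<oplus>\<^bsub>C1 V'\<^esub> c2 \<oplus>\<^bsub>C1 V'\<^esub> df V' v1 v2, v1 \<oplus>\<^bsub>V'\<^esub> v2) = c0 V' (c1, v1) \<oplus>\<^bsub>C0 V'\<^esub> c0 V' (c2, v2)"
    using c0_add[OF V(2) assms(2,3)] y y' by (simp add: G_simps)
  have 1: "m01 \<mu> V V' (st V v) (df V' v1 v2) = df (T V V') (t V V' v v1) (t V V' v v2)"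
    using V x y y' df_nat[OF V(2) T_proj[OF V] left_mult_hom[OF V x(3)] y(3) y'(3)]
    by (simp add: m01_st[OF V x(3) y(3) k])
  have dfT: "df (T V V') (t V V' v v1) (t V V' v v2) \<in> carrier (C1 (T V V'))"
    using V x y y' by (simp add: df T_proj tens_closed)
  show ?thesis
    using V x y y' k s Y dfT
    by (simp add: G_simps prod01_eq tens_add_right c0 m10_add m01_add 1 m10_closed m01_closed C1T.M.a_ac)
qed

end

text \<open>
  An element of the ring has the form \<open>(c, v) \<mapsto> (r c + g(v), r v)\<close> with \<open>g\<close> natural, and by naturality
  \<open>g(v) \<cdot> s(v') = g(v \<otimes> v') = s(v) \<cdot> g(v')\<close>. This is what makes the product bilinear over the ring.
\<close>

definition shift :: "(('r, 'v) module \<Rightarrow> 'c1 \<times> 'v \<Rightarrow> 'c1 \<times> 'v) \<Rightarrow> ('r, 'v) module \<Rightarrow> 'v \<Rightarrow> 'c1"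
  where "shift r' V v = fst (r' V (\<zero>\<^bsub>C1 V\<^esub>, v))"

lemma shift:
  assumes r': "r' \<in> carrier E" and V: "V \<in> P" and v: "v \<in> carrier V"
  shows shift_closed: "shift r' V v \<in> carrier (C1 V)"
    and ext_eq: "c \<in> carrier (C1 V) \<Longrightarrow> r' V (c, v) = (q r' \<odot>\<^bsub>C1 V\<^esub> c \<oplus>\<^bsub>C1 V\<^esub> shift r' V v, q r' \<odot>\<^bsub>V\<^esub> v)"
    and d_shift: "d V (shift r' V v) \<oplus>\<^bsub>C0 V\<^esub> st V (q r' \<odot>\<^bsub>V\<^esub> v) = q r' \<odot>\<^bsub>C0 V\<^esub> st V v"
    and shift_nat: "W \<in> P \<Longrightarrow> f \<in> mod_hom R V W \<Longrightarrow> A1 V W f (shift r' V v) = shift r' W (f v)"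
proof -
  interpret V: module R V by (rule proj_module[OF V])
  interpret C1: module R "C1 V" by (rule C1_module[OF V])
  interpret C0: module R "C0 V" by (rule C0_module[OF V])
  note r = q_closed[OF r']
  have x: "(\<zero>\<^bsub>C1 V\<^esub>, v) \<in> carrier (G V)" using v by (simp add: G_simps)
  have rx: "r' V (\<zero>\<^bsub>C1 V\<^esub>, v) \<in> carrier (G V)" by (rule ext_closed[OF r' V x])
  obtain g w where gw: "r' V (\<zero>\<^bsub>C1 V\<^esub>, v) = (g, w)" "g \<in> carrier (C1 V)" "w \<in> carrier V"
    by (rule G_cases[OF rx])
  have c0x: "c0 V (\<zero>\<^bsub>C1 V\<^esub>, v) = st V v"
    using V v by (simp add: c0_eq mod_hom_zero[OF d_hom] C1_module C0_module st_closed)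
  have c0r: "c0 V (g, w) = q r' \<odot>\<^bsub>C0 V\<^esub> st V v"
    using c0_ext[OF r' V x] by (simp add: gw(1) c0x)
  have "a V (c0 V (g, w)) = q r' \<odot>\<^bsub>V\<^esub> v"
    using V v r by (simp add: c0r mod_hom_smult[OF a_hom] st_closed a_st)
  then have w: "w = q r' \<odot>\<^bsub>V\<^esub> v" using a_c0[OF V gw(2,3)] by simp
  have g: "shift r' V v = g" by (simp add: shift_def gw)
  show "shift r' V v \<in> carrier (C1 V)" using g gw by simp
  show "d V (shift r' V v) \<oplus>\<^bsub>C0 V\<^esub> st V (q r' \<odot>\<^bsub>V\<^esub> v) = q r' \<odot>\<^bsub>C0 V\<^esub> st V v"
    using c0r c0_eq[OF V gw(2,3)] by (simp add: g w)
  show "r' V (c, v) = (q r' \<odot>\<^bsub>C1 V\<^esub> c \<oplus>\<^bsub>C1 V\<^esub> shift r' V v, q r' \<odot>\<^bsub>V\<^esub> v)" if "c \<in> carrier (C1 V)"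
    using that V v r gw by (simp add: ext_decompose[OF r' V that v] g c1_eq G_simps df w[symmetric])
  show "A1 V W f (shift r' V v) = shift r' W (f v)" if W: "W \<in> P" and f: "f \<in> mod_hom R V W"
  proof -
    have "AG V W f (\<zero>\<^bsub>C1 V\<^esub>, v) = (\<zero>\<^bsub>C1 W\<^esub>, f v)"
      using v mod_hom_zero[OF A1_hom[OF V W f] C1_module[OF V] C1_module[OF W]] by (simp add: AG_eq)
    then have "r' W (\<zero>\<^bsub>C1 W\<^esub>, f v) = AG V W f (g, w)" using ext_nat[OF r' V W f x] by (simp add: gw(1))
    then show ?thesis using gw g by (simp add: AG_eq shift_def)
  qed
qed

context
  fixes V V' r' x y
  assumes V: "V \<in> P" "V' \<in> P" and r': "r' \<in> carrier E" and x: "x \<in> carrier (G V)" and y: "y \<in> carrier (G V')"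
begin

lemma prod01_ext_left: "prod01 V V' (r' V x) y = r' (T V V') (prod01 V V' x y)"
proof -
  interpret V: module R V by (rule proj_module[OF V(1)])
  interpret C1T: module R "C1 (T V V')" by (rule C1_module[OF T_proj[OF V]])
  interpret C1V: module R "C1 V" by (rule C1_module[OF V(1)])
  interpret C0V: module R "C0 V" by (rule C0_module[OF V(1)])
  obtain c v c' v' where x: "x = (c, v)" "c \<in> carrier (C1 V)" "v \<in> carrier V"
    and y: "y = (c', v')" "c' \<in> carrier (C1 V')" "v' \<in> carrier V'"
    using x y by (elim G_cases)
  let ?r = "q r'" and ?g = "shift r' V v" and ?Y = "c0 V' (c', v')"
  note r = q_closed[OF r']
  have rv: "?r \<odot>\<^bsub>V\<^esub> v \<in> carrier V" using r x by simp
  have Y: "?Y \<in> carrier (C0 V')" using V y by (simp add: c0_closed G_simps)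
  have g: "?g \<in> carrier (C1 V)" by (rule shift_closed[OF r' V(1) x(3)])
  have dc: "d V ?g \<in> carrier (C0 V)" "d V' c' \<in> carrier (C0 V')" using V g y by (simp_all add: d_closed)
  note s = st_closed[OF V(1) x(3)] st_closed[OF V(1) rv] st_closed[OF V(2) y(3)]
  note cl = m10_closed[OF V x(2) Y] m10_closed[OF V g dc(2)] m01_closed[OF V s(1) y(2)] m01_closed[OF V s(2) y(2)]
  have vv: "t V V' v v' \<in> carrier (T V V')" using V x y by (simp add: tens_closed)
  have gT: "shift r' (T V V') (t V V' v v') \<in> carrier (C1 (T V V'))"
    by (rule shift_closed[OF r' T_proj[OF V] vv])
  have 1: "m10 \<mu> V V' ?g (st V' v') = shift r' (T V V') (t V V' v v')"
    using shift_nat[OF r' V(1) x(3) T_proj[OF V] right_mult_hom[OF V y(3)]] x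
    by (simp add: m10_st[OF V x(3) y(3) g])
  have 2: "m10 \<mu> V V' ?g (d V' c') \<oplus>\<^bsub>C1 (T V V')\<^esub> m01 \<mu> V V' (st V (?r \<odot>\<^bsub>V\<^esub> v)) c' = ?r \<odot>\<^bsub>C1 (T V V')\<^esub> m01 \<mu> V V' (st V v) c'"
  proof -
    have "m10 \<mu> V V' ?g (d V' c') \<oplus>\<^bsub>C1 (T V V')\<^esub> m01 \<mu> V V' (st V (?r \<odot>\<^bsub>V\<^esub> v)) c' =
        m01 \<mu> V V' (d V ?g \<oplus>\<^bsub>C0 V\<^esub> st V (?r \<odot>\<^bsub>V\<^esub> v)) c'"
      using V y g s dc by (simp add: m10_d m01_add)
    then show ?thesis using V x y r s by (simp add: d_shift[OF r' V(1) x(3)] m01_smult)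
  qed
  have "m10 \<mu> V V' (?r \<odot>\<^bsub>C1 V\<^esub> c \<oplus>\<^bsub>C1 V\<^esub> ?g) ?Y \<oplus>\<^bsub>C1 (T V V')\<^esub> m01 \<mu> V V' (st V (?r \<odot>\<^bsub>V\<^esub> v)) c' =
      ?r \<odot>\<^bsub>C1 (T V V')\<^esub> m10 \<mu> V V' c ?Y \<oplus>\<^bsub>C1 (T V V')\<^esub>
        (m10 \<mu> V V' ?g (d V' c') \<oplus>\<^bsub>C1 (T V V')\<^esub> m01 \<mu> V V' (st V (?r \<odot>\<^bsub>V\<^esub> v)) c') \<oplus>\<^bsub>C1 (T V V')\<^esub> shift r' (T V V') (t V V' v v')"
  proof -
    have "m10 \<mu> V V' (?r \<odot>\<^bsub>C1 V\<^esub> c \<oplus>\<^bsub>C1 V\<^esub> ?g) ?Y = ?r \<odot>\<^bsub>C1 (T V V')\<^esub> m10 \<mu> V V' c ?Y \<oplus>\<^bsub>C1 (T V V')\<^esub> m10 \<mu> V V' ?g ?Y"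
      using V x g r Y by (simp add: m10_add m10_smult)
    moreover have "m10 \<mu> V V' ?g ?Y = m10 \<mu> V V' ?g (d V' c') \<oplus>\<^bsub>C1 (T V V')\<^esub> shift r' (T V V') (t V V' v v')"
      using V y g s dc by (simp add: c0_eq m10_add 1)
    ultimately show ?thesis using r cl gT by (simp add: C1T.M.a_ac)
  qed
  also have "\<dots> = ?r \<odot>\<^bsub>C1 (T V V')\<^esub> (m10 \<mu> V V' c ?Y \<oplus>\<^bsub>C1 (T V V')\<^esub> m01 \<mu> V V' (st V v) c') \<oplus>\<^bsub>C1 (T V V')\<^esub> shift r' (T V V') (t V V' v v')"
    unfolding 2 using r cl by (simp add: C1T.smult_r_distr)
  finally show ?thesis
    using V x y r vv cl by (simp add: prod01_eq ext_eq[OF r'] T_proj tens_smult_left)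
qed

lemma prod01_ext_right: "prod01 V V' x (r' V' y) = r' (T V V') (prod01 V V' x y)"
proof -
  interpret V': module R V' by (rule proj_module[OF V(2)])
  interpret C1T: module R "C1 (T V V')" by (rule C1_module[OF T_proj[OF V]])
  interpret C1V': module R "C1 V'" by (rule C1_module[OF V(2)])
  have c0y: "c0 V' (r' V' y) = q r' \<odot>\<^bsub>C0 V'\<^esub> c0 V' y" by (rule c0_ext[OF r' V(2) y])
  have Y: "c0 V' y \<in> carrier (C0 V')" using V y by (simp add: c0_closed)
  obtain c v c' v' where x: "x = (c, v)" "c \<in> carrier (C1 V)" "v \<in> carrier V"
    and y: "y = (c', v')" "c' \<in> carrier (C1 V')" "v' \<in> carrier V'"
    using x y by (elim G_cases)
  let ?r = "q r'" and ?g = "shift r' V' v'"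
  note r = q_closed[OF r']
  have g: "?g \<in> carrier (C1 V')" by (rule shift_closed[OF r' V(2) y(3)])
  note s = st_closed[OF V(1) x(3)]
  have vv: "t V V' v v' \<in> carrier (T V V')" using V x y by (simp add: tens_closed)
  have gT: "shift r' (T V V') (t V V' v v') \<in> carrier (C1 (T V V'))"
    by (rule shift_closed[OF r' T_proj[OF V] vv])
  have 1: "m01 \<mu> V V' (st V v) ?g = shift r' (T V V') (t V V' v v')"
    using shift_nat[OF r' V(2) y(3) T_proj[OF V] left_mult_hom[OF V x(3)]] y
    by (simp add: m01_st[OF V x(3) y(3) g])
  note cl = m10_closed[OF V x(2) Y] m01_closed[OF V s y(2)]
  show ?thesis
    using V x y r vv cl s g gT Y c0y
    by (simp add: prod01_eq ext_eq[OF r'] T_proj tens_smult_right m10_smult m01_add m01_smult 1 C1T.smult_r_distr C1T.M.a_assoc)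
qed

end

lemma one_closed: "(\<zero>\<^bsub>C1 U\<^esub>, u) \<in> carrier (G U)"
proof -
  interpret C1: abelian_group "C1 U" by (rule C1_abelian[OF U_proj])
  show ?thesis using u_closed by (simp add: G_simps)
qed

lemma c0_one: "c0 U (\<zero>\<^bsub>C1 U\<^esub>, u) = s"
proof -
  interpret C1: abelian_group "C1 U" by (rule C1_abelian[OF U_proj])
  interpret C0: abelian_group "C0 U" by (rule C0_abelian[OF U_proj])
  show ?thesis using u_closed U_proj by (simp add: c0_eq mod_hom_zero[OF d_hom] C1_module C0_module st_u s_closed)
qed

lemma prod01_one_right:
  assumes V: "V \<in> P" and x: "x \<in> carrier (G V)"
  shows "AG (T V U) V (right_unitor R K V) (prod01 V U x (\<zero>\<^bsub>C1 U\<^esub>, u)) = x"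
proof -
  interpret C1T: abelian_group "C1 (T V U)" by (rule C1_abelian[OF T_proj[OF V U_proj]])
  obtain c v where cv: "x = (c, v)" "c \<in> carrier (C1 V)" "v \<in> carrier V" using x by (elim G_cases)
  show ?thesis
    using V U_proj cv u_closed s_closed
    by (simp add: prod01_eq c0_one m01_zero st_closed m10_closed AG_eq tens_closed m10_unit_right right_unitor_tens)
qed

lemma prod01_one_left:
  assumes V: "V \<in> P" and x: "x \<in> carrier (G V)"
  shows "AG (T U V) V (left_unitor R K V) (prod01 U V (\<zero>\<^bsub>C1 U\<^esub>, u) x) = x"
proof -
  interpret C1T: abelian_group "C1 (T U V)" by (rule C1_abelian[OF T_proj[OF U_proj V]])
  interpret C1U: abelian_group "C1 U" by (rule C1_abelian[OF U_proj])
  have z: "m10 \<mu> U V \<zero>\<^bsub>C1 U\<^esub> y = \<zero>\<^bsub>C1 (T U V)\<^esub>" if "y \<in> carrier (C0 V)" for y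
    using V U_proj C1U.abelian_group_axioms C1T.abelian_group_axioms that
    by (intro additive_zero[where f = "\<lambda>x. m10 \<mu> U V x y"]) (auto simp: m10_closed m10_add)
  obtain c v where cv: "x = (c, v)" "c \<in> carrier (C1 V)" "v \<in> carrier V" using x by (elim G_cases)
  have "c0 V (c, v) \<in> carrier (C0 V)" using V x cv by (simp add: c0_closed)
  then show ?thesis
    using V U_proj cv u_closed s_closed
    by (simp add: prod01_eq z st_u m01_closed AG_eq tens_closed m01_unit_left left_unitor_tens)
qed

text \<open>
  Bilinearity gives \<open>r'(r''(x \<cdot> y)) = r'(x) \<cdot> r''(y) = r''(r'(x \<cdot> y))\<close>, and for \<open>y\<close> the unit this is commutativity.
\<close>

lemma ext_cring: "cring E"
proof -
  interpret E: ring E by (rule ext_ring)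
  have "x \<otimes>\<^bsub>E\<^esub> y = y \<otimes>\<^bsub>E\<^esub> x" if x: "x \<in> carrier E" and y: "y \<in> carrier E" for x y
  proof (rule ext_eqI)
    fix V z assume V: "V \<in> P" and z: "z \<in> carrier (G V)"
    let ?e = "(\<zero>\<^bsub>C1 U\<^esub>, u)" and ?TU = "T V U"
    note TU = T_proj[OF V U_proj] and e = one_closed and ru = right_unitor_hom[OF V]
    have p: "prod01 V U z ?e \<in> carrier (G ?TU)" by (rule prod01_closed[OF V U_proj z e])
    have "x ?TU (y ?TU (prod01 V U z ?e)) = prod01 V U (x V z) (y U ?e)"
      by (simp add: prod01_ext_right[OF V U_proj y z e, symmetric] prod01_ext_left[OF V U_proj x z ext_closed[OF y U_proj e]])
    also have "\<dots> = y ?TU (x ?TU (prod01 V U z ?e))"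
      by (simp add: prod01_ext_left[OF V U_proj x z e, symmetric] prod01_ext_right[OF V U_proj y ext_closed[OF x V z] e])
    finally have "AG ?TU V (right_unitor R K V) (x ?TU (y ?TU (prod01 V U z ?e))) =
        AG ?TU V (right_unitor R K V) (y ?TU (x ?TU (prod01 V U z ?e)))" by simp
    then have "x V (y V z) = y V (x V z)"
      by (simp add: ext_nat[OF x TU V ru, symmetric] ext_nat[OF y TU V ru, symmetric] ext_closed[OF x TU] ext_closed[OF y TU]
          p prod01_one_right[OF V z])
    then show "(x \<otimes>\<^bsub>E\<^esub> y) V z = (y \<otimes>\<^bsub>E\<^esub> x) V z" using V z by (simp add: ext_ring_simps)
  qed (simp_all add: x y)
  then show ?thesis by (intro cring.intro ext_ring comm_monoid.intro comm_monoid_axioms.intro E.is_monoid)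
qed

lemma prod01_nat:
  assumes "V \<in> P" "V' \<in> P" "W \<in> P" "W' \<in> P" "f \<in> mod_hom R V W" "f' \<in> mod_hom R V' W'"
    "x \<in> carrier (G V)" "y \<in> carrier (G V')"
  shows "AG (T V V') (T W W') (tens_map R K V V' W W' f f') (prod01 V V' x y) = prod01 W W' (AG V W f x) (AG V' W' f' y)"
proof -
  note hom = tens_map_hom[OF assms(1-6)]
  interpret C1T: abelian_group "C1 (T V V')" by (rule C1_abelian[OF T_proj[OF assms(1,2)]])
  obtain c v c' v' where x: "x = (c, v)" "c \<in> carrier (C1 V)" "v \<in> carrier V"
    and y: "y = (c', v')" "c' \<in> carrier (C1 V')" "v' \<in> carrier V'"
    using assms(7,8) by (elim G_cases)
  have Y: "c0 V' (c', v') \<in> carrier (C0 V')" using assms y by (simp add: c0_closed)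
  have s: "st V v \<in> carrier (C0 V)" using assms x by (simp add: st_closed)
  show ?thesis
    using assms(1-6) x y Y s
    by (simp add: prod01_eq AG_eq m10_closed m01_closed tens_closed T_proj tens_map_tens[OF assms(1-6)]
        mod_hom_add[OF A1_hom[OF T_proj[OF assms(1,2)] T_proj[OF assms(3,4)] hom]]
        m10_nat[OF assms(1-6)] m01_nat[OF assms(1-6)] c0_nat st_nat)
qed

lemma prod01_assoc:
  assumes "X \<in> P" "V \<in> P" "W \<in> P" "x \<in> carrier (G X)" "y \<in> carrier (G V)" "z \<in> carrier (G W)"
  shows "AG (T (T X V) W) (T X (T V W)) (associator R K X V W) (prod01 (T X V) W (prod01 X V x y) z) =
    prod01 X (T V W) x (prod01 V W y z)"
proof -
  note PT = T_proj[OF assms(1,2)] T_proj[OF assms(2,3)] T_proj[OF T_proj[OF assms(1,2)] assms(3)]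
    T_proj[OF assms(1) T_proj[OF assms(2,3)]]
  note hom = associator_hom[OF assms(1-3)]
  interpret XV: abelian_group "C1 (T X V)" by (rule C1_abelian[OF PT(1)])
  interpret VW: abelian_group "C1 (T V W)" by (rule C1_abelian[OF PT(2)])
  interpret L: abelian_group "C1 (T (T X V) W)" by (rule C1_abelian[OF PT(3)])
  interpret N: abelian_group "C1 (T X (T V W))" by (rule C1_abelian[OF PT(4)])
  have Y: "c0 V y \<in> carrier (C0 V)" and Z: "c0 W z \<in> carrier (C0 W)" using assms by (simp_all add: c0_closed)
  have c0yz: "c0 (T V W) (prod01 V W y z) = m00 \<mu> V W (c0 V y) (c0 W z)"
    by (rule c0_prod01[OF assms(2,3,5,6)])
  obtain c v c' v' c'' v'' where x: "x = (c, v)" "c \<in> carrier (C1 X)" "v \<in> carrier X"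
    and y: "y = (c', v')" "c' \<in> carrier (C1 V)" "v' \<in> carrier V"
    and z: "z = (c'', v'')" "c'' \<in> carrier (C1 W)" "v'' \<in> carrier W"
    using assms(4-6) by (elim G_cases)
  note s = st_closed[OF assms(1) x(3)] st_closed[OF assms(2) y(3)]
  note cl = m10_closed[OF assms(1,2) x(2) Y] m01_closed[OF assms(1,2) s(1) y(2)]
    m10_closed[OF assms(2,3) y(2) Z] m01_closed[OF assms(2,3) s(2) z(2)]
  have "A1 (T (T X V) W) (T X (T V W)) (associator R K X V W)
      (m10 \<mu> (T X V) W (m10 \<mu> X V c (c0 V y) \<oplus>\<^bsub>C1 (T X V)\<^esub> m01 \<mu> X V (st X v) c') (c0 W z) \<oplus>\<^bsub>C1 (T (T X V) W)\<^esub>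
        m01 \<mu> (T X V) W (st (T X V) (t X V v v')) c'') =
      m10 \<mu> X (T V W) c (m00 \<mu> V W (c0 V y) (c0 W z)) \<oplus>\<^bsub>C1 (T X (T V W))\<^esub>
        m01 \<mu> X (T V W) (st X v) (m10 \<mu> V W c' (c0 W z) \<oplus>\<^bsub>C1 (T V W)\<^esub> m01 \<mu> V W (st V v') c'')"
    using assms(1-3) PT x y z Y Z s cl
    by (simp add: st_mult[symmetric] m10_add m01_add m10_closed m01_closed m00_closed mod_hom_add[OF A1_hom[OF PT(3,4) hom]]
        m10_assoc[OF assms(1-3)] m01_assoc[OF assms(1-3)] m01_m10_assoc[OF assms(1-3)] N.a_assoc)
  then show ?thesis
    using assms(1-3) PT x y z Y Z s cl
    by (simp add: prod01_def c0yz[unfolded y(1) z(1) prod01_eq] AG_eq m10_closed m01_closed st_closed tens_closed associator_tens)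
qed

section \<open>Multiplicative splittings\<close>

text \<open>
  The action of a ring \<open>S\<close> on \<open>C\<^sub>0\<^sub>1\<close> through a homomorphism to the square-zero extension makes the canonical
  splitting multiplicative over \<open>S\<close>. The integers and the square-zero extension itself are the cases of interest.
\<close>

context
  fixes S :: "'s ring" and \<sigma> :: "'s \<Rightarrow> ('r, 'v) module \<Rightarrow> 'c1 \<times> 'v \<Rightarrow> 'c1 \<times> 'v" and f :: "'s \<Rightarrow> 'r"
    and act :: "('r, 'v) module \<Rightarrow> 's \<Rightarrow> 'c1 \<times> 'v \<Rightarrow> 'c1 \<times> 'v"
  assumes S: "cring S" and \<sigma>: "\<sigma> \<in> ring_hom S E"
    and act: "\<And>V r x. V \<in> P \<Longrightarrow> r \<in> carrier S \<Longrightarrow> x \<in> carrier (G V) \<Longrightarrow> act V r x = \<sigma> r V x"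
    and f: "\<And>r. r \<in> carrier S \<Longrightarrow> f r = q (\<sigma> r)"
begin

interpretation S: cring S by (rule S)

abbreviation F where "F \<equiv> C01_functor R K \<phi> \<mu> act"
abbreviation Cl where "Cl \<equiv> \<lparr>deg1 = restrict_functor f (deg1 \<phi>), deg0 = F, diff = c1\<rparr>"
abbreviation \<nu> where "\<nu> \<equiv> C01_mult R K \<phi> \<mu> S act"

lemma \<sigma>_closed: "r \<in> carrier S \<Longrightarrow> \<sigma> r \<in> carrier E"
  by (rule ring_hom_closed[OF \<sigma>])

lemma f_hom: "f \<in> ring_hom S R"
  using \<sigma>_closed ring_hom_add[OF \<sigma>] ring_hom_mult[OF \<sigma>] ring_hom_one[OF \<sigma>]
  by (intro ring_hom_memI) (simp_all add: f q_closed q_add q_mult q_one)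

lemma f_closed: "r \<in> carrier S \<Longrightarrow> f r \<in> carrier R"
  by (rule ring_hom_closed[OF f_hom])

lemma act_closed: "V \<in> P \<Longrightarrow> r \<in> carrier S \<Longrightarrow> x \<in> carrier (G V) \<Longrightarrow> act V r x \<in> carrier (G V)"
  by (simp add: act ext_closed \<sigma>_closed)

lemma F_module:
  assumes V: "V \<in> P"
  shows "module S (Ob F V)"
proof (rule moduleI[OF S])
  show "abelian_group (Ob F V)"
    by (rule abelian_group_transfer[OF G_abelian[OF V]]) simp_all
  fix r r' x assume r: "r \<in> carrier S" "r' \<in> carrier S" and x: "x \<in> carrier (Ob F V)"
  show "(r \<oplus>\<^bsub>S\<^esub> r') \<odot>\<^bsub>Ob F V\<^esub> x = r \<odot>\<^bsub>Ob F V\<^esub> x \<oplus>\<^bsub>Ob F V\<^esub> r' \<odot>\<^bsub>Ob F V\<^esub> x"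
    using V r x by (simp add: act ring_hom_add[OF \<sigma>] ext_ring_simps)
  show "(r \<otimes>\<^bsub>S\<^esub> r') \<odot>\<^bsub>Ob F V\<^esub> x = r \<odot>\<^bsub>Ob F V\<^esub> (r' \<odot>\<^bsub>Ob F V\<^esub> x)"
    using V r x by (simp add: act act_closed[unfolded act] ext_closed \<sigma>_closed ring_hom_mult[OF \<sigma>] ext_ring_simps)
qed (use V in \<open>simp_all add: act_closed act ext_add \<sigma>_closed ext_closed ring_hom_one[OF \<sigma>] ext_ring_simps abelian_groupE(1)[OF G_abelian]\<close>)

lemma F_pointed: "pointed_functor R S F"
  unfolding pointed_functor_def
proof (intro conjI ballI impI)
  show "module S (Ob F V)" if "V \<in> P" for V by (rule F_module[OF that])
  show "Ar F V W h \<in> mod_hom S (Ob F V) (Ob F W)" if "V \<in> P" "W \<in> P" "h \<in> mod_hom R V W" for V W h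
    using that by (intro mod_homI)
      (simp_all add: AG_closed AG_add AG_extensional act ext_nat[OF \<sigma>_closed])
  show "Ar F V V (\<lambda>v\<in>carrier V. v) = (\<lambda>x\<in>carrier (Ob F V). x)" if "V \<in> P" for V
    using AG_extensional[of V V] that
    by (intro extensionalityI[of _ "carrier (G V)"]) (auto elim!: G_cases simp: AG_eq A1_id)
  show "Ar F X W (compose (carrier X) g h) = compose (carrier (Ob F X)) (Ar F V W g) (Ar F X V h)"
    if V: "X \<in> P" "V \<in> P" "W \<in> P" and h: "h \<in> mod_hom R X V" "g \<in> mod_hom R V W" for X V W h g
    using AG_extensional[of X W]
  proof (intro extensionalityI[of _ "carrier (G X)"])
    fix x assume "x \<in> carrier (G X)"
    then obtain c v where x: "x = (c, v)" "c \<in> carrier (C1 X)" "v \<in> carrier X" by (rule G_cases)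
    show "Ar F X W (compose (carrier X) g h) x = compose (carrier (Ob F X)) (Ar F V W g) (Ar F X V h) x"
      using x \<open>x \<in> carrier (G X)\<close> V h
      by (simp add: compose_eq AG_eq A1_closed mod_hom_closed[OF h(1)] A1_comp[OF V h])
  qed (simp_all add: compose_def)
  show "carrier (Ob F V) = {\<zero>\<^bsub>Ob F V\<^esub>}" if "V \<in> P" "carrier V = {\<zero>\<^bsub>V\<^esub>}" for V
    using that pointed_functorD(5)[OF pointed(1) that] by (simp add: G_simps)
qed

lemma c1_trans: "c1 \<in> nat_trans R S (restrict_functor f (deg1 \<phi>)) F"
  unfolding nat_trans_def
proof (intro CollectI conjI ballI)
  show "c1 \<in> extensional P" by (simp add: C01_c1_def)
  show "c1 V \<in> mod_hom S (Ob (restrict_functor f (deg1 \<phi>)) V) (Ob F V)" if V: "V \<in> P" for V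
  proof (rule mod_homI)
    show "c1 V \<in> extensional (carrier (Ob (restrict_functor f (deg1 \<phi>)) V))"
      using V by (simp add: C01_c1_def)
  qed (use V in \<open>simp_all add: c1_closed c1_add act ext_c1[OF \<sigma>_closed] f\<close>)
qed (simp add: AG_c1)

lemma c0_trans: "c0 \<in> nat_trans R S F (restrict_functor f (deg0 \<phi>))"
  unfolding nat_trans_def
proof (intro CollectI conjI ballI)
  show "c0 \<in> extensional P" by (simp add: C01_c0_def)
  show "c0 V \<in> mod_hom S (Ob F V) (Ob (restrict_functor f (deg0 \<phi>)) V)" if V: "V \<in> P" for V
  proof (rule mod_homI)
    show "c0 V \<in> extensional (carrier (Ob F V))"
      using V by (simp add: C01_c0_def)
  qed (use V in \<open>simp_all add: c0_closed c0_add act c0_ext[OF \<sigma>_closed] f\<close>)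
qed (simp add: AG_c0)

lemma is_splitting: "splitting R S (restrict_functor f (tensor_functor R M)) (restrict_elext f \<phi>) F c0 c1"
  unfolding splitting_def
proof (intro conjI ballI)
  fix V assume V: "V \<in> P"
  show "inj_on (c1 V) (carrier (Ob (deg1 (restrict_elext f \<phi>)) V))"
    using V by (intro inj_onI) (simp add: c1_eq)
  show "{y \<in> carrier (Ob F V). c0 V y = \<zero>\<^bsub>Ob (deg0 (restrict_elext f \<phi>)) V\<^esub>} =
      c1 V ` inc (restrict_elext f \<phi>) V ` carrier (Ob (restrict_functor f (tensor_functor R M)) V)"
  proof (intro equalityI subsetI)
    fix y assume "y \<in> {y \<in> carrier (Ob F V). c0 V y = \<zero>\<^bsub>Ob (deg0 (restrict_elext f \<phi>)) V\<^esub>}"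
    then obtain \<tau> where "\<tau> \<in> carrier (TM V)" "y = c1 V (b V \<tau>)"
      using c0_kernel[OF V, of y] by auto
    then show "y \<in> c1 V ` inc (restrict_elext f \<phi>) V ` carrier (Ob (restrict_functor f (tensor_functor R M)) V)"
      by simp
  next
    fix y assume "y \<in> c1 V ` inc (restrict_elext f \<phi>) V ` carrier (Ob (restrict_functor f (tensor_functor R M)) V)"
    then show "y \<in> {y \<in> carrier (Ob F V). c0 V y = \<zero>\<^bsub>Ob (deg0 (restrict_elext f \<phi>)) V\<^esub>}"
      using V by (auto simp: c1_closed b_closed c0_c1 db)
  qed
qed (simp_all add: F_pointed c1_trans c0_trans c0_surj c0_c1)

lemma is_mult_structure: "mult_structure R K S Cl \<nu>"
  unfolding mult_structure_def
proof (intro conjI)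
  show "cring S" by (rule S)
  show "is_cpx R S Cl"
    by (simp add: is_cpx_def restrict_pointed[OF S f_hom pointed(1)] F_pointed c1_trans)
  interpret FU: module S "Ob F U" by (rule F_module[OF U_proj])
  show "munit \<nu> \<in> mod_hom S (regular_module S) (Ob (deg0 Cl) U)"
  proof (rule mod_homI)
    show "munit \<nu> (r \<oplus>\<^bsub>regular_module S\<^esub> r') = munit \<nu> r \<oplus>\<^bsub>Ob (deg0 Cl) U\<^esub> munit \<nu> r'"
      if "r \<in> carrier (regular_module S)" "r' \<in> carrier (regular_module S)" for r r'
      using FU.smult_l_distr[of r r' "(\<zero>\<^bsub>C1 U\<^esub>, u)"] that one_closed by (simp add: regular_module_def C01_mult_simps)
    show "munit \<nu> (r \<odot>\<^bsub>regular_module S\<^esub> r') = r \<odot>\<^bsub>Ob (deg0 Cl) U\<^esub> munit \<nu> r'"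
      if "r \<in> carrier S" "r' \<in> carrier (regular_module S)" for r r'
      using FU.smult_assoc1[of r r' "(\<zero>\<^bsub>C1 U\<^esub>, u)"] that one_closed by (simp add: regular_module_def C01_mult_simps)
  qed (simp_all add: regular_module_def C01_mult_simps act_closed U_proj one_closed)
  show "mult_bilinear R K S Cl \<nu>"
    unfolding mult_bilinear_def bilinear_map_def
    by (simp add: C01_mult_m00 C01_mult_simps abelian_groupE(1)[OF G_abelian] prod01_closed prod01_add_left prod01_add_right
        act_closed act ext_closed[OF \<sigma>_closed] prod01_ext_left[OF _ _ \<sigma>_closed] prod01_ext_right[OF _ _ \<sigma>_closed]
        m10_closed m01_closed c0_closed m10_add m01_add c0_add c0_ext[OF \<sigma>_closed] m10_smult m01_smult
        f_closed f[symmetric] T_proj)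
  show "mult_functorial R K Cl \<nu>"
    unfolding mult_functorial_def
    by (simp add: C01_mult_m00 C01_mult_simps AG_closed prod01_nat m10_nat m01_nat AG_c0 c0_closed)
  show "mult_chain_map R K Cl \<nu>"
    unfolding mult_chain_map_def
  proof (intro ballI conjI)
    fix V V' assume V: "V \<in> P" "V' \<in> P"
    interpret C1T: abelian_group "C1 (T V V')" by (rule C1_abelian[OF T_proj[OF V]])
    interpret V: abelian_group V by (rule V_abelian[OF V(1)])
    interpret V': abelian_group V' by (rule V_abelian[OF V(2)])
    show "diff Cl (T V V') (m10 \<nu> V V' c x) = m00 \<nu> V V' (diff Cl V c) x"
      if c: "c \<in> carrier (Ob (deg1 Cl) V)" and x: "x \<in> carrier (Ob (deg0 Cl) V')" for c x
    proof -
      have x: "x \<in> carrier (G V')" and c: "c \<in> carrier (C1 V)" using x c by simp_all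
      obtain c' v' where cv: "x = (c', v')" "c' \<in> carrier (C1 V')" "v' \<in> carrier V'" using x by (rule G_cases)
      have "c0 V' (c', v') \<in> carrier (C0 V')" using x cv V by (simp add: c0_closed)
      then show ?thesis
        using V x c cv c1_closed[OF V(1) c]
        by (simp add: C01_mult_m00 C01_mult_simps c1_eq prod01_eq st_zero m01_zero tens_zero_left m10_closed T_proj)
    qed
    show "diff Cl (T V V') (m01 \<nu> V V' x c) = m00 \<nu> V V' x (diff Cl V' c)"
      if x: "x \<in> carrier (Ob (deg0 Cl) V)" and c: "c \<in> carrier (Ob (deg1 Cl) V')" for x c
    proof -
      have x: "x \<in> carrier (G V)" and c: "c \<in> carrier (C1 V')" using x c by simp_all
      obtain c' v where cv: "x = (c', v)" "c' \<in> carrier (C1 V)" "v \<in> carrier V" using x by (rule G_cases)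
      have "m01 \<mu> V V' (c0 V (c', v)) c = m10 \<mu> V V' c' (d V' c) \<oplus>\<^bsub>C1 (T V V')\<^esub> m01 \<mu> V V' (st V v) c"
        using V cv c by (simp add: c0_eq m01_add m10_d d_closed st_closed)
      moreover have "c0 V' (c, \<zero>\<^bsub>V'\<^esub>) = d V' c" using c0_c1[OF V(2) c] c1_eq[OF V(2) c] by simp
      ultimately show ?thesis
        using V x c cv c1_closed[OF V(2) c]
        by (simp add: C01_mult_m00 C01_mult_simps c1_eq prod01_eq tens_zero_right m10_closed m01_closed d_closed st_closed T_proj)
    qed
  qed (simp add: C01_mult_simps c0_c1 m10_d)
  show "mult_associative R K Cl \<nu>"
    unfolding mult_associative_def Let_def
    by (simp add: C01_mult_m00 C01_mult_simps prod01_closed T_proj prod01_assoc c0_prod01 m10_assoc m01_assoc m01_m10_assoc c0_closed)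
  have one: "munit \<nu> \<one>\<^bsub>S\<^esub> = (\<zero>\<^bsub>C1 U\<^esub>, u)"
    using one_closed U_proj by (simp add: C01_mult_simps act ring_hom_one[OF \<sigma>] ext_ring_simps)
  show "mult_unital R K S Cl \<nu>"
    unfolding mult_unital_def Let_def one
    by (simp add: C01_mult_m00 C01_mult_simps one_closed U_proj prod01_one_left prod01_one_right c0_one m01_unit_left m10_unit_right)
qed

lemma is_multiplicative_splitting:
  "multiplicative_splitting R K S (restrict_functor f (tensor_functor R M)) (restrict_elext f \<phi>) (restrict_mult S f \<mu>)
    F c0 c1 \<nu>"
  unfolding multiplicative_splitting_def Let_def
proof (intro conjI)
  show "splitting R S (restrict_functor f (tensor_functor R M)) (restrict_elext f \<phi>) F c0 c1" by (rule is_splitting)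
  show "mult_structure R K S \<lparr>deg1 = deg1 (restrict_elext f \<phi>), deg0 = F, diff = c1\<rparr> \<nu>"
    using is_mult_structure by simp
  have id: "(\<lambda>V\<in>P. \<lambda>x\<in>carrier (C1 V). x) \<in> nat_trans R S (restrict_functor f (deg1 \<phi>)) (restrict_functor f (deg1 \<phi>))"
    unfolding nat_trans_def
  proof (intro CollectI conjI ballI)
    show "(\<lambda>V\<in>P. \<lambda>x\<in>carrier (C1 V). x) V \<in>
        mod_hom S (Ob (restrict_functor f (deg1 \<phi>)) V) (Ob (restrict_functor f (deg1 \<phi>)) V)" if "V \<in> P" for V
      using mod_hom_id[OF restrict_module[OF S f_hom C1_module[OF that]]] that by simp
  qed (simp_all add: A1_closed)
  show "multiplicative_map R K S \<lparr>deg1 = deg1 (restrict_elext f \<phi>), deg0 = F, diff = c1\<rparr> \<nu>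
      (restrict_elext f \<phi>) (restrict_mult S f \<mu>)
      (\<lambda>V\<in>P. \<lambda>x\<in>carrier (Ob (deg1 (restrict_elext f \<phi>)) V). x) c0"
    unfolding multiplicative_map_def
  proof (intro conjI ballI)
    fix r assume r: "r \<in> carrier S"
    show "c0 U (munit \<nu> r) = munit (restrict_mult S f \<mu>) r"
      using r by (simp add: C01_mult_simps act U_proj one_closed c0_ext[OF \<sigma>_closed] c0_one munit_eq[OF f_closed[OF r]] flip: f)
  qed (simp_all add: id c0_trans c0_c1 C01_mult_m00 C01_mult_simps c0_prod01 T_proj m10_closed m01_closed c0_closed)
qed

end

subsection \<open>The action of the integers\<close>

definition int_act :: "int \<Rightarrow> ('r, 'v) module \<Rightarrow> 'c1 \<times> 'v \<Rightarrow> 'c1 \<times> 'v"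
  where "int_act n = (\<lambda>V\<in>P. \<lambda>x\<in>carrier (G V). add_pow (G V) n x)"

lemma from_int_smult:
  assumes "module R X" "x \<in> carrier X"
  shows "from_int R n \<odot>\<^bsub>X\<^esub> x = add_pow X n x"
proof -
  interpret X: module R X by fact
  show ?thesis
    using additive_int_pow[OF R.abelian_group_axioms X.abelian_group_axioms, of "\<lambda>r. r \<odot>\<^bsub>X\<^esub> x" "\<one>\<^bsub>R\<^esub>" n] assms(2)
    by (simp add: from_int_def X.smult_l_distr)
qed

lemma G_pow:
  assumes "V \<in> P" "x \<in> carrier (G V)"
  shows "add_pow (G V) (n::int) x \<in> carrier (G V)"
    and "y \<in> carrier (G V) \<Longrightarrow> add_pow (G V) n (x \<oplus>\<^bsub>G V\<^esub> y) = add_pow (G V) n x \<oplus>\<^bsub>G V\<^esub> add_pow (G V) n y"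
    and "add_pow (G V) (n + k) x = add_pow (G V) n x \<oplus>\<^bsub>G V\<^esub> add_pow (G V) k x"
    and "add_pow (G V) (n * k) x = add_pow (G V) n (add_pow (G V) k x)"
    and "add_pow (G V) (1::int) x = x"
proof -
  interpret G: abelian_group "G V" by (rule G_abelian[OF assms(1)])
  show "add_pow (G V) n x \<in> carrier (G V)" using assms by simp
  show "add_pow (G V) n (x \<oplus>\<^bsub>G V\<^esub> y) = add_pow (G V) n x \<oplus>\<^bsub>G V\<^esub> add_pow (G V) n y" if "y \<in> carrier (G V)"
    using assms that by (rule_tac G.add.int_pow_distrib) simp_all
  show "add_pow (G V) (n + k) x = add_pow (G V) n x \<oplus>\<^bsub>G V\<^esub> add_pow (G V) k x"
    using assms by (simp add: G.add.int_pow_mult)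
  show "add_pow (G V) (n * k) x = add_pow (G V) n (add_pow (G V) k x)"
    using assms by (simp add: G.add.int_pow_pow mult.commute)
  show "add_pow (G V) (1::int) x = x" using assms by (simp add: G.add.int_pow_1)
qed

lemma int_act_mem: "int_act n \<in> carrier E \<and> q (int_act n) = from_int R n"
proof (rule extI)
  show "from_int R n \<in> carrier R" by (simp add: from_int_def)
  fix V x assume V: "V \<in> P" and x: "x \<in> carrier (G V)"
  show "int_act n W (AG V W h x) = AG V W h (int_act n V x)" if W: "W \<in> P" and h: "h \<in> mod_hom R V W" for W h
    using V x W h additive_int_pow[OF G_abelian[OF V] G_abelian[OF W], of "AG V W h"]
    by (simp add: int_act_def AG_closed AG_add)
  show "c0 V (int_act n V x) = from_int R n \<odot>\<^bsub>C0 V\<^esub> c0 V x"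
    using V x additive_int_pow[OF G_abelian[OF V] C0_abelian[OF V], of "c0 V"]
    by (simp add: int_act_def from_int_smult C0_module c0_closed c0_add)
next
  fix V c assume V: "V \<in> P" and c: "c \<in> carrier (C1 V)"
  show "int_act n V (c1 V c) = c1 V (from_int R n \<odot>\<^bsub>C1 V\<^esub> c)"
    using V c additive_int_pow[OF C1_abelian[OF V] G_abelian[OF V], of "c1 V"]
    by (simp add: int_act_def from_int_smult C1_module c1_closed c1_add)
qed (simp_all add: int_act_def G_pow abelian_groupE(1)[OF G_abelian])

lemma int_act_hom: "int_act \<in> ring_hom \<Z> E"
proof (rule ring_hom_memI)
  fix n k :: int
  show "int_act n \<in> carrier E" using int_act_mem by blast
  show "int_act (n \<otimes>\<^bsub>\<Z>\<^esub> k) = int_act n \<otimes>\<^bsub>E\<^esub> int_act k"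
    by (rule ext_eqI) (simp_all add: int_act_mem ext_mult_closed ext_ring_simps, simp add: int_act_def G_pow)
  show "int_act (n \<oplus>\<^bsub>\<Z>\<^esub> k) = int_act n \<oplus>\<^bsub>E\<^esub> int_act k"
    by (rule ext_eqI) (simp_all add: int_act_mem ext_add_closed ext_ring_simps, simp add: int_act_def G_pow)
  show "int_act \<one>\<^bsub>\<Z>\<^esub> = \<one>\<^bsub>E\<^esub>"
    by (rule ext_eqI) (simp_all add: int_act_mem ext_one_closed ext_ring_simps, simp add: int_act_def G_pow)
qed

end

theorem proposition5p7:
  fixes R :: "'r ring"
    and K :: "('r, 'v) tensor_data"
    and M :: "('r, 'm) bimodule"
    and \<phi> :: "('r, 'v, 'r, 'c1, 'c0, 'v, (('m \<times> 'v) \<Rightarrow>\<^sub>0 int) set) elext"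
    and \<mu> :: "('r, 'v, 'r, 'c1, 'c0) mult_data"
  assumes "cring R"
    and "is_tensor_data R K"
    and "is_bimodule R M"
    and "multiplicative_extension R K M \<phi> \<mu>"
  shows "let R' = ext_ring R K \<phi> \<mu>; q = ext_proj R K \<phi> \<mu>; i = ext_incl R K M \<phi> \<mu>;
             zact = (\<lambda>V n x. add_pow (C01_group R K \<phi> \<mu> V) n x);
             act = (\<lambda>V r' x. r' V x)
         in
           square_zero_extension R M R' i q \<and>
           multiplicative_splitting R K \<Z>
             (restrict_functor (from_int R) (tensor_functor R M))
             (restrict_elext (from_int R) \<phi>) (restrict_mult \<Z> (from_int R) \<mu>)
             (C01_int R K \<phi> \<mu>) (C01_c0 R K \<phi> \<mu>) (C01_c1 R \<phi>)
             (C01_mult R K \<phi> \<mu> \<Z> zact) \<and>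
           cring R' \<and>
           multiplicative_splitting R K R'
             (restrict_functor q (tensor_functor R M))
             (restrict_elext q \<phi>) (restrict_mult R' q \<mu>)
             (C01_functor R K \<phi> \<mu> act) (C01_c0 R K \<phi> \<mu>) (C01_c1 R \<phi>)
             (C01_mult R K \<phi> \<mu> R' act)"
proof -
  interpret mult_ext R K M \<phi> \<mu>
    using assms by (intro mult_ext.intro proj_tensor.intro mult_ext_axioms.intro)
  have "multiplicative_splitting R K \<Z> (restrict_functor (from_int R) (tensor_functor R M))
      (restrict_elext (from_int R) \<phi>) (restrict_mult \<Z> (from_int R) \<mu>) CI c0 c1
      (C01_mult R K \<phi> \<mu> \<Z> (\<lambda>V n x. add_pow (G V) n x))"
    unfolding C01_int_def
    by (rule is_multiplicative_splitting[OF int_is_cring int_act_hom])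
      (simp_all add: int_act_def int_act_mem[unfolded int_act_def])
  moreover have "multiplicative_splitting R K E (restrict_functor q (tensor_functor R M))
      (restrict_elext q \<phi>) (restrict_mult E q \<mu>) (C01_functor R K \<phi> \<mu> (\<lambda>V r' x. r' V x)) c0 c1
      (C01_mult R K \<phi> \<mu> E (\<lambda>V r' x. r' V x))"
    by (rule is_multiplicative_splitting[OF ext_cring, where \<sigma> = "\<lambda>r'. r'"])
      (simp_all add: ring_hom_def Pi_def)
  ultimately show ?thesis
    unfolding Let_def using square_zero ext_cring by blast
qed

end
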